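(* Let $A$ be the Hahn ring and $\Theta=K/I_{>0}$. An $A$-module $M$ is $\Theta$-reflexive if and only if it is multibasic. Moreover, every multibasic $A$-module has a unique decomposition as a finite direct sum of basic submodules, up to isomorphism of the summands and the ordering of the summands: if $M=\bigoplus_{i=1}^m M_i=\bigoplus_{j=1}^n N_j$ with all $M_i,N_j$ basic, then $m=n$ and there is a permutation $\sigma$ with $M_i\cong N_{\sigma(i)}$ for all $i$.
   Context: $\mathbb{F}$ is the field of order $2$. $K$ is the field of Hahn series with value group $\mathbb{R}$ and residue field $\mathbb{F}$: elements are maps $a:\mathbb{R}\to\mathbb{F}$ whose support $\operatorname{supp}(a)=\{q:a_q=1\}$ is a well-ordered subset of $\mathbb{R}$, thought of as formal series $\sum_q a_qt^q$, with pointwise addition and multiplication $(ab)_q=\sum_{u+v=q}a_ub_v$. The valuation is $\nu(a)=\min(\operatorname{supp}(a))$ for $a\ne0$, $\nu(0)=\infty$. The Hahn ring is $A=\{a\in K:\nu(a)\ge0\}$, and $I_{>0}=\{a\in K:\nu(a)>0\}$. For an $A$-module $M$ let $D(M)=\operatorname{Hom}_A(M,\Theta)$ and $\chi_M:M\to D^2M$, $\chi_M(m)(\alpha)=\alpha(m)$. $M$ is $\Theta$-reflexive if $\chi_M$ is an isomorphism. An $A$-module $M$ is basic if it is non-zero and for all $x,y\in M$ we have $x\in Ay$ or $y\in Ax$; it is multibasic if it is the direct sum of a finite (possibly empty) list of basic submodules. *)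

theory Defs
  imports "HOL-Library.Z2" "HOL-Library.Extended_Real" "HOL-Algebra.Algebra"
begin

section \<open>The Hahn field, the Hahn ring and the module \<open>\<Theta>\<close>\<close>

text \<open>
  The field of order 2 is the type \<open>bit\<close>.  A Hahn series is its coefficient function
  \<open>real \<Rightarrow> bit\<close>.
\<close>

type_synonym hahn = "real \<Rightarrow> bit"

definition supp :: "hahn \<Rightarrow> real set" where
  "supp a = {q. a q = 1}"

definition hahn_series :: "hahn set" where
  "hahn_series = {a. well_order_on (supp a) (relation_of (\<le>) (supp a))}"

text \<open>
  The index set of the convolution sum is restricted to the pairs contributing a non-zero term;
  it is finite when \<open>a\<close> and \<open>b\<close> have well-ordered support.
\<close>

definition hahn_mult :: "hahn \<Rightarrow> hahn \<Rightarrow> hahn" where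
  "hahn_mult a b = (\<lambda>q. \<Sum>(u, v) \<in> {(u, v). u \<in> supp a \<and> v \<in> supp b \<and> u + v = q}. a u * b v)"

definition hahn_field :: "hahn ring" where
  "hahn_field =
     \<lparr>carrier = hahn_series, monoid.mult = hahn_mult, one = (\<lambda>q. if q = 0 then 1 else 0),
      ring.zero = (\<lambda>_. 0), ring.add = (\<lambda>a b q. a q + b q)\<rparr>"

text \<open>\<open>LEAST q. q \<in> supp a\<close> is the minimum of the support when \<open>a\<close> is a non-zero Hahn series.\<close>

definition hahn_val :: "hahn \<Rightarrow> ereal" where
  "hahn_val a = (if a = \<zero>\<^bsub>hahn_field\<^esub> then \<infinity> else ereal (LEAST q. q \<in> supp a))"

definition hahn_ring :: "hahn ring" where
  "hahn_ring = hahn_field\<lparr>carrier := {a \<in> carrier hahn_field. hahn_val a \<ge> 0}\<rparr>"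

definition I_pos :: "hahn set" where
  "I_pos = {a \<in> carrier hahn_field. hahn_val a > 0}"

text \<open>
  The library's module record extends the ring record; in a module the fields \<open>mult\<close> and \<open>one\<close>
  carry no meaning, and they are left unspecified below.
\<close>

definition hahn_field_module :: "(hahn, hahn) module" where
  "hahn_field_module =
     \<lparr>carrier = carrier hahn_field, monoid.mult = undefined, one = undefined,
      ring.zero = ring.zero hahn_field, ring.add = ring.add hahn_field,
      smult = monoid.mult hahn_field\<rparr>"

definition quotient_module ::
    "('r, 's) ring_scheme \<Rightarrow> ('r, 'm, 'x) module_scheme \<Rightarrow> 'm set \<Rightarrow> ('r, 'm set) module" where
  "quotient_module R M N =
     \<lparr>carrier = a_rcosets\<^bsub>M\<^esub> N, monoid.mult = undefined, one = undefined,
      ring.zero = N, ring.add = set_add M,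
      smult = (\<lambda>a C. \<Union>x\<in>C. N +>\<^bsub>M\<^esub> (a \<odot>\<^bsub>M\<^esub> x))\<rparr>"

definition Theta :: "(hahn, hahn set) module" where
  "Theta = quotient_module hahn_ring hahn_field_module I_pos"


section \<open>Module homomorphisms, duals and reflexivity\<close>

definition mod_hom ::
    "('r, 's) ring_scheme \<Rightarrow> ('r, 'm, 'x) module_scheme \<Rightarrow> ('r, 'n, 'y) module_scheme
      \<Rightarrow> ('m \<Rightarrow> 'n) set" where
  "mod_hom R M N =
     {f \<in> carrier M \<rightarrow> carrier N.
        (\<forall>x\<in>carrier M. \<forall>y\<in>carrier M. f (x \<oplus>\<^bsub>M\<^esub> y) = f x \<oplus>\<^bsub>N\<^esub> f y) \<and>
        (\<forall>a\<in>carrier R. \<forall>x\<in>carrier M. f (a \<odot>\<^bsub>M\<^esub> x) = a \<odot>\<^bsub>N\<^esub> f x)}"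

definition mod_iso ::
    "('r, 's) ring_scheme \<Rightarrow> ('r, 'm, 'x) module_scheme \<Rightarrow> ('r, 'n, 'y) module_scheme
      \<Rightarrow> ('m \<Rightarrow> 'n) set" where
  "mod_iso R M N = {f \<in> mod_hom R M N. bij_betw f (carrier M) (carrier N)}"

definition mod_isomorphic ::
    "('r, 's) ring_scheme \<Rightarrow> ('r, 'm, 'x) module_scheme \<Rightarrow> ('r, 'n, 'y) module_scheme \<Rightarrow> bool" where
  "mod_isomorphic R M N \<longleftrightarrow> mod_iso R M N \<noteq> {}"

text \<open>
  Elements of the Hom module are taken to be extensional, so that each homomorphism on
  \<open>carrier M\<close> is represented by exactly one HOL function.
\<close>

definition Hom_module ::
    "('r, 's) ring_scheme \<Rightarrow> ('r, 'm, 'x) module_scheme \<Rightarrow> ('r, 'n, 'y) module_scheme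
      \<Rightarrow> ('r, 'm \<Rightarrow> 'n) module" where
  "Hom_module R M N =
     \<lparr>carrier = mod_hom R M N \<inter> extensional (carrier M), monoid.mult = undefined, one = undefined,
      ring.zero = (\<lambda>x\<in>carrier M. \<zero>\<^bsub>N\<^esub>),
      ring.add = (\<lambda>f g. \<lambda>x\<in>carrier M. f x \<oplus>\<^bsub>N\<^esub> g x),
      smult = (\<lambda>a f. \<lambda>x\<in>carrier M. a \<odot>\<^bsub>N\<^esub> f x)\<rparr>"

definition dual :: "(hahn, 'm, 'x) module_scheme \<Rightarrow> (hahn, 'm \<Rightarrow> hahn set) module" where
  "dual M = Hom_module hahn_ring M Theta"

definition chi ::
    "(hahn, 'm, 'x) module_scheme \<Rightarrow> 'm \<Rightarrow> ('m \<Rightarrow> hahn set) \<Rightarrow> hahn set" where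
  "chi M m = (\<lambda>\<alpha>\<in>carrier (dual M). \<alpha> m)"

definition Theta_reflexive :: "(hahn, 'm, 'x) module_scheme \<Rightarrow> bool" where
  "Theta_reflexive M \<longleftrightarrow> chi M \<in> mod_iso hahn_ring M (dual (dual M))"


section \<open>Basic and multibasic modules\<close>

definition basic_module :: "('r, 's) ring_scheme \<Rightarrow> ('r, 'm, 'x) module_scheme \<Rightarrow> bool" where
  "basic_module R M \<longleftrightarrow>
     carrier M \<noteq> {\<zero>\<^bsub>M\<^esub>} \<and>
     (\<forall>x\<in>carrier M. \<forall>y\<in>carrier M.
        (\<exists>a\<in>carrier R. x = a \<odot>\<^bsub>M\<^esub> y) \<or> (\<exists>a\<in>carrier R. y = a \<odot>\<^bsub>M\<^esub> x))"

text \<open>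
  \<open>M\<close> is the internal direct sum of the submodules \<open>N 0, \<dots>, N (n - 1)\<close>; for \<open>n = 0\<close> this
  says that \<open>M\<close> is zero.
\<close>

definition is_direct_sum ::
    "('r, 's) ring_scheme \<Rightarrow> ('r, 'm, 'x) module_scheme \<Rightarrow> nat \<Rightarrow> (nat \<Rightarrow> 'm set) \<Rightarrow> bool" where
  "is_direct_sum R M n N \<longleftrightarrow>
     (\<forall>i<n. submodule (N i) R M) \<and>
     (\<forall>x\<in>carrier M. \<exists>!f. f \<in> (\<Pi>\<^sub>E i\<in>{..<n}. N i) \<and> x = (\<Oplus>\<^bsub>M\<^esub>i\<in>{..<n}. f i))"

definition basic_decomposition ::
    "('r, 's) ring_scheme \<Rightarrow> ('r, 'm, 'x) module_scheme \<Rightarrow> nat \<Rightarrow> (nat \<Rightarrow> 'm set) \<Rightarrow> bool" where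
  "basic_decomposition R M n N \<longleftrightarrow>
     is_direct_sum R M n N \<and> (\<forall>i<n. basic_module R (M\<lparr>carrier := N i\<rparr>))"

definition multibasic :: "('r, 's) ring_scheme \<Rightarrow> ('r, 'm, 'x) module_scheme \<Rightarrow> bool" where
  "multibasic R M \<longleftrightarrow> (\<exists>n N. basic_decomposition R M n N)"

end

theory Submission
  imports Defs
begin

text \<open>
  Both properties are equivalent to linear compactness: every chain of cosets has non-empty intersection.

  Since \<open>K\<close> is spherically complete, every homomorphism from a submodule of \<open>K\<close> to \<open>\<Theta>\<close> is multiplication by
  an element of \<open>K\<close>. Hence \<open>\<Theta>\<close> is an injective cogenerator, reflexive modules are linearly compact, and
  subquotients of \<open>K\<close>, in particular basic modules, are reflexive.

  Conversely, a non-zero linearly compact module over a valuation ring has an element whose divisibility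
  and annihilator behave as in a basic summand; dividing it as far as possible gives a pure basic
  submodule. A pure basic submodule splits off, and this can be repeated only finitely often because an
  infinite direct sum is not linearly compact. Uniqueness is the Krull-Schmidt exchange argument: over a
  commutative local ring the non-automorphisms of a basic module are closed under addition.
\<close>

section \<open>Modules over a valuation ring of characteristic 2\<close>

text \<open>The structure theory runs over any commutative ring with the three properties of
  \<open>val_ring\<close>. Characteristic 2 removes all signs: cosets are the sets closed under x +
  a (y + z), and two elements are equal if their sum vanishes. The third property is what remains of
  the value group being \<real>: subsets of \<real> have countable cofinality, so a basic module,
  not cyclic in general, is still the union of an increasing sequence of cyclic ones. Division "as
  far as possible" is therefore dependent choice along the natural numbers, without limit stages.
  The obstacle in the splitting step is that linear compactness solves only systems of cosets that
  form a chain. A candidate u for the projection of m to a pure basic submodule U must satisfy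
  conditions of the shape n + a u in c U. That any two of them are comparable is not visible from
  their form; it follows from purity together with the comparability of elements of U.\<close>

locale val_ring = R?: cring R for R (structure) +
  assumes char2: "\<one> \<oplus> \<one> = \<zero>"
    and divides_total: "\<lbrakk>a \<in> carrier R; b \<in> carrier R\<rbrakk> \<Longrightarrow>
      (\<exists>c\<in>carrier R. a = b \<otimes> c) \<or> (\<exists>c\<in>carrier R. b = a \<otimes> c)"
    and cofinal_seq: "\<lbrakk>H \<subseteq> carrier R; H \<noteq> {}\<rbrakk> \<Longrightarrow>
      \<exists>c::nat \<Rightarrow> 'a. (\<forall>k. c k \<in> H \<and> (\<exists>d\<in>carrier R. c (Suc k) = c k \<otimes> d)) \<and>
        (\<forall>h\<in>H. \<exists>k. \<exists>d\<in>carrier R. c k = h \<otimes> d)"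

locale val_module = val_ring R + module R M for R and M (structure)
begin

lemma add_self [simp]: "x \<in> carrier M \<Longrightarrow> x \<oplus> x = \<zero>"
  using smult_l_distr[of "\<one>\<^bsub>R\<^esub>" "\<one>\<^bsub>R\<^esub>" x] by (simp add: char2)

lemma add_add_self [simp]:
  "\<lbrakk>x \<in> carrier M; y \<in> carrier M\<rbrakk> \<Longrightarrow> x \<oplus> (x \<oplus> y) = y"
  by (simp flip: M.a_assoc)

lemma add_eq_zero_iff:
  "\<lbrakk>x \<in> carrier M; y \<in> carrier M\<rbrakk> \<Longrightarrow> x \<oplus> y = \<zero> \<longleftrightarrow> x = y"
  by (metis add_add_self M.r_zero add_self)

lemma minus_eq_self [simp]: "x \<in> carrier M \<Longrightarrow> \<ominus> x = x"
  by (simp add: M.minus_equality)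

lemma smult_commute:
  "\<lbrakk>a \<in> carrier R; b \<in> carrier R; x \<in> carrier M\<rbrakk> \<Longrightarrow> a \<odot> (b \<odot> x) = b \<odot> (a \<odot> x)"
  by (metis R.m_comm smult_assoc1)

lemma submodule_iff:
  "submodule N R M \<longleftrightarrow> N \<subseteq> carrier M \<and> \<zero> \<in> N \<and> (\<forall>x\<in>N. \<forall>y\<in>N. x \<oplus> y \<in> N) \<and>
     (\<forall>a\<in>carrier R. \<forall>x\<in>N. a \<odot> x \<in> N)"
  (is "_ \<longleftrightarrow> ?rhs")
proof
  assume N: "submodule N R M"
  note E = submoduleE[OF N]
  obtain x where "x \<in> N" using E(2) by blast
  then have "\<zero> \<in> N" using E(1) E(4)[of "\<zero>\<^bsub>R\<^esub>" x] by auto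
  then show ?rhs using E by blast
next
  assume ?rhs then show "submodule N R M" by (intro submoduleI) auto
qed

lemma submodule_val_module: "submodule N R M \<Longrightarrow> val_module R (M\<lparr>carrier := N\<rparr>)"
  by (intro val_module.intro val_ring_axioms submodule.submodule_is_module module_axioms)

lemma submodule_restrict_iff:
  assumes N: "submodule N R M"
  shows "submodule U R (M\<lparr>carrier := N\<rparr>) \<longleftrightarrow> submodule U R M \<and> U \<subseteq> N"
proof -
  interpret N: val_module R "M\<lparr>carrier := N\<rparr>" by (rule submodule_val_module[OF N])
  show ?thesis using N unfolding N.submodule_iff submodule_iff by auto
qed

text \<open>If \<open>a\<close> is not a unit, then \<open>1 + a\<close> is a unit, but it annihilates \<open>x\<close>.\<close>

lemma unit_if_fixes:
  assumes a: "a \<in> carrier R" and x: "x \<in> carrier M" and "x \<noteq> \<zero>" and ax: "a \<odot> x = x"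
  shows "\<exists>b\<in>carrier R. a \<otimes>\<^bsub>R\<^esub> b = \<one>\<^bsub>R\<^esub>"
proof -
  have self: "a \<oplus>\<^bsub>R\<^esub> a = \<zero>\<^bsub>R\<^esub>"
    using a char2 R.r_distr[of "\<one>\<^bsub>R\<^esub>" "\<one>\<^bsub>R\<^esub>" a] by (metis R.l_distr R.l_null R.l_one R.one_closed)
  consider c where "c \<in> carrier R" "\<one>\<^bsub>R\<^esub> \<oplus>\<^bsub>R\<^esub> a = a \<otimes>\<^bsub>R\<^esub> c" | c where "c \<in> carrier R" "a = (\<one>\<^bsub>R\<^esub> \<oplus>\<^bsub>R\<^esub> a) \<otimes>\<^bsub>R\<^esub> c"
    using divides_total[of "\<one>\<^bsub>R\<^esub> \<oplus>\<^bsub>R\<^esub> a" a] a by auto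
  then show ?thesis
  proof cases
    case 1
    have "a \<otimes>\<^bsub>R\<^esub> (c \<oplus>\<^bsub>R\<^esub> \<one>\<^bsub>R\<^esub>) = a \<oplus>\<^bsub>R\<^esub> (\<one>\<^bsub>R\<^esub> \<oplus>\<^bsub>R\<^esub> a)"
      using 1 a by (simp add: R.r_distr R.a_comm)
    also have "\<dots> = \<one>\<^bsub>R\<^esub>" using a self by (metis R.a_lcomm R.one_closed R.r_zero)
    finally show ?thesis using 1 by blast
  next
    case 2
    have "a \<odot> x = (c \<otimes>\<^bsub>R\<^esub> (\<one>\<^bsub>R\<^esub> \<oplus>\<^bsub>R\<^esub> a)) \<odot> x" using 2 a by (metis R.m_comm R.add.m_closed R.one_closed)
    also have "\<dots> = c \<odot> (x \<oplus> x)"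
      using 2 a x by (simp add: smult_assoc1 smult_l_distr ax del: add_self)
    finally show ?thesis using 2 x ax \<open>x \<noteq> _\<close> by simp
  qed
qed

text \<open>The scalar \<open>a\<close> fixes the non-zero element b x, hence is a unit, and x is
  its inverse times y. This replaces cancellation of b, which may be a zero divisor on the
  module.\<close>

lemma smult_cancel:
  assumes "a \<in> carrier R" "b \<in> carrier R" "x \<in> carrier M" "y \<in> carrier M"
    and "b \<odot> x = b \<odot> y" "b \<odot> x \<noteq> \<zero>" "y = a \<odot> x"
  shows "\<exists>c\<in>carrier R. x = c \<odot> y"
proof -
  have "a \<odot> (b \<odot> x) = b \<odot> x"
    using assms by (metis R.m_comm smult_assoc1)
  then obtain c where "c \<in> carrier R" "a \<otimes>\<^bsub>R\<^esub> c = \<one>\<^bsub>R\<^esub>"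
    using unit_if_fixes[of a "b \<odot> x"] assms by auto
  then have "x = c \<odot> y"
    using assms by (metis R.m_comm smult_assoc1 smult_one)
  then show ?thesis using \<open>c \<in> _\<close> by blast
qed

end

text \<open>In characteristic 2, the affine sets are the cosets of submodules.\<close>

definition affine :: "('a, 'c) ring_scheme \<Rightarrow> ('a, 'm, 'x) module_scheme \<Rightarrow> 'm set \<Rightarrow> bool" where
  "affine R M S \<longleftrightarrow> S \<subseteq> carrier M \<and> S \<noteq> {} \<and>
     (\<forall>x\<in>S. \<forall>y\<in>S. \<forall>z\<in>S. \<forall>a\<in>carrier R. x \<oplus>\<^bsub>M\<^esub> a \<odot>\<^bsub>M\<^esub> (y \<oplus>\<^bsub>M\<^esub> z) \<in> S)"

text \<open>Chains of cosets take the place of the usual families with the finite intersection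
  property; every family to which the definition is applied below is totally ordered by
  inclusion.\<close>

definition lin_compact :: "('a, 'c) ring_scheme \<Rightarrow> ('a, 'm, 'x) module_scheme \<Rightarrow> bool" where
  "lin_compact R M \<longleftrightarrow>
     (\<forall>C. C \<noteq> {} \<and> (\<forall>S\<in>C. affine R M S) \<and> (\<forall>S\<in>C. \<forall>T\<in>C. S \<subseteq> T \<or> T \<subseteq> S) \<longrightarrow> \<Inter>C \<noteq> {})"

lemma lin_compactD:
  assumes "lin_compact R M" "I \<noteq> {}" "\<And>i. i \<in> I \<Longrightarrow> affine R M (S i)"
    and "\<And>i j. \<lbrakk>i \<in> I; j \<in> I\<rbrakk> \<Longrightarrow> S i \<subseteq> S j \<or> S j \<subseteq> S i"
  shows "\<exists>z. \<forall>i\<in>I. z \<in> S i"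
proof -
  have "\<Inter>(S ` I) \<noteq> {}"
    using assms(1)[unfolded lin_compact_def, rule_format, of "S ` I"] assms(2-4) by auto
  then show ?thesis by auto
qed

text \<open>An affine set over the smaller carrier is affine in M, so each chain is already one in
  M.\<close>

lemma lin_compact_restrict:
  assumes "lin_compact R M" "N \<subseteq> carrier M"
  shows "lin_compact R (M\<lparr>carrier := N\<rparr>)"
proof -
  have *: "affine R M S" if "affine R (M\<lparr>carrier := N\<rparr>) S" for S
    using that assms(2) unfolding affine_def by auto
  show ?thesis
    unfolding lin_compact_def
    using assms(1)[unfolded lin_compact_def] * by metis
qed

context val_module
begin

lemma affineI:
  assumes "S \<subseteq> carrier M" "s \<in> S"
    and "\<And>x y z a. \<lbrakk>x \<in> S; y \<in> S; z \<in> S; a \<in> carrier R; x \<in> carrier M; y \<in> carrier M; z \<in> carrier M\<rbrakk>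
       \<Longrightarrow> x \<oplus> a \<odot> (y \<oplus> z) \<in> S"
  shows "affine R M S"
  using assms unfolding affine_def by blast

section \<open>Multiples r M and regular elements\<close>

definition mult_set :: "'a \<Rightarrow> 'c set" where
  "mult_set r = (\<lambda>y. r \<odot> y) ` carrier M"

lemma mult_set_submodule: "r \<in> carrier R \<Longrightarrow> submodule (mult_set r) R M"
  unfolding submodule_iff mult_set_def
proof (safe; clarsimp?)
  assume r: "r \<in> carrier R"
  show "\<zero> \<in> (\<odot>) r ` carrier M"
    using r by (intro image_eqI[where x = "\<zero>"]) auto
  fix x assume x: "x \<in> carrier M"
  { fix y assume "y \<in> carrier M"
    with r x show "r \<odot> x \<oplus> r \<odot> y \<in> (\<odot>) r ` carrier M"
      by (intro image_eqI[where x = "x \<oplus> y"]) (auto simp: smult_r_distr) }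
  fix a assume "a \<in> carrier R"
  with r x show "a \<odot> (r \<odot> x) \<in> (\<odot>) r ` carrier M"
    by (intro image_eqI[where x = "a \<odot> x"]) (auto simp: R.m_comm simp flip: smult_assoc1)
qed

lemma mult_set_mono: "\<lbrakk>r \<in> carrier R; c \<in> carrier R\<rbrakk> \<Longrightarrow> mult_set (r \<otimes>\<^bsub>R\<^esub> c) \<subseteq> mult_set r"
  unfolding mult_set_def by (auto simp: smult_assoc1)

lemma mult_set_total:
  "\<lbrakk>r \<in> carrier R; s \<in> carrier R\<rbrakk> \<Longrightarrow> mult_set r \<subseteq> mult_set s \<or> mult_set s \<subseteq> mult_set r"
  using divides_total[of r s] mult_set_mono by metis

text \<open>Equivalently: \<open>x \<in> r M + ker b\<close> only if \<open>x \<in> r M\<close> or \<open>x \<in> ker b\<close>.\<close>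

definition regular :: "'c \<Rightarrow> bool" where
  "regular x \<longleftrightarrow> x \<in> carrier M \<and> x \<noteq> \<zero> \<and>
     (\<forall>b\<in>carrier R. \<forall>r\<in>carrier R. b \<odot> x \<noteq> \<zero> \<longrightarrow> b \<odot> x \<in> mult_set (b \<otimes>\<^bsub>R\<^esub> r) \<longrightarrow> x \<in> mult_set r)"

text \<open>
  Let \<open>N\<close> be the sum of all \<open>r M\<close> not containing \<open>x\<close>. Then \<open>x + N\<close> contains a regular element, namely
  one killed by every scalar that kills some element of \<open>x + N\<close>.
\<close>

lemma ex_regular:
  assumes lc: "lin_compact R M" and x: "x \<in> carrier M" "x \<noteq> \<zero>"
  shows "\<exists>z. regular z"
proof -
  \<comment> \<open>The submodules r M form a chain, so this union is a submodule. It does not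
    contain x, hence x + N does not contain zero.\<close>
  define N where "N = (\<Union>r\<in>{r \<in> carrier R. x \<notin> mult_set r}. mult_set r)"
  have N0: "\<zero>\<^bsub>R\<^esub> \<in> {r \<in> carrier R. x \<notin> mult_set r}"
    using x by (auto simp: mult_set_def)
  have N: "submodule N R M"
    unfolding submodule_iff
  proof (intro conjI ballI)
    show "N \<subseteq> carrier M" by (auto simp: N_def mult_set_def)
    show "\<zero> \<in> N"
      using N0 mult_set_submodule[of "\<zero>\<^bsub>R\<^esub>"] unfolding N_def submodule_iff by blast
    fix n assume "n \<in> N"
    then obtain r where r: "r \<in> carrier R" "x \<notin> mult_set r" "n \<in> mult_set r" by (auto simp: N_def)
    { fix m assume "m \<in> N"
      then obtain s where s: "s \<in> carrier R" "x \<notin> mult_set s" "m \<in> mult_set s" by (auto simp: N_def)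
      have "(n \<in> mult_set s \<and> m \<in> mult_set s) \<or> (n \<in> mult_set r \<and> m \<in> mult_set r)"
        using mult_set_total[of r s] r s by blast
      then show "n \<oplus> m \<in> N"
        using r s mult_set_submodule[of r] mult_set_submodule[of s]
        unfolding submodule_iff N_def by blast }
    fix a assume "a \<in> carrier R"
    then show "a \<odot> n \<in> N" using r mult_set_submodule[of r] unfolding submodule_iff N_def by blast
  qed
  have NM: "N \<subseteq> carrier M" using N by (simp add: submodule_iff)
  have Nadd: "n \<oplus> m \<in> N" if "n \<in> N" "m \<in> N" for n m
    using that N by (simp add: submodule_iff)
  have Nsm: "a \<odot> n \<in> N" if "n \<in> N" "a \<in> carrier R" for n a
    using that N by (simp add: submodule_iff)
  have xN: "x \<notin> N" by (auto simp: N_def)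
  \<comment> \<open>Members of the coset x + N killed by b. If b divides c, then S b is contained in
    S c, so the non-empty ones form a chain.\<close>
  define S where "S b = {y \<in> carrier M. x \<oplus> y \<in> N \<and> b \<odot> y = \<zero>}" for b
  define B where "B = {b \<in> carrier R. S b \<noteq> {}}"
  have "S \<zero>\<^bsub>R\<^esub> \<noteq> {}" using x N by (auto simp: S_def submodule_iff intro!: exI[of _ x])
  then have B0: "\<zero>\<^bsub>R\<^esub> \<in> B" by (simp add: B_def)
  have S_aff: "affine R M (S b)" if b: "b \<in> B" for b
  proof -
    obtain s where s: "s \<in> S b" using b by (auto simp: B_def)
    show ?thesis
    proof (rule affineI[OF _ s])
      fix u v w a assume uvw: "u \<in> S b" "v \<in> S b" "w \<in> S b" "a \<in> carrier R"
        "u \<in> carrier M" "v \<in> carrier M" "w \<in> carrier M"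
      have "v \<oplus> w = (x \<oplus> v) \<oplus> (x \<oplus> w)"
        using uvw x by (simp add: M.a_ac)
      then have "a \<odot> (v \<oplus> w) \<in> N" using uvw by (auto intro!: Nsm Nadd simp: S_def)
      then have "x \<oplus> (u \<oplus> a \<odot> (v \<oplus> w)) \<in> N"
        using uvw x Nadd[of "x \<oplus> u"] by (simp add: M.a_assoc[symmetric] S_def)
      moreover have "b \<odot> (a \<odot> (v \<oplus> w)) = a \<odot> (b \<odot> v \<oplus> b \<odot> w)"
        using uvw b by (simp add: R.m_comm B_def smult_r_distr flip: smult_assoc1)
      ultimately show "u \<oplus> a \<odot> (v \<oplus> w) \<in> S b"
        using uvw b by (simp add: smult_r_distr B_def S_def)
    qed (auto simp: S_def)
  qed
  have S_mono: "S b \<subseteq> S (b \<otimes>\<^bsub>R\<^esub> c)" if "b \<in> carrier R" "c \<in> carrier R" for b c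
    using that by (auto simp: S_def R.m_comm[of b c] smult_assoc1)
  obtain z where z: "z \<in> S b" if "b \<in> B" for b
  proof -
    have "\<exists>z. \<forall>b\<in>B. z \<in> S b"
    proof (rule lin_compactD[OF lc])
      show "B \<noteq> {}" using B0 by blast
      fix b c assume "b \<in> B" "c \<in> B"
      then show "S b \<subseteq> S c \<or> S c \<subseteq> S b"
        using divides_total[of b c] S_mono unfolding B_def by blast
    qed (rule S_aff)
    then show thesis using that by blast
  qed
  have zc: "z \<in> carrier M" and zN: "x \<oplus> z \<in> N" using z[OF B0] by (auto simp: S_def)
  \<comment> \<open>The element z keeps every divisor of x: x + z lies in some s M that does not
    contain x, and this s M is contained in r M.\<close>
  have div: "z \<in> mult_set r" if r: "r \<in> carrier R" and xr: "x \<in> mult_set r" for r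
  proof -
    obtain s where s: "s \<in> carrier R" "x \<notin> mult_set s" "x \<oplus> z \<in> mult_set s"
      using zN by (auto simp: N_def)
    then have "x \<oplus> z \<in> mult_set r" using mult_set_total[of r s] r xr by blast
    then have "x \<oplus> (x \<oplus> z) \<in> mult_set r"
      using mult_set_submodule[OF r] xr unfolding submodule_iff by blast
    then show ?thesis using x zc by simp
  qed
  have "regular z"
    unfolding regular_def
  proof (intro conjI ballI impI)
    show "z \<noteq> \<zero>" using zN xN x by auto
    fix b r assume br: "b \<in> carrier R" "r \<in> carrier R" and nz: "b \<odot> z \<noteq> \<zero>"
      and "b \<odot> z \<in> mult_set (b \<otimes>\<^bsub>R\<^esub> r)"
    then obtain y where y: "y \<in> carrier M" "b \<odot> z = b \<odot> (r \<odot> y)"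
      by (auto simp: mult_set_def smult_assoc1)
    show "z \<in> mult_set r"
    proof (rule ccontr)
      assume "z \<notin> mult_set r"
      then have "x \<notin> mult_set r" using div br by blast
      \<comment> \<open>Adding r y to z stays inside x + N and gives an element killed by b; by the
        choice of z, b then kills z itself.\<close>
      then have "r \<odot> y \<in> N" using br y by (auto simp: N_def mult_set_def)
      then have "(x \<oplus> z) \<oplus> r \<odot> y \<in> N" using zN Nadd by blast
      then have "z \<oplus> r \<odot> y \<in> S b"
        using x zc br y by (simp add: S_def M.a_assoc smult_r_distr)
      then have "b \<in> B" using br by (auto simp: B_def)
      then show False using z nz by (auto simp: S_def)
    qed
  qed (rule zc)
  then show ?thesis by blast
qed

section \<open>Pure basic submodules and their complements\<close>

lemma basic_submodule_iff:
  "basic_module R (M\<lparr>carrier := U\<rparr>) \<longleftrightarrow> U \<noteq> {\<zero>} \<and>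
     (\<forall>x\<in>U. \<forall>y\<in>U. (\<exists>a\<in>carrier R. x = a \<odot> y) \<or> (\<exists>a\<in>carrier R. y = a \<odot> x))"
  by (simp add: basic_module_def)

lemma affine_mult_set_preimage:
  assumes "d \<in> carrier R" "h \<in> carrier R" "y \<in> carrier M" "v \<in> mult_set h" "d \<odot> v = y"
  shows "affine R M {v \<in> mult_set h. d \<odot> v = y}"
proof (rule affineI[where s = v])
  show "{v \<in> mult_set h. d \<odot> v = y} \<subseteq> carrier M"
    using mult_set_submodule[OF assms(2)] by (auto simp: submodule_iff)
  fix p q r a assume pqr: "p \<in> {v \<in> mult_set h. d \<odot> v = y}" "q \<in> {v \<in> mult_set h. d \<odot> v = y}"
    "r \<in> {v \<in> mult_set h. d \<odot> v = y}" "a \<in> carrier R"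
    "p \<in> carrier M" "q \<in> carrier M" "r \<in> carrier M"
  have "d \<odot> (a \<odot> (q \<oplus> r)) = a \<odot> (d \<odot> q \<oplus> d \<odot> r)"
    using pqr assms by (simp add: smult_commute[of d a] smult_r_distr[of d])
  also have "\<dots> = \<zero>" using pqr assms by auto
  finally have "d \<odot> (p \<oplus> a \<odot> (q \<oplus> r)) = y"
    using pqr assms by (simp add: smult_r_distr[of d])
  moreover have "p \<oplus> a \<odot> (q \<oplus> r) \<in> mult_set h"
    using mult_set_submodule[OF assms(2)] pqr unfolding submodule_iff by blast
  ultimately show "p \<oplus> a \<odot> (q \<oplus> r) \<in> {v \<in> mult_set h. d \<odot> v = y}" by blast
qed (use assms in auto)

text \<open>For a submodule U this is relative divisibility, which over a valuation ring is the
  usual purity.\<close>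

definition pure :: "'c set \<Rightarrow> bool" where
  "pure U \<longleftrightarrow> (\<forall>c\<in>carrier R. \<forall>y\<in>carrier M. c \<odot> y \<in> U \<longrightarrow> (\<exists>u\<in>U. c \<odot> y = c \<odot> u))"

text \<open>
  For a regular \<open>x\<close>, linear compactness lets one divide \<open>x\<close> successively by a sequence of scalars
  cofinal among those dividing \<open>x\<close>; the quotients generate a pure basic submodule.
\<close>

lemma ex_divided_seq:
  assumes lc: "lin_compact R M" and x: "x \<in> carrier M"
  defines "H \<equiv> {c \<in> carrier R. x \<in> mult_set c}"
  shows "\<exists>c y. \<forall>k::nat. c k \<in> H \<and> y k \<in> carrier M \<and> c k \<odot> y k = x \<and>
    (\<exists>d\<in>carrier R. y k = d \<odot> y (Suc k)) \<and> (\<forall>h\<in>H. \<exists>k. \<exists>d\<in>carrier R. c k = h \<otimes>\<^bsub>R\<^esub> d)"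
proof -
  have H1: "\<one>\<^bsub>R\<^esub> \<in> H" using x by (auto simp: H_def mult_set_def intro!: image_eqI[of _ _ x])
  have HR: "H \<subseteq> carrier R" by (auto simp: H_def)
  obtain c where c: "\<And>k. c k \<in> H" "\<And>k. \<exists>d\<in>carrier R. c (Suc k) = c k \<otimes>\<^bsub>R\<^esub> d"
    and cof: "\<And>h. h \<in> H \<Longrightarrow> \<exists>k. \<exists>d\<in>carrier R. c k = h \<otimes>\<^bsub>R\<^esub> d"
    using cofinal_seq[of H] H1 HR by blast
  \<comment> \<open>A quotient y of x by e that leaves room: whatever can still be split off x after
    e divides this particular y. An arbitrary quotient need not have this property, and without it
    the division could get stuck.\<close>
  define Q where "Q e y \<longleftrightarrow> y \<in> carrier M \<and> e \<odot> y = x \<and>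
    (\<forall>h\<in>carrier R. e \<otimes>\<^bsub>R\<^esub> h \<in> H \<longrightarrow> y \<in> mult_set h)" for e y
  have step: "\<exists>y'. d \<odot> y' = y \<and> Q (e \<otimes>\<^bsub>R\<^esub> d) y'"
    if e: "e \<in> carrier R" "d \<in> carrier R" "e \<otimes>\<^bsub>R\<^esub> d \<in> H" and Q: "Q e y" for e d y
  proof -
    define I where "I = {h \<in> carrier R. e \<otimes>\<^bsub>R\<^esub> d \<otimes>\<^bsub>R\<^esub> h \<in> H}"
    have y: "y \<in> carrier M" using Q by (simp add: Q_def)
    \<comment> \<open>The next quotient v must satisfy d v = y and be divisible by every h in I.
      Each constraint is satisfiable because y is divisible by d h, and they are nested as the
      submodules h M are.\<close>
    have "\<exists>v. \<forall>h\<in>I. v \<in> {v \<in> mult_set h. d \<odot> v = y}"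
    proof (rule lin_compactD[OF lc])
      show "I \<noteq> {}" using e by (auto simp: I_def intro!: exI[of _ "\<one>\<^bsub>R\<^esub>"])
      fix h assume h: "h \<in> I"
      then have "y \<in> mult_set (d \<otimes>\<^bsub>R\<^esub> h)" using Q e by (auto simp: Q_def I_def m_assoc)
      then obtain w where w: "w \<in> carrier M" "y = d \<odot> (h \<odot> w)"
        using h e by (auto simp: mult_set_def I_def smult_assoc1)
      then show "affine R M {v \<in> mult_set h. d \<odot> v = y}"
        using h e y by (intro affine_mult_set_preimage[where v = "h \<odot> w"]) (auto simp: I_def mult_set_def)
    next
      fix i j assume "i \<in> I" "j \<in> I"
      then show "{v \<in> mult_set i. d \<odot> v = y} \<subseteq> {v \<in> mult_set j. d \<odot> v = y} \<or>
        {v \<in> mult_set j. d \<odot> v = y} \<subseteq> {v \<in> mult_set i. d \<odot> v = y}"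
        using mult_set_total[of i j] by (auto simp: I_def)
    qed
    then obtain v where v: "\<And>h. h \<in> I \<Longrightarrow> v \<in> mult_set h \<and> d \<odot> v = y" by auto
    have "\<one>\<^bsub>R\<^esub> \<in> I" using e by (auto simp: I_def)
    then have v1: "v \<in> carrier M" "d \<odot> v = y" using v by (auto simp: mult_set_def)
    then have "(e \<otimes>\<^bsub>R\<^esub> d) \<odot> v = x" using Q e by (simp add: Q_def smult_assoc1)
    then have "Q (e \<otimes>\<^bsub>R\<^esub> d) v" using v v1 e by (auto simp: Q_def I_def)
    then show ?thesis using v1 by blast
  qed
  have "Q \<one>\<^bsub>R\<^esub> x" using x by (auto simp: Q_def H_def)
  then obtain y0 where "Q (c 0) y0" using step[of "\<one>\<^bsub>R\<^esub>" "c 0" x] c(1)[of 0] HR by auto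
  then have "\<exists>y. \<forall>k. Q (c k) (y k) \<and> (\<exists>d\<in>carrier R. y k = d \<odot> y (Suc k))"
  proof (intro dependent_nat_choice)
    fix y k assume Qk: "Q (c k) y"
    obtain d where d: "d \<in> carrier R" "c (Suc k) = c k \<otimes>\<^bsub>R\<^esub> d" using c(2) by blast
    then obtain y' where "d \<odot> y' = y \<and> Q (c (Suc k)) y'"
      using step[of "c k" d y] Qk c(1)[of k] c(1)[of "Suc k"] HR by auto
    then show "\<exists>y'. Q (c (Suc k)) y' \<and> (\<exists>d\<in>carrier R. y = d \<odot> y')"
      using d by auto
  qed auto
  then obtain y where y: "\<And>k. Q (c k) (y k)" "\<And>k. \<exists>d\<in>carrier R. y k = d \<odot> y (Suc k)" by blast
  show ?thesis
    using y c cof unfolding Q_def by (intro exI[of _ c] exI[of _ y] allI conjI) blast+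
qed

lemma chain_multiple:
  assumes "\<And>k. y k \<in> carrier M" "\<And>k::nat. \<exists>d\<in>carrier R. y k = d \<odot> y (Suc k)" "k \<le> l"
  shows "\<exists>d\<in>carrier R. y k = d \<odot> y l"
  using assms(3)
proof (induction l rule: dec_induct)
  case base
  show ?case using assms(1) by (intro bexI[of _ "\<one>\<^bsub>R\<^esub>"]) auto
next
  case (step l)
  then obtain d where d: "d \<in> carrier R" "y k = d \<odot> y l" by blast
  obtain e where "e \<in> carrier R" "y l = e \<odot> y (Suc l)" using assms(2) by blast
  then show ?case using d assms(1) by (intro bexI[of _ "d \<otimes>\<^bsub>R\<^esub> e"]) (auto simp: smult_assoc1)
qed

text \<open>Any two elements lie in one cyclic submodule R y_k, where divisibility of their
  coefficients compares them.\<close>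

lemma chain_generates_basic:
  assumes y: "\<And>k. y k \<in> carrier M" "\<And>k::nat. \<exists>d\<in>carrier R. y k = d \<odot> y (Suc k)"
    and nz: "y 0 \<noteq> \<zero>"
  defines "U \<equiv> {a \<odot> y k | a k. a \<in> carrier R}"
  shows "submodule U R M" "basic_module R (M\<lparr>carrier := U\<rparr>)" "\<And>k. y k \<in> U"
proof -
  show yU: "y k \<in> U" for k unfolding U_def using y(1) by (auto intro!: exI[of _ "\<one>\<^bsub>R\<^esub>"] exI[of _ k])
  have two: "\<exists>k a b. a \<in> carrier R \<and> b \<in> carrier R \<and> u = a \<odot> y k \<and> v = b \<odot> y k"
    if uv: "u \<in> U" "v \<in> U" for u v
  proof -
    obtain a k where a: "a \<in> carrier R" "u = a \<odot> y k" using uv by (auto simp: U_def)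
    obtain b l where b: "b \<in> carrier R" "v = b \<odot> y l" using uv by (auto simp: U_def)
    obtain d where d: "d \<in> carrier R" "y k = d \<odot> y (max k l)"
      using chain_multiple[where y = y, OF y, where k = k and l = "max k l"] by auto
    obtain e where e: "e \<in> carrier R" "y l = e \<odot> y (max k l)"
      using chain_multiple[where y = y, OF y, where k = l and l = "max k l"] by auto
    show ?thesis using a b d e y(1)
      by (intro exI[of _ "max k l"] exI[of _ "a \<otimes>\<^bsub>R\<^esub> d"] exI[of _ "b \<otimes>\<^bsub>R\<^esub> e"]) (auto simp: smult_assoc1)
  qed
  show "submodule U R M"
    unfolding submodule_iff
  proof (intro conjI ballI)
    show "U \<subseteq> carrier M" using y by (auto simp: U_def)
    show "\<zero> \<in> U" using y(1) by (auto simp: U_def intro!: exI[of _ "\<zero>\<^bsub>R\<^esub>"])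
    fix u v assume "u \<in> U" "v \<in> U"
    then obtain k a b where "a \<in> carrier R" "b \<in> carrier R" "u = a \<odot> y k" "v = b \<odot> y k"
      using two by blast
    then show "u \<oplus> v \<in> U" using y(1)
      by (auto simp: U_def intro!: exI[of _ "a \<oplus>\<^bsub>R\<^esub> b"] exI[of _ k] simp: smult_l_distr)
  next
    fix a u assume "a \<in> carrier R" "u \<in> U"
    moreover from this obtain b k where "b \<in> carrier R" "u = b \<odot> y k" by (auto simp: U_def)
    ultimately show "a \<odot> u \<in> U" using y(1)
      by (auto simp: U_def intro!: exI[of _ "a \<otimes>\<^bsub>R\<^esub> b"] exI[of _ k] simp: smult_assoc1)
  qed
  show "basic_module R (M\<lparr>carrier := U\<rparr>)"
    unfolding basic_submodule_iff
  proof (intro conjI ballI)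
    show "U \<noteq> {\<zero>}" using yU[of 0] nz by blast
    fix u v assume "u \<in> U" "v \<in> U"
    then obtain k a b where kab: "a \<in> carrier R" "b \<in> carrier R" "u = a \<odot> y k" "v = b \<odot> y k"
      using two by blast
    consider c where "c \<in> carrier R" "a = c \<otimes>\<^bsub>R\<^esub> b" | c where "c \<in> carrier R" "b = c \<otimes>\<^bsub>R\<^esub> a"
      using divides_total[of a b] kab by (metis R.m_comm)
    then show "(\<exists>a\<in>carrier R. u = a \<odot> v) \<or> (\<exists>a\<in>carrier R. v = a \<odot> u)"
    proof cases
      case (1 c)
      then have "u = c \<odot> v" using kab y(1) by (simp add: smult_assoc1)
      then show ?thesis using 1 by blast
    next
      case (2 c)
      then have "v = c \<odot> u" using kab y(1) by (simp add: smult_assoc1)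
      then show ?thesis using 2 by blast
    qed
  qed
qed

text \<open>Quotients of a regular x by cofinally many of its divisors generate U, so every scalar
  dividing x in M divides it inside U. Purity at an arbitrary u in U is reduced to this by comparing
  u with x.\<close>

lemma ex_pure_basic_submodule:
  assumes lc: "lin_compact R M" and nontriv: "carrier M \<noteq> {\<zero>}"
  shows "\<exists>U. submodule U R M \<and> basic_module R (M\<lparr>carrier := U\<rparr>) \<and> pure U"
proof -
  obtain x0 where "x0 \<in> carrier M" "x0 \<noteq> \<zero>" using nontriv by blast
  then obtain x where reg: "regular x" using ex_regular[OF lc] by blast
  then have x: "x \<in> carrier M" "x \<noteq> \<zero>" by (auto simp: regular_def)
  define H where "H = {c \<in> carrier R. x \<in> mult_set c}"
  obtain c y where cy_all: "\<forall>k::nat. c k \<in> H \<and> y k \<in> carrier M \<and> c k \<odot> y k = x \<and>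
      (\<exists>d\<in>carrier R. y k = d \<odot> y (Suc k)) \<and> (\<forall>h\<in>H. \<exists>k. \<exists>d\<in>carrier R. c k = h \<otimes>\<^bsub>R\<^esub> d)"
    using ex_divided_seq[OF lc x(1), folded H_def] by (elim exE)
  then have cy: "\<And>k. c k \<in> H" "\<And>k. y k \<in> carrier M" "\<And>k. c k \<odot> y k = x"
     "\<And>k. \<exists>d\<in>carrier R. y k = d \<odot> y (Suc k)" "\<And>h. h \<in> H \<Longrightarrow> \<exists>k. \<exists>d\<in>carrier R. c k = h \<otimes>\<^bsub>R\<^esub> d"
    by simp_all
  have cR: "c k \<in> carrier R" for k using cy(1)[of k] by (simp add: H_def)
  define U where "U = {a \<odot> y k | a k. a \<in> carrier R}"
  have "y 0 \<noteq> \<zero>" using cy(3)[of 0] x cR by auto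
  note U = chain_generates_basic[of y, OF cy(2,4) this, folded U_def]
  have UM: "U \<subseteq> carrier M" and Usm: "\<And>a u. a \<in> carrier R \<Longrightarrow> u \<in> U \<Longrightarrow> a \<odot> u \<in> U"
    and U0: "\<zero> \<in> U"
    using U(1) by (auto simp: submodule_iff)
  have xU: "x \<in> U" using U(3)[of 0] cy(3)[of 0] cR Usm by metis
  have div: "\<exists>v\<in>U. x = h \<odot> v" if h: "h \<in> H" for h
  proof -
    obtain k d where kd: "d \<in> carrier R" "c k = h \<otimes>\<^bsub>R\<^esub> d" using cy(5)[OF h] by blast
    have "x = h \<odot> (d \<odot> y k)" using kd cy(2) cy(3)[of k] h by (simp add: smult_assoc1 H_def)
    then show ?thesis using kd Usm U(3) by blast
  qed
  have "pure U"
    unfolding pure_def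
  proof (intro ballI impI)
    fix s w assume s: "s \<in> carrier R" and w: "w \<in> carrier M" and swU: "s \<odot> w \<in> U"
    define u where "u = s \<odot> w"
    have u: "u \<in> U" "u \<in> carrier M" using swU s w by (auto simp: u_def)
    \<comment> \<open>If x = b u, the factorisation u = s w makes b s a divisor of x, and x can be
      divided by it inside U. If u is a non-zero multiple of x, regularity is needed to move the
      factor from u to x.\<close>
    consider "u = \<zero>" | b where "b \<in> carrier R" "x = b \<odot> u"
      | b where "b \<in> carrier R" "u = b \<odot> x" "u \<noteq> \<zero>"
      using U(2) xU u unfolding basic_submodule_iff by blast
    then have "\<exists>v\<in>U. u = s \<odot> v"
    proof cases
      case 1
      then show ?thesis using U0 s by (intro bexI[of _ "\<zero>"]) auto
    next
      case (2 b)
      then have "b \<otimes>\<^bsub>R\<^esub> s \<in> H" using s w by (auto simp: H_def mult_set_def u_def smult_assoc1)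
      then obtain v where v: "v \<in> U" "x = b \<odot> (s \<odot> v)"
        using div[of "b \<otimes>\<^bsub>R\<^esub> s"] 2 s UM smult_assoc1 by (metis subsetD)
      have vM: "v \<in> carrier M" using v UM by blast
      consider e where "e \<in> carrier R" "u = e \<odot> (s \<odot> v)"
        | e where "e \<in> carrier R" "s \<odot> v = e \<odot> u"
        using U(2) u Usm[OF s v(1)] unfolding basic_submodule_iff by blast
      then obtain e where e: "e \<in> carrier R" "u = e \<odot> (s \<odot> v)"
      proof cases
        case (2 e)
        \<comment> \<open>Multiplication by b sends both u and s v to the non-zero x, so they are
          associates once one is a multiple of the other.\<close>
        then have "\<exists>c\<in>carrier R. u = c \<odot> (s \<odot> v)"
          using \<open>b \<in> carrier R\<close> \<open>x = b \<odot> u\<close> v vM x u s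
          by (intro smult_cancel[of e b]) auto
        then show thesis using that by blast
      qed (use that in blast)
      then have "u = s \<odot> (e \<odot> v)" using s vM by (metis R.m_comm smult_assoc1)
      then show ?thesis using e v Usm by blast
    next
      case (3 b)
      consider g where "g \<in> carrier R" "b = s \<otimes>\<^bsub>R\<^esub> g" | g where "g \<in> carrier R" "s = b \<otimes>\<^bsub>R\<^esub> g"
        using divides_total[of b s] 3 s by blast
      then show ?thesis
      proof cases
        case (1 g)
        then show ?thesis using 3 xU Usm x s by (auto simp: smult_assoc1)
      next
        case (2 g)
        have "b \<odot> x = (b \<otimes>\<^bsub>R\<^esub> g) \<odot> w" using 2 3 by (simp add: u_def)
        then have "b \<odot> x \<in> mult_set (b \<otimes>\<^bsub>R\<^esub> g)" using w unfolding mult_set_def by (rule image_eqI)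
        \<comment> \<open>Regularity: b x is non-zero and divisible by b g.\<close>
        then have "x \<in> mult_set g" using reg 2 3 by (auto simp: regular_def)
        then obtain v where v: "v \<in> U" "x = g \<odot> v" using div[of g] 2 by (auto simp: H_def)
        then have "u = s \<odot> v" using 2 3 UM smult_assoc1[of b g v] by auto
        then show ?thesis using v by blast
      qed
    qed
    then show "\<exists>v\<in>U. s \<odot> w = s \<odot> v" by (simp add: u_def)
  qed
  then show ?thesis using U by blast
qed

text \<open>The complement is a submodule L maximal subject to the image of U in M / L being
  faithful and pure. For m in M one looks for u in U such that m + u can be adjoined to L without
  losing this property; maximality then puts m + u into L. Linear compactness supplies u.\<close>

lemma pure_basic_complement:
  assumes lc: "lin_compact R M" and U: "submodule U R M"
    and basic: "basic_module R (M\<lparr>carrier := U\<rparr>)" and pure: "pure U"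
  shows "\<exists>L. submodule L R M \<and> U \<inter> L = {\<zero>} \<and> (\<forall>x\<in>carrier M. \<exists>u\<in>U. \<exists>l\<in>L. x = u \<oplus> l)"
proof -
  have UM: "u \<in> carrier M" if "u \<in> U" for u using that U by (auto simp: submodule_iff)
  have U0: "\<zero> \<in> U" and Uadd: "\<And>u v. u \<in> U \<Longrightarrow> v \<in> U \<Longrightarrow> u \<oplus> v \<in> U"
    and Usm: "\<And>a u. a \<in> carrier R \<Longrightarrow> u \<in> U \<Longrightarrow> a \<odot> u \<in> U"
    using U by (auto simp: submodule_iff)
  have comp: "(\<exists>a\<in>carrier R. x = a \<odot> y) \<or> (\<exists>a\<in>carrier R. y = a \<odot> x)" if "x \<in> U" "y \<in> U" for x y
    using basic that unfolding basic_submodule_iff by blast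
  \<comment> \<open>purity of the image of \<open>U\<close> in \<open>M / L\<close>; the case \<open>c = 0\<close> says \<open>U \<inter> L = 0\<close>\<close>
  define good where "good L \<longleftrightarrow> submodule L R M \<and>
    (\<forall>c\<in>carrier R. \<forall>y\<in>carrier M. \<forall>l\<in>L. c \<odot> y \<oplus> l \<in> U \<longrightarrow> (\<exists>u\<in>U. c \<odot> y \<oplus> l = c \<odot> u))" for L
  have "\<exists>L\<in>Collect good. \<forall>L'\<in>Collect good. L \<subseteq> L' \<longrightarrow> L' = L"
  proof (rule subset_Zorn_nonempty)
    have "good {\<zero>}"
      using pure by (simp add: good_def pure_def submodule_iff)
    then show "Collect good \<noteq> {}" by blast
    fix C assume ne: "C \<noteq> {}" and ch: "subset.chain (Collect good) C"
    have C: "\<And>L. L \<in> C \<Longrightarrow> good L" using ch by (auto simp: subset.chain_def)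
    have "submodule (\<Union>C) R M"
      unfolding submodule_iff
    proof (intro conjI ballI)
      show "\<Union>C \<subseteq> carrier M" using C unfolding good_def submodule_iff by blast
      show "\<zero> \<in> \<Union>C" using C ne unfolding good_def submodule_iff by blast
      fix x y assume "x \<in> \<Union>C" "y \<in> \<Union>C"
      then obtain L L' where L: "L \<in> C" "L' \<in> C" "x \<in> L" "y \<in> L'" by blast
      then have "L \<subseteq> L' \<or> L' \<subseteq> L" using ch by (auto simp: subset.chain_def)
      then obtain L'' where "L'' \<in> C" "x \<in> L''" "y \<in> L''" using L by blast
      then show "x \<oplus> y \<in> \<Union>C" using C[of L''] unfolding good_def submodule_iff by blast
    next
      fix a x assume "a \<in> carrier R" "x \<in> \<Union>C"
      then show "a \<odot> x \<in> \<Union>C" using C unfolding good_def submodule_iff by blast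
    qed
    then show "\<Union>C \<in> Collect good" using C by (auto simp: good_def)
  qed
  then obtain L where L: "good L" and max: "\<And>L'. good L' \<Longrightarrow> L \<subseteq> L' \<Longrightarrow> L' = L" by blast
  have Lsub: "submodule L R M" using L by (simp add: good_def)
  have LM: "l \<in> carrier M" if "l \<in> L" for l using that Lsub by (auto simp: submodule_iff)
  have L0: "\<zero> \<in> L" and Ladd: "\<And>u v. u \<in> L \<Longrightarrow> v \<in> L \<Longrightarrow> u \<oplus> v \<in> L"
    and Lsm: "\<And>a u. a \<in> carrier R \<Longrightarrow> u \<in> L \<Longrightarrow> a \<odot> u \<in> L"
    using Lsub by (auto simp: submodule_iff)
  have Lpure: "\<exists>u\<in>U. w = c \<odot> u"
    if "c \<in> carrier R" "y \<in> carrier M" "l \<in> L" "w = c \<odot> y \<oplus> l" "w \<in> U" for c y l w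
    using L that unfolding good_def by blast
  have decomp: "\<exists>u\<in>U. \<exists>l\<in>L. m = u \<oplus> l" if m: "m \<in> carrier M" for m
  proof -
    \<comment> \<open>Each triple records a possible obstruction to adjoining m + u. From n + a m =
      c y + l the element n + a u of U equals c y plus an element of the enlarged submodule, so
      purity demands that it lie in c U.\<close>
    define I where "I = {(a, n, c). a \<in> carrier R \<and> n \<in> U \<and> c \<in> carrier R \<and>
      (\<exists>y\<in>carrier M. \<exists>l\<in>L. n \<oplus> a \<odot> m = c \<odot> y \<oplus> l)}"
    define S where "S = (\<lambda>(a, n, c). {u \<in> U. \<exists>v\<in>U. n \<oplus> a \<odot> u = c \<odot> v})"
    have S_ne: "\<exists>s. s \<in> S i" if "i \<in> I" for i
    proof -
      obtain a n c y l where i: "i = (a, n, c)" "a \<in> carrier R" "n \<in> U" "c \<in> carrier R"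
        "y \<in> carrier M" "l \<in> L" "n \<oplus> a \<odot> m = c \<odot> y \<oplus> l"
        using \<open>i \<in> I\<close> by (auto simp: I_def)
      have "n = a \<odot> m \<oplus> (n \<oplus> a \<odot> m)" using i(2,3) UM m by (simp add: M.a_ac)
      then have n: "n = a \<odot> m \<oplus> (c \<odot> y \<oplus> l)" using i by simp
      \<comment> \<open>If a divides c, then n lies in a M + L, so n = a u with u in U and n + a u =
        0. If c divides a, then n lies in c M + L, hence in c U, and u = 0 works.\<close>
      consider g where "g \<in> carrier R" "c = a \<otimes>\<^bsub>R\<^esub> g" | g where "g \<in> carrier R" "a = c \<otimes>\<^bsub>R\<^esub> g"
        using divides_total[of a c] i by blast
      then show ?thesis
      proof cases
        case (1 g)
        have "n = a \<odot> (m \<oplus> g \<odot> y) \<oplus> l"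
          using 1 i m LM n by (simp add: smult_r_distr smult_assoc1 M.a_assoc)
        then obtain u where "u \<in> U" "n = a \<odot> u"
          using Lpure[of a "m \<oplus> g \<odot> y" l n] 1 i m by auto
        then show ?thesis using i UM U0
          by (intro exI[of _ u]) (auto simp: S_def intro!: bexI[of _ "\<zero>"])
      next
        case (2 g)
        have "n = c \<odot> (g \<odot> m \<oplus> y) \<oplus> l"
          using 2 i m LM n by (simp add: smult_r_distr smult_assoc1 M.a_assoc)
        then obtain u where "u \<in> U" "n = c \<odot> u"
          using Lpure[of c "g \<odot> m \<oplus> y" l n] 2 i m by auto
        then show ?thesis using i UM U0
          by (intro exI[of _ "\<zero>"]) (auto simp: S_def)
      qed
    qed
    have S_aff: "affine R M (S i)" if "i \<in> I" for i
    proof -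
      obtain a n c where i: "i = (a, n, c)" "a \<in> carrier R" "n \<in> U" "c \<in> carrier R"
        using \<open>i \<in> I\<close> by (auto simp: I_def)
      obtain s where "s \<in> S i" using S_ne \<open>i \<in> I\<close> by blast
      then show ?thesis
      proof (rule affineI[rotated])
        show "S i \<subseteq> carrier M" using UM by (auto simp: S_def i)
        fix p q r b assume pqr: "p \<in> S i" "q \<in> S i" "r \<in> S i" "b \<in> carrier R"
          "p \<in> carrier M" "q \<in> carrier M" "r \<in> carrier M"
        obtain p' q' r' where pqr': "p' \<in> U" "q' \<in> U" "r' \<in> U"
          "n \<oplus> a \<odot> p = c \<odot> p'" "n \<oplus> a \<odot> q = c \<odot> q'" "n \<oplus> a \<odot> r = c \<odot> r'"
          and pqrU: "p \<in> U" "q \<in> U" "r \<in> U"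
          using pqr by (auto simp: S_def i)
        have "a \<odot> (q \<oplus> r) = (n \<oplus> a \<odot> q) \<oplus> (n \<oplus> a \<odot> r)"
          using i pqr UM by (simp add: smult_r_distr M.a_ac)
        also have "\<dots> = c \<odot> (q' \<oplus> r')" using pqr' i UM by (simp add: smult_r_distr)
        finally have "n \<oplus> a \<odot> (p \<oplus> b \<odot> (q \<oplus> r)) = (n \<oplus> a \<odot> p) \<oplus> b \<odot> (c \<odot> (q' \<oplus> r'))"
          using i pqr pqr'(1-3) UM by (simp add: smult_r_distr[of a p] smult_commute[of a b] M.a_assoc)
        also have "\<dots> = c \<odot> (p' \<oplus> b \<odot> (q' \<oplus> r'))"
          using i pqr pqr' UM by (simp add: smult_r_distr[of c p'] smult_commute[of b c])
        finally show "p \<oplus> b \<odot> (q \<oplus> r) \<in> S i"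
          using pqr pqr' pqrU Uadd Usm unfolding S_def i by auto
      qed
    qed
    have chain: "S (a, n, c) \<subseteq> S (a \<otimes>\<^bsub>R\<^esub> b, n', c') \<or> S (a \<otimes>\<^bsub>R\<^esub> b, n', c') \<subseteq> S (a, n, c)"
      if I1: "(a, n, c) \<in> I" and I2: "(a \<otimes>\<^bsub>R\<^esub> b, n', c') \<in> I" and b: "b \<in> carrier R" for a n c b n' c'
    proof -
      obtain y l where i: "a \<in> carrier R" "n \<in> U" "c \<in> carrier R" "y \<in> carrier M" "l \<in> L"
        "n \<oplus> a \<odot> m = c \<odot> y \<oplus> l"
        using I1 unfolding I_def by blast
      obtain y' l' where i': "n' \<in> U" "c' \<in> carrier R" "y' \<in> carrier M" "l' \<in> L"
        "n' \<oplus> (a \<otimes>\<^bsub>R\<^esub> b) \<odot> m = c' \<odot> y' \<oplus> l'"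
        using I2 unfolding I_def by blast
      have ab: "(a \<otimes>\<^bsub>R\<^esub> b) \<odot> z = b \<odot> (a \<odot> z)" if "z \<in> carrier M" for z
        using i b that by (metis R.m_comm smult_assoc1)
      \<comment> \<open>The second expression is w plus b times the first, and w no longer depends
        on the unknown u.\<close>
      define w where "w = n' \<oplus> b \<odot> n"
      have wU: "w \<in> U" using i i' b Uadd Usm by (simp add: w_def)
      have w_eq: "n' \<oplus> (a \<otimes>\<^bsub>R\<^esub> b) \<odot> z = w \<oplus> b \<odot> (n \<oplus> a \<odot> z)" if "z \<in> carrier M" for z
        using i i' b that UM by (simp add: ab w_def smult_r_distr[of b] M.a_ac)
      have w_eq2: "w = (n' \<oplus> (a \<otimes>\<^bsub>R\<^esub> b) \<odot> z) \<oplus> b \<odot> (n \<oplus> a \<odot> z)" if "z \<in> carrier M" for z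
        using i i' b that UM by (simp add: ab w_def smult_r_distr[of b] M.a_ac)
      have w: "w = (c' \<odot> y' \<oplus> b \<odot> (c \<odot> y)) \<oplus> (l' \<oplus> b \<odot> l)"
        using w_eq2[OF m] i i' b LM by (simp add: smult_r_distr[of b] M.a_ac)
      have l'': "l' \<oplus> b \<odot> l \<in> L" using i i' b Ladd Lsm by blast
      consider g where "g \<in> carrier R" "b \<otimes>\<^bsub>R\<^esub> c = c' \<otimes>\<^bsub>R\<^esub> g" | g where "g \<in> carrier R" "c' = (b \<otimes>\<^bsub>R\<^esub> c) \<otimes>\<^bsub>R\<^esub> g"
        using divides_total[of c' "b \<otimes>\<^bsub>R\<^esub> c"] i i' b by blast
      then show ?thesis
      proof cases
        \<comment> \<open>Here w is in c' M + L, so purity gives w = c' v, and the first condition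
          implies the second.\<close>
        case (1 g)
        have bc: "b \<odot> (c \<odot> z) = c' \<odot> (g \<odot> z)" if "z \<in> carrier M" for z
          using 1 i i' b that by (metis smult_assoc1)
        have "w = c' \<odot> (y' \<oplus> g \<odot> y) \<oplus> (l' \<oplus> b \<odot> l)"
          using w 1 i i' bc by (simp add: smult_r_distr)
        then obtain v where v: "v \<in> U" "w = c' \<odot> v"
          using Lpure[of c' "y' \<oplus> g \<odot> y" "l' \<oplus> b \<odot> l" w] l'' wU 1 i i' by auto
        have "S (a, n, c) \<subseteq> S (a \<otimes>\<^bsub>R\<^esub> b, n', c')"
        proof
          fix u assume "u \<in> S (a, n, c)"
          then obtain t where t: "u \<in> U" "t \<in> U" "n \<oplus> a \<odot> u = c \<odot> t" by (auto simp: S_def)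
          then have "n' \<oplus> (a \<otimes>\<^bsub>R\<^esub> b) \<odot> u = c' \<odot> (v \<oplus> g \<odot> t)"
            using w_eq[of u] v UM bc[of t] i' 1 by (simp add: smult_r_distr)
          then show "u \<in> S (a \<otimes>\<^bsub>R\<^esub> b, n', c')" using t v 1 Uadd Usm by (auto simp: S_def)
        qed
        then show ?thesis ..
      next
        \<comment> \<open>Now purity gives w = b c v, so the second condition yields only that b (n
          + a u) is in b c U. If b can always be cancelled, the second condition implies the first.
          If cancellation fails once, b kills all of c U and the first implies the second.\<close>
        case (2 g)
        have c': "c' \<odot> z = b \<odot> (c \<odot> (g \<odot> z))" if "z \<in> carrier M" for z
          using 2 i b that by (simp add: smult_assoc1)
        have "w = (b \<otimes>\<^bsub>R\<^esub> c) \<odot> (g \<odot> y' \<oplus> y) \<oplus> (l' \<oplus> b \<odot> l)"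
          using w 2 i i' b by (simp add: smult_r_distr c' smult_assoc1)
        then obtain v where v: "v \<in> U" "w = b \<odot> (c \<odot> v)"
          using Lpure[of "b \<otimes>\<^bsub>R\<^esub> c" "g \<odot> y' \<oplus> y" "l' \<oplus> b \<odot> l" w] l'' wU 2 i i' b UM
          by (auto simp: smult_assoc1)
        have key: "\<exists>v'\<in>U. b \<odot> (n \<oplus> a \<odot> u) = b \<odot> (c \<odot> v')"
          if u: "u \<in> S (a \<otimes>\<^bsub>R\<^esub> b, n', c')" for u
        proof -
          obtain t where t: "u \<in> U" "t \<in> U" "n' \<oplus> (a \<otimes>\<^bsub>R\<^esub> b) \<odot> u = c' \<odot> t"
            using u by (auto simp: S_def)
          have z: "n \<oplus> a \<odot> u \<in> carrier M" using t i UM by simp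
          have "b \<odot> (n \<oplus> a \<odot> u) = w \<oplus> (w \<oplus> b \<odot> (n \<oplus> a \<odot> u))"
            using z wU UM b by simp
          also have "\<dots> = w \<oplus> c' \<odot> t" using w_eq[of u] t UM by simp
          also have "\<dots> = b \<odot> (c \<odot> (v \<oplus> g \<odot> t))"
            using v t UM c' i b 2 by (simp add: smult_r_distr)
          finally show ?thesis using v t 2 Uadd Usm by blast
        qed
        show ?thesis
        proof (cases "S (a \<otimes>\<^bsub>R\<^esub> b, n', c') \<subseteq> S (a, n, c)")
          case False
          then obtain u where u: "u \<in> S (a \<otimes>\<^bsub>R\<^esub> b, n', c')" "u \<notin> S (a, n, c)" by blast
          then have uU: "u \<in> U" by (auto simp: S_def)
          define z where "z = n \<oplus> a \<odot> u"
          have zU: "z \<in> U" using i uU Uadd Usm by (simp add: z_def)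
          have zc: "\<not> (\<exists>v\<in>U. z = c \<odot> v)" using u uU by (auto simp: S_def z_def)
          \<comment> \<open>Since U is basic and z is not in c U, all of c U consists of multiples
            of z.\<close>
          have cz: "\<exists>e\<in>carrier R. c \<odot> v = e \<odot> z" if v: "v \<in> U" for v
          proof -
            have "z \<noteq> e \<odot> (c \<odot> v)" if "e \<in> carrier R" for e
              using zc v Usm[OF that v] smult_commute[of e c v] that i UM by auto
            then show ?thesis using comp[of z "c \<odot> v"] zU v i Usm by blast
          qed
          obtain v' where v': "v' \<in> U" "b \<odot> z = b \<odot> (c \<odot> v')"
            using key[OF u(1)] by (auto simp: z_def)
          \<comment> \<open>Were b z non-zero, z and c v' would be associates, as they agree after
            multiplication by b; but z is not in c U.\<close>
          have bz: "b \<odot> z = \<zero>"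
          proof (rule ccontr)
            assume nz: "b \<odot> z \<noteq> \<zero>"
            obtain e where "e \<in> carrier R" "c \<odot> v' = e \<odot> z" using cz v' by blast
            then obtain f where f: "f \<in> carrier R" "z = f \<odot> (c \<odot> v')"
              using smult_cancel[of e b z "c \<odot> v'"] nz v' b i UM zU by auto
            then show False using zc v'(1) Usm smult_commute[of f c v'] i UM by auto
          qed
          have bc0: "b \<odot> (c \<odot> t) = \<zero>" if t: "t \<in> U" for t
          proof -
            obtain e where "e \<in> carrier R" "c \<odot> t = e \<odot> z" using cz t by blast
            then show ?thesis using smult_commute[of b e z] b UM zU bz by simp
          qed
          have "S (a, n, c) \<subseteq> S (a \<otimes>\<^bsub>R\<^esub> b, n', c')"
          proof
            fix t assume "t \<in> S (a, n, c)"
            then obtain s where s: "t \<in> U" "s \<in> U" "n \<oplus> a \<odot> t = c \<odot> s" by (auto simp: S_def)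
            then have "n' \<oplus> (a \<otimes>\<^bsub>R\<^esub> b) \<odot> t = c' \<odot> \<zero>"
              using w_eq[of t] UM v bc0 i' by simp
            then show "t \<in> S (a \<otimes>\<^bsub>R\<^esub> b, n', c')" using s U0 unfolding S_def by blast
          qed
          then show ?thesis ..
        qed simp
      qed
    qed
    have "\<exists>u. \<forall>i\<in>I. u \<in> S i"
    proof (rule lin_compactD[OF lc _ S_aff])
      have "(\<zero>\<^bsub>R\<^esub>, \<zero>, \<zero>\<^bsub>R\<^esub>) \<in> I" using U0 L0 m by (auto simp: I_def intro!: bexI[of _ "\<zero>"])
      then show "I \<noteq> {}" by blast
      fix i j assume ij: "i \<in> I" "j \<in> I"
      obtain a n c a' n' c' where eq: "i = (a, n, c)" "j = (a', n', c')" by (metis prod_cases3)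
      then have "a \<in> carrier R" "a' \<in> carrier R" using ij by (auto simp: I_def)
      then consider b where "b \<in> carrier R" "a' = a \<otimes>\<^bsub>R\<^esub> b" | b where "b \<in> carrier R" "a = a' \<otimes>\<^bsub>R\<^esub> b"
        using divides_total[of a' a] by blast
      then show "S i \<subseteq> S j \<or> S j \<subseteq> S i"
      proof cases
        case (1 b)
        then show ?thesis using chain[of a n c b n' c'] ij eq by simp
      next
        case (2 b)
        then show ?thesis using chain[of a' n' c' b n c] ij eq by auto
      qed
    qed
    then obtain u where u: "\<And>i. i \<in> I \<Longrightarrow> u \<in> S i" by blast
    have "(\<zero>\<^bsub>R\<^esub>, \<zero>, \<zero>\<^bsub>R\<^esub>) \<in> I" using U0 L0 m by (auto simp: I_def intro!: bexI[of _ "\<zero>"])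
    then have uU: "u \<in> U" using u by (fastforce simp: S_def)
    have uM: "u \<in> carrier M" using uU UM by blast
    define L' where "L' = {l \<oplus> a \<odot> (m \<oplus> u) | l a. l \<in> L \<and> a \<in> carrier R}"
    have "submodule L' R M"
      unfolding submodule_iff
    proof (intro conjI ballI)
      show "L' \<subseteq> carrier M" using LM m uM by (auto simp: L'_def)
      show "\<zero> \<in> L'" unfolding L'_def using L0 m uM by (auto intro!: exI[of _ "\<zero>"] exI[of _ "\<zero>\<^bsub>R\<^esub>"])
      fix p q assume "p \<in> L'" "q \<in> L'"
      then obtain l a l' a' where pq: "l \<in> L" "a \<in> carrier R" "l' \<in> L" "a' \<in> carrier R"
        "p = l \<oplus> a \<odot> (m \<oplus> u)" "q = l' \<oplus> a' \<odot> (m \<oplus> u)" by (auto simp: L'_def)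
      then have "p \<oplus> q = (l \<oplus> l') \<oplus> (a \<oplus>\<^bsub>R\<^esub> a') \<odot> (m \<oplus> u)"
        using LM m uM by (simp add: smult_l_distr M.a_ac)
      then show "p \<oplus> q \<in> L'" unfolding L'_def using pq Ladd by blast
    next
      fix b p assume b: "b \<in> carrier R" "p \<in> L'"
      then obtain l a where p: "l \<in> L" "a \<in> carrier R" "p = l \<oplus> a \<odot> (m \<oplus> u)" by (auto simp: L'_def)
      then have "b \<odot> p = b \<odot> l \<oplus> (b \<otimes>\<^bsub>R\<^esub> a) \<odot> (m \<oplus> u)"
        using b LM m uM by (simp add: smult_r_distr[of b] smult_assoc1)
      then show "b \<odot> p \<in> L'" unfolding L'_def using p b Lsm by blast
    qed
    moreover have "\<exists>v\<in>U. c \<odot> y \<oplus> p = c \<odot> v"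
      if c: "c \<in> carrier R" "y \<in> carrier M" "p \<in> L'" "c \<odot> y \<oplus> p \<in> U" for c y p
    proof -
      obtain l a where p: "l \<in> L" "a \<in> carrier R" "p = l \<oplus> a \<odot> (m \<oplus> u)" using c by (auto simp: L'_def)
      define n where "n = (c \<odot> y \<oplus> p) \<oplus> a \<odot> u"
      have n: "n \<in> U" using c p uU Uadd Usm by (simp add: n_def)
      have "n \<oplus> a \<odot> m = c \<odot> y \<oplus> l"
        using c p m uM LM by (simp add: n_def smult_r_distr[of a] M.a_ac)
      then have "(a, n, c) \<in> I" using n c p by (auto simp: I_def)
      then obtain v where "v \<in> U" "n \<oplus> a \<odot> u = c \<odot> v" using u by (fastforce simp: S_def)
      moreover have "n \<oplus> a \<odot> u = c \<odot> y \<oplus> p"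
        using c p m uM LM by (simp add: n_def M.a_assoc)
      ultimately show ?thesis by auto
    qed
    ultimately have "good L'" unfolding good_def by blast
    moreover have "L \<subseteq> L'"
    proof
      fix l assume "l \<in> L"
      then show "l \<in> L'" using LM m uM unfolding L'_def by (auto intro!: exI[of _ l] exI[of _ "\<zero>\<^bsub>R\<^esub>"])
    qed
    ultimately have "L' = L" using max by blast
    moreover have "m \<oplus> u \<in> L'"
      using L0 m uM unfolding L'_def by (auto intro!: exI[of _ "\<zero>"] exI[of _ "\<one>\<^bsub>R\<^esub>"])
    ultimately have "m \<oplus> u \<in> L" by simp
    moreover have "m = u \<oplus> (m \<oplus> u)" using m uM by (simp add: M.a_ac)
    ultimately show ?thesis using uU by blast
  qed
  have "U \<inter> L = {\<zero>}"
  proof -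
    have "u = \<zero>" if "u \<in> U" "u \<in> L" for u
      using Lpure[of "\<zero>\<^bsub>R\<^esub>" "\<zero>" u u] that UM by auto
    then show ?thesis using U0 L0 by blast
  qed
  then show ?thesis using Lsub decomp by blast
qed

end

section \<open>Decompositions into basic submodules\<close>

context val_module
begin

section \<open>Finite sums and direct sums\<close>

lemma finsum_lessThan_Suc:
  "f \<in> {..<Suc n} \<rightarrow> carrier M \<Longrightarrow>
     (\<Oplus>i\<in>{..<Suc n}. f i) = f n \<oplus> (\<Oplus>i\<in>{..<n}. f i)"
  by (subst lessThan_Suc, subst M.finsum_insert) auto

text \<open>In characteristic 2 the old entry is removed by adding it once more.\<close>

lemma finsum_upd:
  fixes n :: nat
  assumes f: "f \<in> {..<n} \<rightarrow> carrier M" and z: "z \<in> carrier M" and k: "k < n"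
  shows "(\<Oplus>i\<in>{..<n}. (f(k := z)) i) = (z \<oplus> f k) \<oplus> (\<Oplus>i\<in>{..<n}. f i)"
proof -
  define T where "T = {..<n} - {k}"
  have T: "{..<n} = insert k T" "k \<notin> T" "finite T" using k by (auto simp: T_def)
  have fT: "f \<in> T \<rightarrow> carrier M" "f k \<in> carrier M" using f k by (auto simp: T_def)
  have "(\<Oplus>i\<in>{..<n}. (f(k := z)) i) = z \<oplus> (\<Oplus>i\<in>T. (f(k := z)) i)"
    unfolding T(1) using T z fT by (subst M.finsum_insert) auto
  also have "(\<Oplus>i\<in>T. (f(k := z)) i) = (\<Oplus>i\<in>T. f i)"
    using fT T by (intro M.finsum_cong') auto
  also have "\<dots> = f k \<oplus> (\<Oplus>i\<in>{..<n}. f i)"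
    unfolding T(1) using T fT by (subst M.finsum_insert) (auto intro!: M.finsum_closed)
  finally show ?thesis using z fT f by (simp add: M.a_assoc)
qed

lemma finsum_extend:
  fixes n :: nat
  assumes "f \<in> {..<n} \<rightarrow> carrier M" "\<And>i. m \<le> i \<Longrightarrow> f i = \<zero>" "m \<le> n"
  shows "(\<Oplus>i\<in>{..<n}. f i) = (\<Oplus>i\<in>{..<m}. f i)"
  using assms(3,1)
proof (induction n rule: dec_induct)
  case (step n)
  have "f n = \<zero>" using assms(2) step by simp
  then show ?case
    using step finsum_lessThan_Suc[OF step.prems] by (simp add: Pi_def)
qed simp

text \<open>Adding two representations of one element gives a representation of zero, so uniqueness
  amounts to independence. The families on the right are not extensional, which allows them to be
  modified pointwise.\<close>

lemma direct_sum_iff: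
  "is_direct_sum R M n N \<longleftrightarrow> (\<forall>i<n. submodule (N i) R M) \<and>
     (\<forall>x\<in>carrier M. \<exists>f. (\<forall>i<n. f i \<in> N i) \<and> x = (\<Oplus>i\<in>{..<n}. f i)) \<and>
     (\<forall>f. (\<forall>i<n. f i \<in> N i) \<and> (\<Oplus>i\<in>{..<n}. f i) = \<zero> \<longrightarrow> (\<forall>i<n. f i = \<zero>))"
  (is "?lhs \<longleftrightarrow> ?sub \<and> ?ex \<and> ?un")
proof
  assume ?lhs
  then have sub: ?sub and
    ds: "\<And>x. x \<in> carrier M \<Longrightarrow> \<exists>!f. f \<in> (\<Pi>\<^sub>E i\<in>{..<n}. N i) \<and> x = (\<Oplus>i\<in>{..<n}. f i)"
    by (auto simp: is_direct_sum_def)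
  have NM: "N i \<subseteq> carrier M" "\<zero> \<in> N i" if "i < n" for i using sub that by (auto simp: submodule_iff)
  have ?ex using ds by (fastforce simp: PiE_def Pi_def)
  moreover have ?un
  proof (intro allI impI)
    fix f i assume f: "(\<forall>i<n. f i \<in> N i) \<and> (\<Oplus>i\<in>{..<n}. f i) = \<zero>" and i: "i < n"
    let ?g = "restrict f {..<n}" and ?z = "\<lambda>i\<in>{..<n}. \<zero>"
    have "(\<Oplus>i\<in>{..<n}. ?g i) = (\<Oplus>i\<in>{..<n}. f i)"
      using f NM by (intro M.finsum_cong') auto
    moreover have "(\<Oplus>i\<in>{..<n}. ?z i) = (\<Oplus>i\<in>{..<n}. \<zero>)"
      by (intro M.finsum_cong') auto
    ultimately have "?g = ?z"
      using ds[of "\<zero>"] f NM by (auto simp del: restrict_apply)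
    then have "?g i = ?z i" by simp
    then show "f i = \<zero>" using i by simp
  qed
  ultimately show "?sub \<and> ?ex \<and> ?un" using sub by blast
next
  assume rhs: "?sub \<and> ?ex \<and> ?un"
  then have NM: "\<And>i. i < n \<Longrightarrow> N i \<subseteq> carrier M"
    and Nadd: "\<And>i x y. i < n \<Longrightarrow> x \<in> N i \<Longrightarrow> y \<in> N i \<Longrightarrow> x \<oplus> y \<in> N i" by (auto simp: submodule_iff)
  show ?lhs
    unfolding is_direct_sum_def
  proof (intro conjI ballI)
    show ?sub using rhs by blast
    fix x assume x: "x \<in> carrier M"
    show "\<exists>!f. f \<in> (\<Pi>\<^sub>E i\<in>{..<n}. N i) \<and> x = (\<Oplus>i\<in>{..<n}. f i)"
    proof (rule ex_ex1I)
      obtain f where f: "\<forall>i<n. f i \<in> N i" "x = (\<Oplus>i\<in>{..<n}. f i)" using rhs x by blast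
      have "(\<Oplus>i\<in>{..<n}. restrict f {..<n} i) = (\<Oplus>i\<in>{..<n}. f i)"
        using f NM by (intro M.finsum_cong') auto
      then show "\<exists>f. f \<in> (\<Pi>\<^sub>E i\<in>{..<n}. N i) \<and> x = (\<Oplus>i\<in>{..<n}. f i)"
        using f by (intro exI[of _ "restrict f {..<n}"]) (auto simp del: restrict_apply simp: restrict_PiE_iff)
    next
      fix f g assume f: "f \<in> (\<Pi>\<^sub>E i\<in>{..<n}. N i) \<and> x = (\<Oplus>i\<in>{..<n}. f i)"
        and g: "g \<in> (\<Pi>\<^sub>E i\<in>{..<n}. N i) \<and> x = (\<Oplus>i\<in>{..<n}. g i)"
      have fg: "f i \<in> N i" "g i \<in> N i" "f i \<in> carrier M" "g i \<in> carrier M" if "i < n" for i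
        using f g that NM[OF that] by (auto simp: PiE_def Pi_def)
      have "(\<Oplus>i\<in>{..<n}. f i \<oplus> g i) = x \<oplus> x"
        using f g fg M.finsum_addf[of f "{..<n}" g] by (simp add: Pi_def)
      then have "(\<forall>i<n. f i \<oplus> g i \<in> N i) \<and> (\<Oplus>i\<in>{..<n}. f i \<oplus> g i) = \<zero>"
        using fg Nadd x by simp
      then have "\<forall>i<n. f i \<oplus> g i = \<zero>"
        by (rule spec[OF conjunct2[OF conjunct2[OF rhs]], THEN mp])
      then have "\<forall>i<n. f i = g i" using fg by (auto simp: add_eq_zero_iff)
      then show "f = g"
        by (intro PiE_ext[OF conjunct1[OF f] conjunct1[OF g]]) simp
    qed
  qed
qed

text \<open>Submodules inherit linear compactness, so a basic summand can be split off the current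
  remainder L; this is the step to be iterated.\<close>

lemma basic_splitting:
  assumes lc: "lin_compact R M" and L: "submodule L R M" "L \<noteq> {\<zero>}"
  shows "\<exists>U L'. submodule U R M \<and> basic_module R (M\<lparr>carrier := U\<rparr>) \<and> submodule L' R M \<and>
    U \<inter> L' = {\<zero>} \<and> U \<subseteq> L \<and> L' \<subseteq> L \<and> (\<forall>x\<in>L. \<exists>u\<in>U. \<exists>l\<in>L'. x = u \<oplus> l)"
proof -
  interpret L: val_module R "M\<lparr>carrier := L\<rparr>" by (rule submodule_val_module[OF L(1)])
  have lcL: "lin_compact R (M\<lparr>carrier := L\<rparr>)"
    using lc L by (intro lin_compact_restrict) (auto simp: submodule_iff)
  obtain U where U: "submodule U R (M\<lparr>carrier := L\<rparr>)" "basic_module R (M\<lparr>carrier := L, carrier := U\<rparr>)" "L.pure U"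
    using L.ex_pure_basic_submodule[OF lcL] L(2) by auto
  then show ?thesis
    using L.pure_basic_complement[OF lcL U] submodule_restrict_iff[OF L(1)] by auto
qed

text \<open>The remainder \<open>L n\<close> is carried along as one more summand, since it becomes
  zero only at the end, if at all.\<close>

lemma splitting_seq_decomposes:
  assumes L0: "L 0 = carrier M" and L: "\<And>k. submodule (L k) R M"
    and U: "\<And>k. k < n \<Longrightarrow> submodule (U k) R M" "\<And>k. k < n \<Longrightarrow> U k \<inter> L (Suc k) = {\<zero>}"
      "\<And>k. k < n \<Longrightarrow> U k \<subseteq> L k" "\<And>k. k < n \<Longrightarrow> L (Suc k) \<subseteq> L k"
      "\<And>k x. k < n \<Longrightarrow> x \<in> L k \<Longrightarrow> \<exists>u\<in>U k. \<exists>l\<in>L (Suc k). x = u \<oplus> l"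
  shows "(\<forall>x\<in>carrier M. \<exists>f l. (\<forall>i<n. f i \<in> U i) \<and> l \<in> L n \<and> x = (\<Oplus>i\<in>{..<n}. f i) \<oplus> l) \<and>
    (\<forall>f l. (\<forall>i<n. f i \<in> U i) \<and> l \<in> L n \<and> (\<Oplus>i\<in>{..<n}. f i) \<oplus> l = \<zero> \<longrightarrow>
       (\<forall>i<n. f i = \<zero>) \<and> l = \<zero>)"
  using U
proof (induction n)
  case 0
  have "l \<in> carrier M" if "l \<in> L 0" for l using that L0 by simp
  then show ?case using L0 by auto
next
  case (Suc n)
  then have IH: "(\<forall>x\<in>carrier M. \<exists>f l. (\<forall>i<n. f i \<in> U i) \<and> l \<in> L n \<and> x = (\<Oplus>i\<in>{..<n}. f i) \<oplus> l) \<and>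
    (\<forall>f l. (\<forall>i<n. f i \<in> U i) \<and> l \<in> L n \<and> (\<Oplus>i\<in>{..<n}. f i) \<oplus> l = \<zero> \<longrightarrow>
       (\<forall>i<n. f i = \<zero>) \<and> l = \<zero>)"
    by (intro Suc.IH) simp_all
  have LM: "l \<in> carrier M" if "l \<in> L k" for l k using that L[of k] by (auto simp: submodule_iff)
  have UM: "u \<in> carrier M" if "u \<in> U k" "k < Suc n" for u k
    using that Suc.prems(1)[of k] by (auto simp: submodule_iff)
  show ?case
  proof (intro conjI ballI allI impI)
    fix x assume "x \<in> carrier M"
    then obtain f l where f: "\<forall>i<n. f i \<in> U i" "l \<in> L n" "x = (\<Oplus>i\<in>{..<n}. f i) \<oplus> l"
      using IH by blast
    obtain u l' where u: "u \<in> U n" "l' \<in> L (Suc n)" "l = u \<oplus> l'" using Suc.prems(5)[of n l] f by auto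
    have fM: "f \<in> {..<n} \<rightarrow> carrier M" using f UM by auto
    have "(\<Oplus>i\<in>{..<Suc n}. (f(n := u)) i) = u \<oplus> (\<Oplus>i\<in>{..<n}. (f(n := u)) i)"
      using fM u UM by (subst finsum_lessThan_Suc) (auto simp: Pi_def less_Suc_eq)
    also have "(\<Oplus>i\<in>{..<n}. (f(n := u)) i) = (\<Oplus>i\<in>{..<n}. f i)"
      using fM by (intro M.finsum_cong') auto
    finally have "x = (\<Oplus>i\<in>{..<Suc n}. (f(n := u)) i) \<oplus> l'"
      using f u fM UM[OF u(1)] LM[OF u(2)] by (simp add: M.a_ac)
    then show "\<exists>f l. (\<forall>i<Suc n. f i \<in> U i) \<and> l \<in> L (Suc n) \<and> x = (\<Oplus>i\<in>{..<Suc n}. f i) \<oplus> l"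
      using f u by (intro exI[of _ "f(n := u)"] exI[of _ l']) (auto simp: less_Suc_eq)
  next
    fix f l assume f: "(\<forall>i<Suc n. f i \<in> U i) \<and> l \<in> L (Suc n) \<and> (\<Oplus>i\<in>{..<Suc n}. f i) \<oplus> l = \<zero>"
    have fM: "f \<in> {..<Suc n} \<rightarrow> carrier M" using f UM by auto
    have l: "l \<in> L n" "l \<in> carrier M" using f Suc.prems(4)[of n] LM by auto
    have fn: "f n \<in> L n" "f n \<in> carrier M" using f Suc.prems(3)[of n] LM by auto
    have fnl: "f n \<oplus> l \<in> L n" using l fn L[of n] by (simp add: submodule_iff)
    have sum0: "(\<Oplus>i\<in>{..<n}. f i) \<oplus> (f n \<oplus> l) = \<zero>"
      using f finsum_lessThan_Suc[OF fM] fM l fn by (simp add: M.a_ac Pi_def)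
    have "(\<forall>i<n. f i \<in> U i) \<and> f n \<oplus> l \<in> L n \<and> (\<Oplus>i\<in>{..<n}. f i) \<oplus> (f n \<oplus> l) = \<zero>"
      using f fnl sum0 by simp
    from mp[OF spec[OF spec[OF conjunct2[OF IH]]] this]
    have z: "\<forall>i<n. f i = \<zero>" "f n \<oplus> l = \<zero>" by simp_all
    then have "f n = l" using fn l by (simp add: add_eq_zero_iff)
    then have "f n = \<zero> \<and> l = \<zero>" using f Suc.prems(2)[of n] by auto
    then show "\<And>i. i < Suc n \<Longrightarrow> f i = \<zero>" and "l = \<zero>" using z by (auto simp: less_Suc_eq)
  qed
qed

text \<open>
  A sequence of independent non-zero submodules contradicts linear compactness: choose
  \<open>u i \<noteq> 0\<close> in each and intersect the cosets of finite sums starting with \<open>u 0 + \<dots> + u (k - 1)\<close>.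
\<close>

lemma no_infinite_independent_family:
  fixes U :: "nat \<Rightarrow> 'c set"
  assumes lc: "lin_compact R M" and U: "\<And>k. submodule (U k) R M" "\<And>k. U k \<noteq> {\<zero>}"
    and ind: "\<And>n f. (\<And>i. f i \<in> U i) \<Longrightarrow> (\<Oplus>i\<in>{..<n}. f i) = \<zero> \<Longrightarrow> \<forall>i<n. f i = \<zero>"
  shows False
proof -
  have UM: "x \<in> carrier M" if "x \<in> U k" for x k using that U(1)[of k] by (auto simp: submodule_iff)
  have U0: "\<zero> \<in> U k" and Uadd: "\<And>x y. x \<in> U k \<Longrightarrow> y \<in> U k \<Longrightarrow> x \<oplus> y \<in> U k"
    and Usm: "\<And>a x. a \<in> carrier R \<Longrightarrow> x \<in> U k \<Longrightarrow> a \<odot> x \<in> U k" for k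
    using U(1)[of k] by (auto simp: submodule_iff)
  have "\<exists>u. u \<in> U k \<and> u \<noteq> \<zero>" for k using U(2)[of k] U0 by blast
  then obtain u where u: "\<And>k. u k \<in> U k" "\<And>k. u k \<noteq> \<zero>" by metis
  define F where "F n f \<longleftrightarrow> (\<forall>i. f i \<in> U i) \<and> (\<forall>i\<ge>n. f i = \<zero>)" for n :: nat and f :: "nat \<Rightarrow> 'c"
  define S where "S k = {x. \<exists>n f. F n f \<and> (\<forall>i<k. f i = u i) \<and> x = (\<Oplus>i\<in>{..<n}. f i)}" for k
  have FM: "f \<in> A \<rightarrow> carrier M" if "F n f" for f n A using that UM by (auto simp: F_def)
  have ext: "(\<Oplus>i\<in>{..<n}. f i) = (\<Oplus>i\<in>{..<m}. f i)" if "F n f" "n \<le> m" for n f m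
    using finsum_extend[of f m n] that FM[of n f] by (auto simp: F_def)
  have "\<exists>x. \<forall>k\<in>UNIV. x \<in> S k"
  proof (rule lin_compactD[OF lc])
    fix k :: nat
    have "F k (\<lambda>i. if i < k then u i else \<zero>)" using u U0 by (auto simp: F_def)
    then have "(\<Oplus>i\<in>{..<k}. if i < k then u i else \<zero>) \<in> S k"
      unfolding S_def by (auto intro!: exI[of _ k] exI[of _ "\<lambda>i. if i < k then u i else \<zero>"])
    then show "affine R M (S k)"
    proof (rule affineI[rotated])
      show "S k \<subseteq> carrier M" using FM by (auto simp: S_def intro!: M.finsum_closed)
      fix x y z a assume xyz: "x \<in> S k" "y \<in> S k" "z \<in> S k" and a: "a \<in> carrier R"
      obtain n1 f1 where 1: "F n1 f1" "\<forall>i<k. f1 i = u i" "x = (\<Oplus>i\<in>{..<n1}. f1 i)"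
        using xyz by (auto simp: S_def)
      obtain n2 f2 where 2: "F n2 f2" "\<forall>i<k. f2 i = u i" "y = (\<Oplus>i\<in>{..<n2}. f2 i)"
        using xyz by (auto simp: S_def)
      obtain n3 f3 where 3: "F n3 f3" "\<forall>i<k. f3 i = u i" "z = (\<Oplus>i\<in>{..<n3}. f3 i)"
        using xyz by (auto simp: S_def)
      define n where "n = max n1 (max n2 n3)"
      define f where "f = (\<lambda>i. f1 i \<oplus> a \<odot> (f2 i \<oplus> f3 i))"
      have F: "F n f"
        using 1 2 3 a Uadd Usm unfolding F_def f_def n_def by (auto simp: max_def)
      have M123: "\<And>i. f1 i \<in> carrier M" "\<And>i. f2 i \<in> carrier M" "\<And>i. f3 i \<in> carrier M"
        using FM[OF 1(1), of UNIV] FM[OF 2(1), of UNIV] FM[OF 3(1), of UNIV] by auto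
      have "(\<Oplus>i\<in>{..<n}. f i) = (\<Oplus>i\<in>{..<n}. f1 i) \<oplus> a \<odot> ((\<Oplus>i\<in>{..<n}. f2 i) \<oplus> (\<Oplus>i\<in>{..<n}. f3 i))"
        using M123 a unfolding f_def
        by (simp add: M.finsum_addf finsum_smult_ldistr[symmetric] Pi_def)
      also have "\<dots> = x \<oplus> a \<odot> (y \<oplus> z)"
        using 1 2 3 ext[OF 1(1), of n] ext[OF 2(1), of n] ext[OF 3(1), of n] by (simp add: n_def)
      finally have "x \<oplus> a \<odot> (y \<oplus> z) = (\<Oplus>i\<in>{..<n}. f i)" by simp
      moreover have "f i = u i" if "i < k" for i
        using that 1 2 3 UM[OF u(1)] a by (simp add: f_def)
      ultimately show "x \<oplus> a \<odot> (y \<oplus> z) \<in> S k" using F unfolding S_def by blast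
    qed
  next
    fix k l :: nat
    have "S l \<subseteq> S k" if "k \<le> l" for k l using that by (force simp: S_def)
    then show "S k \<subseteq> S l \<or> S l \<subseteq> S k" by (metis linear)
  qed simp
  then obtain x where x: "\<And>k. x \<in> S k" by auto
  obtain n f where f: "F n f" "x = (\<Oplus>i\<in>{..<n}. f i)" using x[of 0] by (auto simp: S_def)
  obtain m g where g: "F m g" "\<forall>i<Suc n. g i = u i" "x = (\<Oplus>i\<in>{..<m}. g i)"
    using x[of "Suc n"] unfolding S_def by blast
  \<comment> \<open>The successor brings index n into the comparison: there f is already zero while
    g equals the non-zero u n.\<close>
  define N where "N = Suc (max n m)"
  have fgM: "\<And>i. f i \<in> carrier M" "\<And>i. g i \<in> carrier M"
    using FM[OF f(1), of UNIV] FM[OF g(1), of UNIV] by auto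
  have "(\<Oplus>i\<in>{..<N}. f i \<oplus> g i) = x \<oplus> x"
    using fgM f g ext[OF f(1), of N] ext[OF g(1), of N] by (simp add: M.finsum_addf Pi_def N_def)
  also have "\<dots> = \<zero>" using f fgM by (simp add: Pi_def)
  finally have "\<forall>i<N. f i \<oplus> g i = \<zero>"
    using f g Uadd by (intro ind) (auto simp: F_def)
  then have "f n \<oplus> g n = \<zero>" by (simp add: N_def)
  moreover have "f n = \<zero>" "g n = u n" using f g by (auto simp: F_def)
  ultimately show False using u[of n] UM by simp
qed

theorem lin_compact_imp_multibasic:
  assumes lc: "lin_compact R M"
  shows "multibasic R M"
proof -
  define step where "step L U L' \<longleftrightarrow> submodule U R M \<and> basic_module R (M\<lparr>carrier := U\<rparr>) \<and>
    U \<inter> L' = {\<zero>} \<and> U \<subseteq> L \<and> L' \<subseteq> L \<and> (\<forall>x\<in>L. \<exists>u\<in>U. \<exists>l\<in>L'. x = u \<oplus> l)" for L U L'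
  \<comment> \<open>Only the remainders are chosen recursively; the summands are recovered from
    consecutive remainders.\<close>
  have seq: "\<exists>L. \<forall>n::nat. (submodule (L n) R M \<and> (n = 0 \<longrightarrow> L n = carrier M)) \<and>
    (L n \<noteq> {\<zero>} \<longrightarrow> (\<exists>U. step (L n) U (L (Suc n))))"
  proof (rule dependent_nat_choice)
    show "\<exists>L. submodule L R M \<and> ((0::nat) = 0 \<longrightarrow> L = carrier M)" using carrier_is_submodule by blast
    fix L and n :: nat assume L: "submodule L R M \<and> (n = 0 \<longrightarrow> L = carrier M)"
    show "\<exists>L'. (submodule L' R M \<and> (Suc n = 0 \<longrightarrow> L' = carrier M)) \<and> (L \<noteq> {\<zero>} \<longrightarrow> (\<exists>U. step L U L'))"
    proof (cases "L = {\<zero>}")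
      case False
      then show ?thesis using basic_splitting[OF lc _ False] L unfolding step_def by blast
    qed (use L in blast)
  qed
  obtain L where L: "\<And>n::nat. submodule (L n) R M" "L 0 = carrier M"
    and ex: "\<And>n. L n \<noteq> {\<zero>} \<longrightarrow> (\<exists>U. step (L n) U (L (Suc n)))"
  proof -
    obtain L where "\<forall>n::nat. (submodule (L n) R M \<and> (n = 0 \<longrightarrow> L n = carrier M)) \<and>
      (L n \<noteq> {\<zero>} \<longrightarrow> (\<exists>U. step (L n) U (L (Suc n))))"
      using seq by (elim exE)
    then show thesis by (intro that[of L]) simp_all
  qed
  \<comment> \<open>Meaningful only where \<open>L n\<close> is non-zero; the final decomposition
    uses it below the first n with zero remainder.\<close>
  define U where "U n = (SOME U. step (L n) U (L (Suc n)))" for n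
  have U: "step (L n) (U n) (L (Suc n))" if "L n \<noteq> {\<zero>}" for n
    unfolding U_def by (rule someI_ex[OF mp[OF ex[of n] that]])
  have dec: "(\<forall>x\<in>carrier M. \<exists>f l. (\<forall>i<n. f i \<in> U i) \<and> l \<in> L n \<and> x = (\<Oplus>i\<in>{..<n}. f i) \<oplus> l) \<and>
    (\<forall>f l. (\<forall>i<n. f i \<in> U i) \<and> l \<in> L n \<and> (\<Oplus>i\<in>{..<n}. f i) \<oplus> l = \<zero> \<longrightarrow>
       (\<forall>i<n. f i = \<zero>) \<and> l = \<zero>)"
    if nz: "\<forall>k<n. L k \<noteq> {\<zero>}" for n
    using U[OF mp[OF spec[OF nz]]] L by (intro splitting_seq_decomposes) (auto simp: step_def)
  have L0: "\<zero> \<in> L n" for n using L(1)[of n] by (simp add: submodule_iff)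
  have "\<exists>n. L n = {\<zero>}"
  proof (rule ccontr)
    assume "\<nexists>n. L n = {\<zero>}"
    then have nz: "\<And>n. L n \<noteq> {\<zero>}" by blast
    note st = U[OF nz, unfolded step_def]
    show False
    proof (rule no_infinite_independent_family[OF lc, of U])
      show "submodule (U k) R M" for k using st by blast
      show "U k \<noteq> {\<zero>}" for k using st[of k] unfolding basic_submodule_iff by blast
      fix n f assume f: "\<And>i. f i \<in> U i" "(\<Oplus>i\<in>{..<n}. f i) = \<zero>"
      then have "(\<forall>i<n. f i \<in> U i) \<and> \<zero> \<in> L n \<and> (\<Oplus>i\<in>{..<n}. f i) \<oplus> \<zero> = \<zero>"
        using L0 by simp
      from mp[OF spec[OF spec[OF conjunct2[OF dec]]] this] nz
      show "\<forall>i<n. f i = \<zero>" by simp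
    qed
  qed
  then obtain n where n: "L n = {\<zero>}" "\<forall>k<n. L k \<noteq> {\<zero>}"
    using LeastI[of "\<lambda>n. L n = {\<zero>}"] not_less_Least[of _ "\<lambda>n. L n = {\<zero>}"] by blast
  have st: "step (L k) (U k) (L (Suc k))" if "k < n" for k using U n(2) that by blast
  have UM: "U k \<subseteq> carrier M" if "k < n" for k using st[OF that] by (auto simp: step_def submodule_iff)
  have "is_direct_sum R M n U"
    unfolding direct_sum_iff
  proof (intro conjI)
    show "\<forall>i<n. submodule (U i) R M" using st by (auto simp: step_def)
    have fM: "(\<Oplus>i\<in>{..<n}. f i) \<in> carrier M" if "\<forall>i<n. f i \<in> U i" for f
      using that UM by (intro M.finsum_closed) auto
    show "\<forall>x\<in>carrier M. \<exists>f. (\<forall>i<n. f i \<in> U i) \<and> x = (\<Oplus>i\<in>{..<n}. f i)"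
    proof
      fix x assume "x \<in> carrier M"
      from bspec[OF conjunct1[OF dec[OF n(2)]] this] obtain f l where
        "\<forall>i<n. f i \<in> U i" "l \<in> L n" "x = (\<Oplus>i\<in>{..<n}. f i) \<oplus> l"
        by (elim exE conjE)
      then show "\<exists>f. (\<forall>i<n. f i \<in> U i) \<and> x = (\<Oplus>i\<in>{..<n}. f i)" using fM n(1) by auto
    qed
    show "\<forall>f. (\<forall>i<n. f i \<in> U i) \<and> (\<Oplus>i\<in>{..<n}. f i) = \<zero> \<longrightarrow> (\<forall>i<n. f i = \<zero>)"
    proof (intro allI impI)
      fix f i assume f: "(\<forall>i<n. f i \<in> U i) \<and> (\<Oplus>i\<in>{..<n}. f i) = \<zero>" and "i < n"
      then have "(\<Oplus>i\<in>{..<n}. f i) \<oplus> \<zero> = \<zero>" by simp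
      then have "(\<forall>i<n. f i \<in> U i) \<and> \<zero> \<in> L n \<and> (\<Oplus>i\<in>{..<n}. f i) \<oplus> \<zero> = \<zero>"
        using f n(1) by simp
      from mp[OF spec[OF spec[OF conjunct2[OF dec[OF n(2)]]]] this]
      have "\<forall>i<n. f i = \<zero>" by simp
      then show "f i = \<zero>" using \<open>i < n\<close> by blast
    qed
  qed
  then have "basic_decomposition R M n U" using st by (auto simp: basic_decomposition_def step_def)
  then show ?thesis unfolding multibasic_def by blast
qed

end

section \<open>Uniqueness of decompositions\<close>

lemma mod_homD:
  assumes "f \<in> mod_hom R M N"
  shows "x \<in> carrier M \<Longrightarrow> f x \<in> carrier N"
    and "\<lbrakk>x \<in> carrier M; y \<in> carrier M\<rbrakk> \<Longrightarrow> f (x \<oplus>\<^bsub>M\<^esub> y) = f x \<oplus>\<^bsub>N\<^esub> f y"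
    and "\<lbrakk>a \<in> carrier R; x \<in> carrier M\<rbrakk> \<Longrightarrow> f (a \<odot>\<^bsub>M\<^esub> x) = a \<odot>\<^bsub>N\<^esub> f x"
  using assms by (auto simp: mod_hom_def)

lemma mod_hom_compose:
  assumes "f \<in> mod_hom R M N" "g \<in> mod_hom R N P"
  shows "(\<lambda>x. g (f x)) \<in> mod_hom R M P"
  using assms by (auto simp: mod_hom_def Pi_def)

context val_module
begin

lemma mod_hom_zero:
  assumes "module R N" "f \<in> mod_hom R M N"
  shows "f \<zero> = \<zero>\<^bsub>N\<^esub>"
proof -
  interpret N: module R N by fact
  show ?thesis
    using mod_homD(3)[OF assms(2), of "\<zero>\<^bsub>R\<^esub>" "\<zero>"] mod_homD(1)[OF assms(2)] by simp
qed

lemma mod_hom_add: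
  assumes N: "module R N" and f: "f \<in> mod_hom R M N" and g: "g \<in> mod_hom R M N"
  shows "(\<lambda>x. f x \<oplus>\<^bsub>N\<^esub> g x) \<in> mod_hom R M N"
proof -
  interpret N: module R N by fact
  note F = mod_homD[OF f] and G = mod_homD[OF g]
  show ?thesis
    using F G unfolding mod_hom_def
    by (auto simp: N.smult_r_distr N.a_ac)
qed

lemma mod_hom_inj:
  assumes N: "val_module R N" and f: "f \<in> mod_hom R M N"
    and ker: "\<And>x. \<lbrakk>x \<in> carrier M; f x = \<zero>\<^bsub>N\<^esub>\<rbrakk> \<Longrightarrow> x = \<zero>"
  shows "inj_on f (carrier M)"
proof (rule inj_onI)
  interpret N: val_module R N by fact
  note F = mod_homD[OF f]
  fix x y assume xy: "x \<in> carrier M" "y \<in> carrier M" "f x = f y"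
  then have "f (x \<oplus> y) = \<zero>\<^bsub>N\<^esub>" using F by simp
  then show "x = y" using ker[of "x \<oplus> y"] xy by (simp add: add_eq_zero_iff)
qed

end

section \<open>Endomorphisms of a basic module\<close>

locale basic_val_module = val_module +
  assumes basic: "basic_module R M"
begin

lemma comparable:
  "\<lbrakk>x \<in> carrier M; y \<in> carrier M\<rbrakk> \<Longrightarrow> (\<exists>a\<in>carrier R. x = a \<odot> y) \<or> (\<exists>a\<in>carrier R. y = a \<odot> x)"
  using basic by (simp add: basic_module_def)

lemma nontrivial: "\<exists>x\<in>carrier M. x \<noteq> \<zero>"
  using basic M.zero_closed unfolding basic_module_def by blast

context
  fixes f g
  assumes f: "f \<in> mod_hom R M M" and g: "g \<in> mod_hom R M M"
    and bij: "bij_betw (\<lambda>x. f x \<oplus> g x) (carrier M) (carrier M)"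
begin

lemma sum_hom: "(\<lambda>x. f x \<oplus> g x) \<in> mod_hom R M M"
  by (rule mod_hom_add[OF module_axioms f g])

lemma sum_zero_imp: "\<lbrakk>x \<in> carrier M; f x = \<zero>; g x = \<zero>\<rbrakk> \<Longrightarrow> x = \<zero>"
  using bij mod_hom_zero[OF module_axioms sum_hom]
  unfolding bij_betw_def inj_on_def by (metis M.add.one_closed M.r_zero)

lemma sum_surj: "y \<in> carrier M \<Longrightarrow> \<exists>x\<in>carrier M. y = f x \<oplus> g x"
  using bij unfolding bij_betw_def by blast

text \<open>Two non-zero kernels would contain comparable non-zero elements. The one that is a
  multiple of the other lies in both kernels, so the bijective sum would kill it.\<close>

lemma one_inj: "inj_on f (carrier M) \<or> inj_on g (carrier M)"
proof (rule ccontr)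
  assume neg: "\<not> ?thesis"
  obtain x where x: "x \<in> carrier M" "f x = \<zero>" "x \<noteq> \<zero>"
    using mod_hom_inj[OF val_module_axioms f] neg by blast
  obtain y where y: "y \<in> carrier M" "g y = \<zero>" "y \<noteq> \<zero>"
    using mod_hom_inj[OF val_module_axioms g] neg by blast
  consider a where "a \<in> carrier R" "x = a \<odot> y" | a where "a \<in> carrier R" "y = a \<odot> x"
    using comparable x y by blast
  then show False
  proof cases
    case (1 a)
    then have "g x = \<zero>" using mod_homD(3)[OF g, of a y] y by simp
    then show False using sum_zero_imp x by blast
  next
    case (2 a)
    then have "f y = \<zero>" using mod_homD(3)[OF f, of a x] x by simp
    then show False using sum_zero_imp y by blast
  qed
qed

text \<open>The two images are comparable, since otherwise they would contain incomparable elements.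
  The larger one contains every f x + g x and so is the whole module.\<close>

lemma one_surj: "f ` carrier M = carrier M \<or> g ` carrier M = carrier M"
proof -
  note F = mod_homD[OF f] and G = mod_homD[OF g]
  have ranges: "f ` carrier M \<subseteq> g ` carrier M \<or> g ` carrier M \<subseteq> f ` carrier M"
  proof (rule ccontr)
    assume "\<not> ?thesis"
    then obtain s t where st: "s \<in> carrier M" "t \<in> carrier M" "f s \<notin> g ` carrier M" "g t \<notin> f ` carrier M"
      by blast
    consider a where "a \<in> carrier R" "f s = a \<odot> g t" | a where "a \<in> carrier R" "g t = a \<odot> f s"
      using comparable[OF F(1)[OF st(1)] G(1)[OF st(2)]] by blast
    then show False
    proof cases
      case (1 a)
      then have "f s = g (a \<odot> t)" using G(3) st by simp
      then show False using st 1 by blast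
    next
      case (2 a)
      then have "g t = f (a \<odot> s)" using F(3) st by simp
      then show False using st 2 by blast
    qed
  qed
  have sub: "h ` carrier M = carrier M"
    if h: "h \<in> mod_hom R M M" and fg: "f ` carrier M \<subseteq> h ` carrier M" "g ` carrier M \<subseteq> h ` carrier M" for h
  proof
    note H = mod_homD[OF h]
    show "h ` carrier M \<subseteq> carrier M" using H by blast
    show "carrier M \<subseteq> h ` carrier M"
    proof
      fix y assume "y \<in> carrier M"
      then obtain x where x: "x \<in> carrier M" "y = f x \<oplus> g x" using sum_surj by blast
      obtain p q where pq: "p \<in> carrier M" "f x = h p" "q \<in> carrier M" "g x = h q" using fg x by blast
      then have "y = h (p \<oplus> q)" using H x by simp
      then show "y \<in> h ` carrier M" using pq by blast
    qed
  qed
  show ?thesis using ranges sub[OF f] sub[OF g] by blast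
qed

end

text \<open>
  The remaining mixed case cannot occur because \<open>R\<close> is commutative: on a basic module \<open>f\<close> would act
  on a suitable element as a non-unit scalar, and on a kernel element of \<open>g\<close> as the bijection.
\<close>

lemma no_inj_with_surj:
  assumes f: "f \<in> mod_hom R M M" and g: "g \<in> mod_hom R M M"
    and bij: "bij_betw (\<lambda>x. f x \<oplus> g x) (carrier M) (carrier M)"
    and nsurj: "f ` carrier M \<noteq> carrier M" and ninj: "\<not> inj_on g (carrier M)"
  shows False
proof -
  define h where "h x = f x \<oplus> g x" for x
  have h: "h \<in> mod_hom R M M" using sum_hom[OF f g bij] unfolding h_def .
  note F = mod_homD[OF f] and H = mod_homD[OF h]
  obtain x where x: "x \<in> carrier M" "g x = \<zero>" "x \<noteq> \<zero>"
    using mod_hom_inj[OF val_module_axioms g] ninj by blast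
  have hx: "h x = f x" using x F by (simp add: h_def)
  have hx0: "h x \<noteq> \<zero>" using sum_zero_imp[OF f g bij x(1)] x hx by auto
  obtain y where y: "y \<in> carrier M" "y \<notin> f ` carrier M" using nsurj F by blast
  obtain z where z: "z \<in> carrier M" "y = h z" using sum_surj[OF f g bij y(1)] by (auto simp: h_def)
  \<comment> \<open>If h z were a multiple of f z, then y would be in the image of f.\<close>
  obtain a where a: "a \<in> carrier R" "f z = a \<odot> h z"
  proof -
    have ne: "h z \<noteq> a \<odot> f z" if "a \<in> carrier R" for a
    proof
      assume "h z = a \<odot> f z"
      then have "y = f (a \<odot> z)" using z F that by simp
      then show False using y z that by blast
    qed
    show thesis using comparable[OF F(1)[OF z(1)] H(1)[OF z(1)]] ne that by blast
  qed
  \<comment> \<open>If z were a multiple of x, then y = h z would be a multiple of h x = f x, again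
    in the image of f.\<close>
  obtain c where c: "c \<in> carrier R" "x = c \<odot> z"
  proof -
    have ne: "z \<noteq> c \<odot> x" if "c \<in> carrier R" for c
    proof
      assume "z = c \<odot> x"
      then have "y = f (c \<odot> x)" using z F H x hx that by simp
      then show False using y x that by blast
    qed
    show thesis using comparable[OF x(1) z(1)] ne that by blast
  qed
  \<comment> \<open>With x = c z one has f x = c (f z) = c (a (h z)) = a (h x), so a fixes the
    non-zero h x.\<close>
  have "h x = a \<odot> h x"
    using hx F(3)[of c z] H(3)[of c z] a c z H(1) by (simp add: smult_commute)
  then obtain b where b: "b \<in> carrier R" "a \<otimes>\<^bsub>R\<^esub> b = \<one>\<^bsub>R\<^esub>"
    using unit_if_fixes[of a "h x"] a x hx0 H by auto
  have "f (b \<odot> z) = (b \<otimes>\<^bsub>R\<^esub> a) \<odot> h z" using F(3)[of b z] a b z H(1) by (simp add: smult_assoc1)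
  also have "\<dots> = y" using b a z H R.m_comm[of a b] by simp
  finally have "f (b \<odot> z) = y" .
  then show False using y b z by blast
qed

text \<open>One of the maps is injective and one is surjective. If neither is both, one is injective
  but not onto and the other is not injective, which is the excluded mixed case.\<close>

lemma endo_sum_bij:
  assumes "f \<in> mod_hom R M M" "g \<in> mod_hom R M M"
    and bij: "bij_betw (\<lambda>x. f x \<oplus> g x) (carrier M) (carrier M)"
  shows "bij_betw f (carrier M) (carrier M) \<or> bij_betw g (carrier M) (carrier M)"
proof -
  have "bij_betw (\<lambda>x. g x \<oplus> f x) (carrier M) (carrier M)"
    using bij mod_homD(1)[OF assms(1)] mod_homD(1)[OF assms(2)]
    by (subst bij_betw_cong[where g = "\<lambda>x. f x \<oplus> g x"]) (auto simp: M.a_comm)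
  then show ?thesis
    using one_inj[OF assms] one_surj[OF assms] no_inj_with_surj[OF assms]
      no_inj_with_surj[OF assms(2,1)] unfolding bij_betw_def by blast
qed

lemma endo_finsum_bij:
  fixes n :: nat
  assumes "\<And>j. j < n \<Longrightarrow> f j \<in> mod_hom R M M"
    and "bij_betw (\<lambda>x. \<Oplus>j\<in>{..<n}. f j x) (carrier M) (carrier M)"
  shows "\<exists>j<n. bij_betw (f j) (carrier M) (carrier M)"
proof -
  have hom: "(\<lambda>x. \<Oplus>j\<in>{..<n}. f j x) \<in> mod_hom R M M" if "\<And>j. j < n \<Longrightarrow> f j \<in> mod_hom R M M" for n :: nat
    using that
  proof (induction n)
    case 0
    then show ?case by (simp add: mod_hom_def)
  next
    case (Suc n)
    have "(\<Oplus>j\<in>{..<Suc n}. f j x) = f n x \<oplus> (\<Oplus>j\<in>{..<n}. f j x)" if "x \<in> carrier M" for x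
      using that mod_homD(1)[OF Suc.prems] by (intro finsum_lessThan_Suc) auto
    moreover have "(\<lambda>x. f n x \<oplus> (\<Oplus>j\<in>{..<n}. f j x)) \<in> mod_hom R M M"
      using Suc by (intro mod_hom_add module_axioms) simp_all
    ultimately show ?case unfolding mod_hom_def by (simp add: Pi_def)
  qed
  show ?thesis using assms
  proof (induction n)
    case 0
    obtain x where "x \<in> carrier M" "x \<noteq> \<zero>" using nontrivial by blast
    then show ?case using 0 by (auto simp: bij_betw_def)
  next
    case (Suc n)
    have "bij_betw (\<lambda>x. f n x \<oplus> (\<Oplus>j\<in>{..<n}. f j x)) (carrier M) (carrier M)"
    proof (subst bij_betw_cong)
      fix x assume "x \<in> carrier M"
      then show "f n x \<oplus> (\<Oplus>j\<in>{..<n}. f j x) = (\<Oplus>j\<in>{..<Suc n}. f j x)"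
        using mod_homD(1)[OF Suc.prems(1)] by (intro finsum_lessThan_Suc[symmetric]) auto
    qed (rule Suc.prems(2))
    then have "bij_betw (f n) (carrier M) (carrier M) \<or>
        bij_betw (\<lambda>x. \<Oplus>j\<in>{..<n}. f j x) (carrier M) (carrier M)"
      using Suc.prems(1) by (intro endo_sum_bij hom) simp_all
    then show ?case using Suc by (metis less_Suc_eq)
  qed
qed

end

section \<open>Components of a direct sum and exchange of summands\<close>

context val_module
begin

lemma hom_finsum:
  fixes n :: nat
  assumes N: "val_module R N" and h: "h \<in> mod_hom R M N" and f: "\<And>j. j < n \<Longrightarrow> f j \<in> carrier M"
  shows "h (\<Oplus>j\<in>{..<n}. f j) = (\<Oplus>\<^bsub>N\<^esub>j\<in>{..<n}. h (f j))"
  using f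
proof (induction n)
  interpret N: val_module R N by fact
  case 0
  show ?case using mod_hom_zero[OF N.module_axioms h] by simp
next
  interpret N: val_module R N by fact
  case (Suc n)
  note H = mod_homD[OF h]
  have "h (\<Oplus>j\<in>{..<Suc n}. f j) = h (f n \<oplus> (\<Oplus>j\<in>{..<n}. f j))"
    using Suc.prems by (subst finsum_lessThan_Suc) auto
  also have "\<dots> = h (f n) \<oplus>\<^bsub>N\<^esub> (\<Oplus>\<^bsub>N\<^esub>j\<in>{..<n}. h (f j))"
    using Suc by (subst H(2)) (auto intro!: M.finsum_closed)
  also have "\<dots> = (\<Oplus>\<^bsub>N\<^esub>j\<in>{..<Suc n}. h (f j))"
    using Suc.prems H(1) by (subst N.finsum_lessThan_Suc) auto
  finally show ?case .
qed

text \<open>The components of \<open>x\<close> in a direct sum; \<open>SOME\<close> is only meaningful for \<open>x \<in> carrier M\<close>.\<close>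

definition component :: "(nat \<Rightarrow> 'c set) \<Rightarrow> nat \<Rightarrow> nat \<Rightarrow> 'c \<Rightarrow> 'c" where
  "component P m i x = (SOME f. (\<forall>i<m. f i \<in> P i) \<and> x = (\<Oplus>i\<in>{..<m}. f i)) i"

context
  fixes m P
  assumes ds: "is_direct_sum R M m P"
begin

lemma summand_submodule: "i < m \<Longrightarrow> submodule (P i) R M"
  using ds by (auto simp: is_direct_sum_def)

lemma summand_closed: "\<lbrakk>x \<in> P i; i < m\<rbrakk> \<Longrightarrow> x \<in> carrier M"
  using summand_submodule[of i] by (auto simp: submodule_iff)

lemma component_sum:
  assumes x: "x \<in> carrier M"
  shows "\<And>i. i < m \<Longrightarrow> component P m i x \<in> P i" "x = (\<Oplus>i\<in>{..<m}. component P m i x)"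
proof -
  have "\<exists>f. (\<forall>i<m. f i \<in> P i) \<and> x = (\<Oplus>i\<in>{..<m}. f i)"
    using ds x unfolding direct_sum_iff by blast
  from someI_ex[OF this]
  show "\<And>i. i < m \<Longrightarrow> component P m i x \<in> P i" "x = (\<Oplus>i\<in>{..<m}. component P m i x)"
    unfolding component_def by auto
qed

lemma direct_sum_zero:
  assumes "\<And>i. i < m \<Longrightarrow> f i \<in> P i" "(\<Oplus>i\<in>{..<m}. f i) = \<zero>" "i < m"
  shows "f i = \<zero>"
proof -
  have "(\<forall>i<m. f i \<in> P i) \<and> (\<Oplus>i\<in>{..<m}. f i) = \<zero>" using assms by blast
  from mp[OF spec[OF conjunct2[OF conjunct2[OF ds[unfolded direct_sum_iff]]]] this]
  show ?thesis using assms(3) by blast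
qed

lemma component_eqI:
  assumes f: "\<And>i. i < m \<Longrightarrow> f i \<in> P i" and k: "k < m"
  shows "component P m k (\<Oplus>i\<in>{..<m}. f i) = f k"
proof -
  define x where "x = (\<Oplus>i\<in>{..<m}. f i)"
  have fM: "f i \<in> carrier M" if "i < m" for i using f summand_closed that by blast
  then have x: "x \<in> carrier M" unfolding x_def by (intro M.finsum_closed) auto
  note C = component_sum[OF x]
  have CM: "component P m i x \<in> carrier M" if "i < m" for i using C(1) summand_closed that by blast
  have "(\<Oplus>i\<in>{..<m}. component P m i x \<oplus> f i) = x \<oplus> x"
    using C(2) fM CM by (subst M.finsum_addf) (auto simp: x_def[symmetric])
  then have "component P m k x \<oplus> f k = \<zero>"
    using x C(1) f summand_submodule k
    by (intro direct_sum_zero[where f = "\<lambda>i. component P m i x \<oplus> f i"]) (auto simp: submodule_iff)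
  then show ?thesis using add_eq_zero_iff CM fM k by (simp add: x_def)
qed

lemma component_self:
  assumes "k < m" "x \<in> P k" "i < m"
  shows "component P m i x = (if i = k then x else \<zero>)"
proof -
  have x: "x \<in> carrier M" using assms summand_closed by blast
  have "(\<Oplus>i\<in>{..<m}. ((\<lambda>_. \<zero>)(k := x)) i) = x"
    using x assms by (subst finsum_upd) auto
  moreover have "component P m i (\<Oplus>i\<in>{..<m}. ((\<lambda>_. \<zero>)(k := x)) i) = ((\<lambda>_. \<zero>)(k := x)) i"
    using assms summand_submodule by (intro component_eqI) (auto simp: submodule_iff)
  ultimately show ?thesis by simp
qed

lemma component_hom:
  assumes k: "k < m"
  shows "component P m k \<in> mod_hom R M (M\<lparr>carrier := P k\<rparr>)"
proof -
  have CM: "component P m i x \<in> carrier M" if "i < m" "x \<in> carrier M" for i x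
    using component_sum(1) summand_closed that by blast
  have "component P m k (x \<oplus> y) = component P m k x \<oplus> component P m k y"
    if "x \<in> carrier M" "y \<in> carrier M" for x y
  proof -
    have "x \<oplus> y = (\<Oplus>i\<in>{..<m}. component P m i x \<oplus> component P m i y)"
      using component_sum(2)[OF that(1)] component_sum(2)[OF that(2)] CM that
      by (subst M.finsum_addf) auto
    moreover have "component P m k \<dots> = component P m k x \<oplus> component P m k y"
      using that k component_sum(1) summand_submodule
      by (intro component_eqI) (auto simp: submodule_iff)
    ultimately show ?thesis by simp
  qed
  moreover have "component P m k (a \<odot> x) = a \<odot> component P m k x"
    if "a \<in> carrier R" "x \<in> carrier M" for a x
  proof -
    have "a \<odot> x = (\<Oplus>i\<in>{..<m}. a \<odot> component P m i x)"
      using component_sum(2)[OF that(2)] CM that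
        finsum_smult_ldistr[of "{..<m}" a "\<lambda>i. component P m i x"] by auto
    moreover have "component P m k \<dots> = a \<odot> component P m k x"
      using that k component_sum(1) summand_submodule
      by (intro component_eqI) (auto simp: submodule_iff)
    ultimately show ?thesis by simp
  qed
  ultimately show ?thesis using component_sum(1) k by (auto simp: mod_hom_def)
qed

text \<open>Adding to x the n in N with the same k-th component leaves an element of the other
  summands. Conversely, a member of N that lies in the sum of the others has zero k-th component and
  hence vanishes.\<close>

lemma exchange_summand:
  assumes k: "k < m" and N: "submodule N R M" and bij: "bij_betw (component P m k) N (P k)"
  shows "is_direct_sum R M m (P(k := N))"
proof -
  let ?p = "component P m k"
  note p = mod_homD[OF component_hom[OF k], simplified]
  have NM: "x \<in> carrier M" if "x \<in> N" for x using N that by (auto simp: submodule_iff)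
  have PM: "x \<in> carrier M" if "x \<in> P i" "i < m" for x i using summand_closed that by blast
  have P0: "\<zero> \<in> P i" if "i < m" for i using summand_submodule[OF that] by (simp add: submodule_iff)
  show ?thesis
    unfolding direct_sum_iff
  proof (intro conjI ballI allI impI)
    fix i assume "i < m"
    then show "submodule ((P(k := N)) i) R M" using N summand_submodule by simp
  next
    fix x assume x: "x \<in> carrier M"
    obtain n where n: "n \<in> N" "?p n = ?p x"
      using bij p(1)[OF x] unfolding bij_betw_def by (metis imageE)
    define g where "g i = component P m i (x \<oplus> n)" for i
    have xn: "x \<oplus> n \<in> carrier M" using x n NM by simp
    have g: "\<And>i. i < m \<Longrightarrow> g i \<in> P i" "(\<Oplus>i\<in>{..<m}. g i) = x \<oplus> n"
      using component_sum[OF xn] by (auto simp: g_def)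
    have gk: "g k = \<zero>" using p(2)[OF x NM[OF n(1)]] n p(1)[OF x] PM k by (simp add: g_def)
    have "(\<Oplus>i\<in>{..<m}. (g(k := n)) i) = (n \<oplus> g k) \<oplus> (\<Oplus>i\<in>{..<m}. g i)"
      using g PM NM n k by (intro finsum_upd) auto
    also have "\<dots> = x" using gk g(2) x NM[OF n(1)] by (simp add: M.a_ac)
    finally show "\<exists>f. (\<forall>i<m. f i \<in> (P(k := N)) i) \<and> x = (\<Oplus>i\<in>{..<m}. f i)"
      using g n by (intro exI[of _ "g(k := n)"]) auto
  next
    fix f i assume f: "(\<forall>i<m. f i \<in> (P(k := N)) i) \<and> (\<Oplus>i\<in>{..<m}. f i) = \<zero>" and i: "i < m"
    have fk: "f k \<in> N" using f k by auto
    have fM: "f i \<in> carrier M" if "i < m" for i using f that NM PM by (metis fun_upd_def)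
    define f' where "f' = f(k := \<zero>)"
    have f': "f' i \<in> P i" if "i < m" for i using f that P0 by (auto simp: f'_def)
    have "(\<Oplus>i\<in>{..<m}. f' i) = (\<zero> \<oplus> f k) \<oplus> (\<Oplus>i\<in>{..<m}. f i)"
      unfolding f'_def using fM k by (intro finsum_upd) auto
    also have "\<dots> = f k" using f fM[OF k] by simp
    finally have sum: "(\<Oplus>i\<in>{..<m}. f' i) = f k" .
    then have "?p (f k) = \<zero>" using component_eqI[of f', OF f' k] by (simp add: f'_def)
    moreover have "?p \<zero> = \<zero>" using component_self[OF k P0[OF k] k] by simp
    moreover have "\<zero> \<in> N" using N by (simp add: submodule_iff)
    ultimately have fk0: "f k = \<zero>" using bij fk unfolding bij_betw_def inj_on_def by metis
    then have "f' = f" by (auto simp: f'_def)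
    then show "f i = \<zero>" using direct_sum_zero[of f' i] f' sum fk0 i by simp
  qed
qed

end

text \<open>The identity of P k is the sum over j of the composites P k \<rightarrow> Q j
  \<rightarrow> P k, so one composite is bijective. The projection Q j \<rightarrow> P k is then an
  isomorphism, and Q j can take the place of P k.\<close>

lemma exchange_basic:
  assumes P: "basic_decomposition R M m P" and Q: "basic_decomposition R M n Q" and k: "k < m"
  shows "\<exists>j<n. mod_isomorphic R (M\<lparr>carrier := P k\<rparr>) (M\<lparr>carrier := Q j\<rparr>) \<and>
    basic_decomposition R M m (P(k := Q j))"
proof -
  have dsP: "is_direct_sum R M m P" and dsQ: "is_direct_sum R M n Q"
    and bP: "\<And>i. i < m \<Longrightarrow> basic_module R (M\<lparr>carrier := P i\<rparr>)"
    and bQ: "\<And>i. i < n \<Longrightarrow> basic_module R (M\<lparr>carrier := Q i\<rparr>)"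
    using P Q by (auto simp: basic_decomposition_def)
  interpret Pk: basic_val_module R "M\<lparr>carrier := P k\<rparr>"
    using submodule_val_module[OF summand_submodule[OF dsP k]] bP[OF k]
    by (simp add: basic_val_module_def basic_val_module_axioms_def)
  define p where "p = component P m k"
  define q where "q = component Q n"
  have pH: "p \<in> mod_hom R M (M\<lparr>carrier := P k\<rparr>)" using component_hom[OF dsP k] by (simp add: p_def)
  have qH: "q j \<in> mod_hom R M (M\<lparr>carrier := Q j\<rparr>)" if "j < n" for j
    using component_hom[OF dsQ that] by (simp add: q_def)
  note p = mod_homD[OF pH, simplified] and q = mod_homD[OF qH, simplified]
  have PkM: "x \<in> carrier M" if "x \<in> P k" for x using summand_closed[OF dsP that k] .
  have QM: "x \<in> carrier M" if "x \<in> Q j" "j < n" for x j using summand_closed[OF dsQ that] .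
  have qM: "q j x \<in> carrier M" if "j < n" "x \<in> carrier M" for j x using QM[OF q(1)] that by blast
  have "\<exists>j<n. bij_betw (\<lambda>x. p (q j x)) (carrier (M\<lparr>carrier := P k\<rparr>)) (carrier (M\<lparr>carrier := P k\<rparr>))"
  proof (rule Pk.endo_finsum_bij)
    fix j assume "j < n"
    then show "(\<lambda>x. p (q j x)) \<in> mod_hom R (M\<lparr>carrier := P k\<rparr>) (M\<lparr>carrier := P k\<rparr>)"
      using p q PkM qM unfolding mod_hom_def by (auto simp: Pi_def)
  next
    have "(\<Oplus>\<^bsub>M\<lparr>carrier := P k\<rparr>\<^esub>j\<in>{..<n}. p (q j x)) = x" if x: "x \<in> P k" for x
    proof -
      have "(\<Oplus>\<^bsub>M\<lparr>carrier := P k\<rparr>\<^esub>j\<in>{..<n}. p (q j x)) = p (\<Oplus>j\<in>{..<n}. q j x)"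
        using q(1) QM PkM[OF x]
        by (intro hom_finsum[OF Pk.val_module_axioms pH, symmetric]) blast
      also have "\<dots> = p x" using component_sum(2)[OF dsQ PkM[OF x]] by (simp add: q_def)
      also have "\<dots> = x" using component_self[OF dsP k x k] by (simp add: p_def)
      finally show ?thesis .
    qed
    then show "bij_betw (\<lambda>x. \<Oplus>\<^bsub>M\<lparr>carrier := P k\<rparr>\<^esub>j\<in>{..<n}. p (q j x))
        (carrier (M\<lparr>carrier := P k\<rparr>)) (carrier (M\<lparr>carrier := P k\<rparr>))"
      by (subst bij_betw_cong[where g = id]) auto
  qed
  then obtain j where j: "j < n" and bij: "bij_betw (\<lambda>x. p (q j x)) (P k) (P k)" by auto
  interpret Qj: basic_val_module R "M\<lparr>carrier := Q j\<rparr>"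
    using submodule_val_module[OF summand_submodule[OF dsQ j]] bQ[OF j]
    by (simp add: basic_val_module_def basic_val_module_axioms_def)
  note p0 = mod_hom_zero[OF Pk.module_axioms pH, simplified]
  note q0 = mod_hom_zero[OF Qj.module_axioms qH[OF j], simplified]
  have Q0: "\<zero> \<in> Q j" using Qj.M.zero_closed by simp
  have inj0: "x = \<zero>" if "x \<in> P k" "p (q j x) = \<zero>" for x
  proof -
    have "\<zero> \<in> P k" using Pk.M.zero_closed by simp
    then show ?thesis using bij that p0 q0 unfolding bij_betw_def inj_on_def by metis
  qed
  have surj: "\<exists>x\<in>P k. y = p (q j x)" if "y \<in> P k" for y using bij that unfolding bij_betw_def by blast
  have pQ: "p \<in> mod_hom R (M\<lparr>carrier := Q j\<rparr>) (M\<lparr>carrier := P k\<rparr>)"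
    using p QM j by (auto simp: mod_hom_def)
  have qP: "q j \<in> mod_hom R (M\<lparr>carrier := P k\<rparr>) (M\<lparr>carrier := Q j\<rparr>)"
    using q j PkM by (auto simp: mod_hom_def)
  \<comment> \<open>As Q j is basic, a kernel element z is comparable with q j x for a non-zero x in
    P k. Either z lies in the image of q j, on which p is injective, or q j x is a multiple of z and
    killed by p, which is impossible.\<close>
  have p_inj: "inj_on p (Q j)"
  proof -
    have "z = \<zero>" if z: "z \<in> Q j" "p z = \<zero>" for z
    proof -
      obtain x where x: "x \<in> P k" "x \<noteq> \<zero>" using Pk.nontrivial by auto
      have xM: "x \<in> carrier M" using x PkM by blast
      have w: "q j x \<in> Q j" using q(1)[OF j xM] .
      consider a where "a \<in> carrier R" "z = a \<odot> q j x" | a where "a \<in> carrier R" "q j x = a \<odot> z"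
        using Qj.comparable[of z "q j x"] z w by auto
      then show ?thesis
      proof cases
        case (1 a)
        then have "z = q j (a \<odot> x)" using q(3)[OF j _ xM] by simp
        moreover have "a \<odot> x \<in> P k" using Pk.smult_closed[of a x] 1 x by simp
        ultimately show ?thesis using inj0[of "a \<odot> x"] z q0 by simp
      next
        case (2 a)
        then have "p (q j x) = \<zero>" using p(3)[of a z] z QM[OF z(1) j] by simp
        then show ?thesis using inj0 x by blast
      qed
    qed
    then show ?thesis using Qj.mod_hom_inj[OF Pk.val_module_axioms pQ] by simp
  qed
  have "bij_betw p (Q j) (P k)"
    unfolding bij_betw_def
  proof (intro conjI p_inj equalityI subsetI)
    fix y assume "y \<in> P k"
    then obtain x where "x \<in> P k" "y = p (q j x)" using surj by blast
    then show "y \<in> p ` Q j" using q(1)[OF j] PkM by blast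
  next
    fix y assume "y \<in> p ` Q j"
    then show "y \<in> P k" using p(1)[OF QM[OF _ j]] by blast
  qed
  then have "is_direct_sum R M m (P(k := Q j))"
    using exchange_summand[OF dsP k summand_submodule[OF dsQ j]] by (simp add: p_def)
  then have "basic_decomposition R M m (P(k := Q j))"
    using bP bQ j by (simp add: basic_decomposition_def)
  moreover have "bij_betw (q j) (P k) (Q j)"
    unfolding bij_betw_def
  proof (intro conjI equalityI subsetI)
    show "inj_on (q j) (P k)"
      using Pk.mod_hom_inj[OF Qj.val_module_axioms qP] inj0 p0 by simp
    fix y assume y: "y \<in> Q j"
    then have "p y \<in> P k" using p QM j by blast
    then obtain x where x: "x \<in> P k" "p y = p (q j x)" using surj by blast
    then have "y = q j x" using p_inj y q(1)[OF j PkM[OF x(1)]] unfolding inj_on_def by blast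
    then show "y \<in> q j ` P k" using x by blast
  next
    fix y assume "y \<in> q j ` P k"
    then show "y \<in> Q j" using q(1)[OF j PkM] by blast
  qed
  then have "mod_isomorphic R (M\<lparr>carrier := P k\<rparr>) (M\<lparr>carrier := Q j\<rparr>)"
    using qP unfolding mod_isomorphic_def mod_iso_def by auto
  ultimately show ?thesis using j by blast
qed

text \<open>The summands P i are exchanged one at a time, always against the full original list Q.
  In the final decomposition a repeated index would make a non-zero summand independent of itself,
  so s is injective.\<close>

lemma basic_decomposition_embeds:
  assumes P: "basic_decomposition R M m P" and Q: "basic_decomposition R M n Q"
  shows "\<exists>s. inj_on s {..<m} \<and> (\<forall>i<m. s i < n \<and> mod_isomorphic R (M\<lparr>carrier := P i\<rparr>) (M\<lparr>carrier := Q (s i)\<rparr>))"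
proof -
  have "\<exists>s. (\<forall>i<k. s i < n \<and> mod_isomorphic R (M\<lparr>carrier := P i\<rparr>) (M\<lparr>carrier := Q (s i)\<rparr>)) \<and>
      basic_decomposition R M m (\<lambda>i. if i < k then Q (s i) else P i)" if "k \<le> m" for k
    using that
  proof (induction k)
    case 0
    then show ?case using P by simp
  next
    case (Suc k)
    then obtain s where s: "\<forall>i<k. s i < n \<and> mod_isomorphic R (M\<lparr>carrier := P i\<rparr>) (M\<lparr>carrier := Q (s i)\<rparr>)"
      and dec: "basic_decomposition R M m (\<lambda>i. if i < k then Q (s i) else P i)" by auto
    obtain j where j: "j < n" "mod_isomorphic R (M\<lparr>carrier := P k\<rparr>) (M\<lparr>carrier := Q j\<rparr>)"
      "basic_decomposition R M m ((\<lambda>i. if i < k then Q (s i) else P i)(k := Q j))"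
      using exchange_basic[OF dec Q, of k] Suc.prems by auto
    have "(\<lambda>i. if i < k then Q (s i) else P i)(k := Q j) = (\<lambda>i. if i < Suc k then Q ((s(k := j)) i) else P i)"
      by (rule ext) (auto simp: less_Suc_eq)
    then show ?case using s j by (intro exI[of _ "s(k := j)"]) (auto simp: less_Suc_eq)
  qed
  from this[of m] obtain s where
    s: "\<forall>i<m. s i < n \<and> mod_isomorphic R (M\<lparr>carrier := P i\<rparr>) (M\<lparr>carrier := Q (s i)\<rparr>)"
    and dec: "basic_decomposition R M m (\<lambda>i. if i < m then Q (s i) else P i)" by auto
  define N where "N i = (if i < m then Q (s i) else P i)" for i
  have ds: "is_direct_sum R M m N" and basic: "\<And>i. i < m \<Longrightarrow> basic_module R (M\<lparr>carrier := N i\<rparr>)"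
    using dec by (auto simp: basic_decomposition_def N_def[abs_def])
  have "inj_on s {..<m}"
  proof (rule inj_onI, rule ccontr)
    fix i j assume ij: "i \<in> {..<m}" "j \<in> {..<m}" "s i = s j" "i \<noteq> j"
    have N0: "\<zero> \<in> N l" if "l < m" for l
      using summand_submodule[OF ds that] by (simp add: submodule_iff)
    obtain z where z: "z \<in> N i" "z \<noteq> \<zero>"
      using basic[of i] N0[of i] ij unfolding basic_submodule_iff by auto
    have zM: "z \<in> carrier M" using summand_closed[OF ds z(1)] ij by auto
    have zj: "z \<in> N j" using z ij by (simp add: N_def)
    show False using component_self[OF ds _ z(1), of j] component_self[OF ds _ zj, of j] ij z by auto
  qed
  then show ?thesis using s by blast
qed

theorem basic_decomposition_unique:
  assumes P: "basic_decomposition R M m P" and Q: "basic_decomposition R M n Q"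
  shows "m = n \<and> (\<exists>\<sigma>. \<sigma> permutes {..<n} \<and>
    (\<forall>i<n. mod_isomorphic R (M\<lparr>carrier := P i\<rparr>) (M\<lparr>carrier := Q (\<sigma> i)\<rparr>)))"
proof -
  obtain s where s: "inj_on s {..<m}"
    "\<forall>i<m. s i < n \<and> mod_isomorphic R (M\<lparr>carrier := P i\<rparr>) (M\<lparr>carrier := Q (s i)\<rparr>)"
    using basic_decomposition_embeds[OF P Q] by blast
  obtain t where t: "inj_on t {..<n}" "\<forall>i<n. t i < m"
    using basic_decomposition_embeds[OF Q P] by blast
  have "m \<le> n" using card_inj_on_le[OF s(1), of "{..<n}"] s(2) by auto
  moreover have "n \<le> m" using card_inj_on_le[OF t(1), of "{..<m}"] t(2) by auto
  ultimately have mn: "m = n" by simp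
  \<comment> \<open>Extended by the identity, as \<open>permutes\<close> demands outside the index
    set.\<close>
  define \<sigma> where "\<sigma> i = (if i < n then s i else i)" for i
  have inj: "inj_on \<sigma> {..<n}" using s(1) mn by (auto simp: \<sigma>_def inj_on_def)
  moreover have "\<sigma> ` {..<n} \<subseteq> {..<n}" using s(2) mn by (auto simp: \<sigma>_def)
  ultimately have "\<sigma> ` {..<n} = {..<n}" by (intro endo_inj_surj) auto
  then have "\<sigma> permutes {..<n}"
    using inj by (intro bij_imp_permutes) (auto simp: bij_betw_def \<sigma>_def)
  then show ?thesis using mn s(2) by (auto simp: \<sigma>_def intro!: exI[of _ \<sigma>])
qed

end

section \<open>Arithmetic of Hahn series\<close>

declare add_bit_eq_xor [simp del] mult_bit_eq_and [simp del] bit_not_zero_iff [simp del] bit_not_one_iff [simp del]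

lemma bit_add_self [simp]: "x + x = (0::bit)"
  by (cases x) simp_all

lemma bit_add_add_self [simp]: "x + (x + y) = (y::bit)"
  by (simp flip: add.assoc)

section \<open>Well-ordered supports and the convolution product\<close>

lemma well_ordered_iff:
  "well_order_on S (relation_of (\<le>) S) \<longleftrightarrow> (\<forall>T\<subseteq>S. T \<noteq> {} \<longrightarrow> (\<exists>m\<in>T. \<forall>t\<in>T. m \<le> t))"
  for S :: "real set"
proof -
  have diff: "relation_of (\<le>) S - Id = {(x, y). x \<in> S \<and> y \<in> S \<and> x < y}"
    by (auto simp: relation_of_def)
  have lin: "linear_order_on S (relation_of (\<le>) S)"
    by (auto simp: linear_order_on_def partial_order_on_def preorder_on_def refl_on_def
        relation_of_def total_on_def intro!: transI antisymI)
  show ?thesis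
    unfolding well_order_on_def diff
  proof (intro iffI conjI lin allI impI)
    fix T assume "linear_order_on S (relation_of (\<le>) S) \<and> wf {(x, y). x \<in> S \<and> y \<in> S \<and> x < y}"
      and "T \<subseteq> S" "T \<noteq> {}"
    then obtain t where wf: "wf {(x, y). x \<in> S \<and> y \<in> S \<and> x < y}" and T: "T \<subseteq> S" "t \<in> T" by blast
    obtain m where "m \<in> T" "\<And>y. (y, m) \<in> {(x, y). x \<in> S \<and> y \<in> S \<and> x < y} \<Longrightarrow> y \<notin> T"
      using wfE_min[OF wf T(2)] by blast
    then show "\<exists>m\<in>T. \<forall>t\<in>T. m \<le> t" using T by (intro bexI[of _ m]) force+
  next
    assume min: "\<forall>T\<subseteq>S. T \<noteq> {} \<longrightarrow> (\<exists>m\<in>T. \<forall>t\<in>T. m \<le> t)"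
    show "wf {(x, y). x \<in> S \<and> y \<in> S \<and> x < y}"
    proof (rule wfI_min)
      fix x and Q :: "real set" assume "x \<in> Q"
      show "\<exists>z\<in>Q. \<forall>y. (y, z) \<in> {(x, y). x \<in> S \<and> y \<in> S \<and> x < y} \<longrightarrow> y \<notin> Q"
      proof (cases "Q \<inter> S = {}")
        case True
        then show ?thesis using \<open>x \<in> Q\<close> by blast
      next
        case False
        then obtain m where "m \<in> Q \<inter> S" "\<forall>t\<in>Q \<inter> S. m \<le> t" using min[rule_format, of "Q \<inter> S"] by auto
        then show ?thesis by (intro bexI[of _ m]) force+
      qed
    qed
  qed
qed

lemma hahn_series_iff:
  "a \<in> hahn_series \<longleftrightarrow> (\<forall>T\<subseteq>supp a. T \<noteq> {} \<longrightarrow> (\<exists>m\<in>T. \<forall>t\<in>T. m \<le> t))"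
  unfolding hahn_series_def by (simp add: well_ordered_iff)

lemma in_supp_iff: "q \<in> supp a \<longleftrightarrow> a q \<noteq> 0"
  by (simp add: supp_def bit_not_zero_iff)

lemma hahn_series_least:
  assumes "a \<in> hahn_series" "a \<noteq> (\<lambda>_. 0)"
  obtains m where "a m = 1" "\<And>q. q < m \<Longrightarrow> a q = 0" "(LEAST q. q \<in> supp a) = m"
proof -
  have "\<exists>q. q \<in> supp a" using assms(2) unfolding in_supp_iff by blast
  then have "supp a \<noteq> {}" by blast
  then obtain m where m: "m \<in> supp a" "\<forall>t\<in>supp a. m \<le> t" using assms(1) unfolding hahn_series_iff by blast
  then have "(LEAST q. q \<in> supp a) = m" by (intro Least_equality) auto
  moreover have "a m = 1" using m(1) by (simp add: supp_def)
  moreover have "a q = 0" if "q < m" for q using m(2) that by (force simp: in_supp_iff)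
  ultimately show thesis using that by blast
qed

text \<open>A decreasing sequence in a well-ordered set attains its minimum and is constant from
  there on, so a monotone subsequence can always be taken weakly increasing.\<close>

lemma increasing_subseq:
  assumes "a \<in> hahn_series" "\<And>n::nat. f n \<in> supp a"
  obtains r :: "nat \<Rightarrow> nat" where "strict_mono r" "incseq (f \<circ> r)"
proof -
  obtain r :: "nat \<Rightarrow> nat" where r: "strict_mono r" "monoseq (\<lambda>n. f (r n))" using seq_monosub[of f] by blast
  consider "incseq (\<lambda>n. f (r n))" | "decseq (\<lambda>n. f (r n))" using r(2) monoseq_iff by blast
  then show thesis
  proof cases
    assume "incseq (\<lambda>n. f (r n))"
    then show thesis using that[OF r(1)] by (simp add: comp_def)
  next
    assume dec: "decseq (\<lambda>n. f (r n))"
    have "\<exists>m\<in>range (f \<circ> r). \<forall>t\<in>range (f \<circ> r). m \<le> t"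
      by (rule assms(1)[unfolded hahn_series_iff, rule_format]) (use assms(2) in auto)
    then obtain N where N: "\<And>n. f (r N) \<le> f (r n)" by auto
    have "f (r (N + n)) = f (r N)" for n
      by (rule antisym[OF decseqD[OF dec] N]) simp
    then have "incseq (f \<circ> (\<lambda>n. r (N + n)))" by (simp add: incseq_def)
    moreover have "strict_mono (\<lambda>n. r (N + n))" using r(1) by (simp add: strict_mono_def)
    ultimately show thesis using that by blast
  qed
qed

text \<open>In an infinite descent of sums u + v, passing to a subsequence along which both u and v
  increase weakly gives a contradiction. Only an inclusion of supports is asked of c, so the
  indicator of the whole sumset is covered as well as the product.\<close>

lemma supp_sum_well_ordered:
  assumes a: "a \<in> hahn_series" and b: "b \<in> hahn_series"
    and c: "\<And>q. q \<in> supp c \<Longrightarrow> \<exists>u\<in>supp a. \<exists>v\<in>supp b. q = u + v"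
  shows "c \<in> hahn_series"
  unfolding hahn_series_iff
proof (intro allI impI, rule ccontr)
  fix T assume T: "T \<subseteq> supp c" "T \<noteq> {}" and "\<not> (\<exists>m\<in>T. \<forall>t\<in>T. m \<le> t)"
  then have desc: "\<And>m. m \<in> T \<Longrightarrow> \<exists>t\<in>T. t < m" by (meson not_less)
  have "\<exists>w. \<forall>n::nat. w n \<in> T \<and> w (Suc n) < w n"
  proof (rule dependent_nat_choice)
    show "\<exists>x. x \<in> T" using T(2) by blast
    show "\<exists>y. y \<in> T \<and> y < x" if "x \<in> T" for x using desc[OF that] by blast
  qed
  then obtain w where w: "\<And>n. w n \<in> T" "\<And>n::nat. w (Suc n) < w n" by blast
  have "\<exists>u v. u \<in> supp a \<and> v \<in> supp b \<and> w n = u + v" for n using c[of "w n"] w(1) T(1) by blast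
  then obtain u v where uv: "\<And>n. u n \<in> supp a" "\<And>n. v n \<in> supp b" "\<And>n. w n = u n + v n" by metis
  obtain r where r: "strict_mono r" "incseq (u \<circ> r)" by (rule increasing_subseq[OF a uv(1)])
  obtain s where s: "strict_mono s" "incseq (v \<circ> r \<circ> s)"
    by (rule increasing_subseq[OF b, of "v \<circ> r"]) (use uv(2) in auto)
  have "u (r (s 0)) \<le> u (r (s 1))" using r(2) s(1) by (simp add: incseq_def strict_mono_less_eq)
  moreover have "v (r (s 0)) \<le> v (r (s 1))" using s(2) by (simp add: incseq_def)
  moreover have "w (r (s 1)) < w (r (s 0))"
  proof -
    have "- w (r (s 0)) < - w (r (s 1))"
    proof (rule lift_Suc_mono_less[where f = "\<lambda>n. - w n"])
      show "r (s 0) < r (s 1)" using strict_monoD[OF r(1) strict_monoD[OF s(1)]] by simp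
      show "- w n < - w (Suc n)" for n using w(2)[of n] by simp
    qed
    then show ?thesis by simp
  qed
  ultimately show False using uv(3) by simp
qed

text \<open>In an infinite family both u and q - u could be made weakly increasing, which forces u
  to repeat.\<close>

lemma finite_convolution:
  assumes a: "a \<in> hahn_series" and b: "b \<in> hahn_series"
  shows "finite {u \<in> supp a. q - u \<in> supp b}"
proof (rule ccontr)
  assume "infinite {u \<in> supp a. q - u \<in> supp b}"
  then obtain u :: "nat \<Rightarrow> real" where u: "inj u" "range u \<subseteq> {u \<in> supp a. q - u \<in> supp b}"
    using infinite_countable_subset by blast
  then have ua: "\<And>n. u n \<in> supp a" and ub: "\<And>n. q - u n \<in> supp b" by auto
  obtain r where r: "strict_mono r" "incseq (u \<circ> r)" by (rule increasing_subseq[OF a ua])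
  obtain s where s: "strict_mono s" "incseq ((\<lambda>n. q - u (r n)) \<circ> s)"
    by (rule increasing_subseq[OF b, of "\<lambda>n. q - u (r n)"]) (use ub in auto)
  have "u (r (s 0)) \<le> u (r (s 1))" using r(2) s(1) by (simp add: incseq_def strict_mono_less_eq)
  moreover have "q - u (r (s 0)) \<le> q - u (r (s 1))" using s(2) unfolding incseq_def comp_def by (meson zero_le)
  ultimately have "r (s 0) = r (s 1)" using u(1) by (simp add: inj_def)
  then show False using r(1) s(1) by (metis strict_mono_eq zero_neq_one)
qed

text \<open>Several products can be compared once their sums run over one common finite index
  set.\<close>

lemma hahn_mult_eq:
  assumes "finite F" "{u \<in> supp a. q - u \<in> supp b} \<subseteq> F"
  shows "hahn_mult a b q = (\<Sum>u\<in>F. a u * b (q - u))"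
proof -
  let ?S = "{u \<in> supp a. q - u \<in> supp b}"
  have "hahn_mult a b q = (\<Sum>u\<in>?S. a u * b (q - u))"
    unfolding hahn_mult_def
    by (rule sum.reindex_bij_witness[of _ "\<lambda>u. (u, q - u)" fst]) auto
  also have "\<dots> = (\<Sum>u\<in>F. a u * b (q - u))"
    using assms by (intro sum.mono_neutral_left) (auto simp: in_supp_iff)
  finally show ?thesis .
qed

lemma hahn_mult_eq_conv:
  assumes "a \<in> hahn_series" "b \<in> hahn_series"
  shows "hahn_mult a b q = (\<Sum>u\<in>{u \<in> supp a. q - u \<in> supp b}. a u * b (q - u))"
  using assms by (intro hahn_mult_eq finite_convolution) auto

lemma hahn_mult_nonzeroE:
  assumes "hahn_mult a b q \<noteq> 0"
  obtains u where "u \<in> supp a" "q - u \<in> supp b"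
proof -
  have "{(u, v). u \<in> supp a \<and> v \<in> supp b \<and> u + v = q} \<noteq> {}"
    using assms unfolding hahn_mult_def by (metis sum.empty)
  then obtain u v where "u \<in> supp a" "v \<in> supp b" "u + v = q" by blast
  moreover from this have "q - u = v" by simp
  ultimately show thesis using that by metis
qed

lemma hahn_mult_closed:
  assumes "a \<in> hahn_series" "b \<in> hahn_series"
  shows "hahn_mult a b \<in> hahn_series"
proof (rule supp_sum_well_ordered[OF assms])
  fix q assume "q \<in> supp (hahn_mult a b)"
  then obtain u where "u \<in> supp a" "q - u \<in> supp b" by (auto simp: in_supp_iff elim: hahn_mult_nonzeroE)
  then show "\<exists>u\<in>supp a. \<exists>v\<in>supp b. q = u + v" by (intro bexI[of _ u] bexI[of _ "q - u"]) auto
qed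

lemma hahn_add_closed:
  assumes a: "a \<in> hahn_series" and b: "b \<in> hahn_series"
  shows "(\<lambda>q. a q + b q) \<in> hahn_series"
  unfolding hahn_series_iff
proof (intro allI impI)
  fix T assume T: "T \<subseteq> supp (\<lambda>q. a q + b q)" "T \<noteq> {}"
  have sub: "T \<subseteq> supp a \<union> supp b" using T(1) by (auto simp: in_supp_iff)
  have mins: "\<exists>m\<in>T \<inter> supp c. \<forall>t\<in>T \<inter> supp c. m \<le> t" if "c \<in> hahn_series" "T \<inter> supp c \<noteq> {}" for c
    using that unfolding hahn_series_iff by (meson inf.cobounded2)
  show "\<exists>m\<in>T. \<forall>t\<in>T. m \<le> t"
  proof (cases "T \<inter> supp a = {} \<or> T \<inter> supp b = {}")
    case True
    then show ?thesis using mins[OF a] mins[OF b] sub T(2) by blast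
  next
    case False
    obtain m where m: "m \<in> T \<inter> supp a" "\<forall>t\<in>T \<inter> supp a. m \<le> t" using mins[OF a] False by blast
    obtain n where n: "n \<in> T \<inter> supp b" "\<forall>t\<in>T \<inter> supp b. n \<le> t" using mins[OF b] False by blast
    have "\<forall>t\<in>T. min m n \<le> t" using m n sub by (auto simp: min_le_iff_disj)
    moreover have "min m n \<in> T" using m n by (auto simp: min_def)
    ultimately show ?thesis by blast
  qed
qed

lemma hahn_zero_closed: "(\<lambda>_. 0) \<in> hahn_series"
  by (simp add: hahn_series_iff supp_def)

section \<open>Monomials and the ring laws\<close>

definition monomial :: "real \<Rightarrow> hahn" where
  "monomial s = (\<lambda>q. if q = s then 1 else 0)"

lemma supp_monomial [simp]: "supp (monomial s) = {s}"
  by (auto simp: supp_def monomial_def)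

lemma monomial_closed [simp]: "monomial s \<in> hahn_series"
  by (auto simp: hahn_series_iff)

lemma monomial_mult: "hahn_mult (monomial s) a = (\<lambda>q. a (q - s))"
  by (rule ext, subst hahn_mult_eq[where F = "{s}"]) (auto, auto simp: monomial_def)

lemma hahn_mult_comm:
  assumes "a \<in> hahn_series" "b \<in> hahn_series"
  shows "hahn_mult a b = hahn_mult b a"
proof
  fix q
  show "hahn_mult a b q = hahn_mult b a q"
    unfolding hahn_mult_eq_conv[OF assms] hahn_mult_eq_conv[OF assms(2,1)]
    by (rule sum.reindex_bij_witness[of _ "\<lambda>u. q - u" "\<lambda>u. q - u"]) auto
qed

lemma hahn_mult_add_right:
  assumes "a \<in> hahn_series" "b \<in> hahn_series" "c \<in> hahn_series"
  shows "hahn_mult a (\<lambda>q. b q + c q) = (\<lambda>q. hahn_mult a b q + hahn_mult a c q)"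
proof
  fix q
  let ?F = "{u \<in> supp a. q - u \<in> supp b} \<union> {u \<in> supp a. q - u \<in> supp c}"
  have F: "finite ?F" using assms finite_convolution by blast
  have "hahn_mult a (\<lambda>q. b q + c q) q = (\<Sum>u\<in>?F. a u * (b (q - u) + c (q - u)))"
    using F by (intro hahn_mult_eq) (auto simp: in_supp_iff)
  also have "\<dots> = (\<Sum>u\<in>?F. a u * b (q - u)) + (\<Sum>u\<in>?F. a u * c (q - u))"
    by (simp add: distrib_left sum.distrib)
  also have "\<dots> = hahn_mult a b q + hahn_mult a c q"
    using F by (subst (1 2) hahn_mult_eq[OF F]) auto
  finally show "hahn_mult a (\<lambda>q. b q + c q) q = hahn_mult a b q + hahn_mult a c q" .
qed

definition triples :: "hahn \<Rightarrow> hahn \<Rightarrow> hahn \<Rightarrow> real \<Rightarrow> (real \<times> real) set" where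
  "triples a b c q = {(u, v). u \<in> supp a \<and> v \<in> supp b \<and> q - u - v \<in> supp c}"

text \<open>With the triple product in this symmetric form, associativity is a reindexing of
  \<open>triples\<close>.\<close>

lemma hahn_mult_triple:
  assumes a: "a \<in> hahn_series" and b: "b \<in> hahn_series" and c: "c \<in> hahn_series"
  shows "hahn_mult (hahn_mult a b) c q = (\<Sum>(u, v)\<in>triples a b c q. a u * b v * c (q - u - v))"
proof -
  \<comment> \<open>The indicator of the full sumset of the supports. The support of
    \<open>hahn_mult a b\<close> may be smaller because terms cancel modulo 2, and would then miss
    pairs (u, v) that belong to \<open>triples\<close>.\<close>
  define ab where "ab = (\<lambda>s. if \<exists>u\<in>supp a. \<exists>v\<in>supp b. s = u + v then 1 else 0 :: bit)"
  have ab: "ab \<in> hahn_series"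
    by (rule supp_sum_well_ordered[OF a b]) (auto simp: ab_def in_supp_iff split: if_splits)
  have abI: "u + v \<in> supp ab" if "u \<in> supp a" "v \<in> supp b" for u v
    using that by (auto simp: ab_def supp_def)
  define F where "F = {s \<in> supp ab. q - s \<in> supp c}"
  have F: "finite F" unfolding F_def using ab c by (rule finite_convolution)
  define G where "G s = {u \<in> supp a. s - u \<in> supp b}" for s
  have G: "finite (G s)" for s unfolding G_def using a b by (rule finite_convolution)
  have "hahn_mult (hahn_mult a b) c q = (\<Sum>s\<in>F. hahn_mult a b s * c (q - s))"
  proof (rule hahn_mult_eq[OF F], safe)
    fix s assume s: "s \<in> supp (hahn_mult a b)" "q - s \<in> supp c"
    then obtain u where "u \<in> supp a" "s - u \<in> supp b" by (auto simp: in_supp_iff elim: hahn_mult_nonzeroE)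
    then show "s \<in> F" using s abI[of u "s - u"] by (simp add: F_def)
  qed
  also have "\<dots> = (\<Sum>s\<in>F. \<Sum>u\<in>G s. a u * b (s - u) * c (q - s))"
    unfolding hahn_mult_eq_conv[OF a b] G_def by (simp add: sum_distrib_right)
  also have "\<dots> = (\<Sum>(s, u)\<in>Sigma F G. a u * b (s - u) * c (q - s))"
    using F G by (intro sum.Sigma) auto
  also have "\<dots> = (\<Sum>(u, v)\<in>triples a b c q. a u * b v * c (q - u - v))"
    by (rule sum.reindex_bij_witness[of _ "\<lambda>(u, v). (u + v, u)" "\<lambda>(s, u). (u, s - u)"])
      (auto simp: triples_def F_def G_def diff_diff_eq intro: abI)
  finally show ?thesis .
qed

lemma hahn_mult_assoc:
  assumes a: "a \<in> hahn_series" and b: "b \<in> hahn_series" and c: "c \<in> hahn_series"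
  shows "hahn_mult (hahn_mult a b) c = hahn_mult a (hahn_mult b c)"
proof
  fix q
  \<comment> \<open>Commutativity moves the nested product to the left, where the triple formula
    applies.\<close>
  have "hahn_mult a (hahn_mult b c) q = hahn_mult (hahn_mult b c) a q"
    using hahn_mult_comm a hahn_mult_closed[OF b c] by simp
  also have "\<dots> = (\<Sum>(v, w)\<in>triples b c a q. b v * c w * a (q - v - w))"
    by (rule hahn_mult_triple[OF b c a])
  also have "\<dots> = (\<Sum>(u, v)\<in>triples a b c q. a u * b v * c (q - u - v))"
    by (rule sum.reindex_bij_witness[of _ "\<lambda>(u, v). (v, q - u - v)" "\<lambda>(v, w). (q - v - w, v)"])
      (auto simp: triples_def algebra_simps)
  also have "\<dots> = hahn_mult (hahn_mult a b) c q" by (rule hahn_mult_triple[OF a b c, symmetric])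
  finally show "hahn_mult (hahn_mult a b) c q = hahn_mult a (hahn_mult b c) q" by simp
qed

lemma hahn_mult_vanish:
  assumes "\<And>q. q < r \<Longrightarrow> a q = 0" "\<And>q. q < s \<Longrightarrow> b q = 0" "q < r + s"
  shows "hahn_mult a b q = 0"
proof (rule ccontr)
  assume "hahn_mult a b q \<noteq> 0"
  then obtain u where "a u \<noteq> 0" "b (q - u) \<noteq> 0" by (auto simp: in_supp_iff elim: hahn_mult_nonzeroE)
  then have "r \<le> u" "s \<le> q - u" using assms by (meson not_le)+
  then show False using assms(3) by simp
qed

lemma hahn_mult_vanish_le:
  assumes "\<And>q. q < r \<Longrightarrow> a q = 0" "\<And>q. q \<le> s \<Longrightarrow> b q = 0" "q \<le> r + s"
  shows "hahn_mult a b q = 0"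
proof (rule ccontr)
  assume "hahn_mult a b q \<noteq> 0"
  then obtain u where "a u \<noteq> 0" "b (q - u) \<noteq> 0" by (auto simp: in_supp_iff elim: hahn_mult_nonzeroE)
  then have "r \<le> u" "s < q - u" using assms by (meson not_le)+
  then show False using assms(3) by simp
qed

lemma hahn_field_simps [simp]:
  "carrier hahn_field = hahn_series" "monoid.mult hahn_field = hahn_mult"
  "one hahn_field = monomial 0" "ring.zero hahn_field = (\<lambda>_. 0)"
  "ring.add hahn_field = (\<lambda>a b q. a q + b q)"
  by (simp_all add: hahn_field_def monomial_def)

text \<open>Trades the extended-real valuation for the vanishing of coefficients, the form in which
  A and \<open>I_pos\<close> are handled below.\<close>

lemma hahn_val_ge_iff:
  assumes "a \<in> hahn_series"
  shows "hahn_val a \<ge> ereal r \<longleftrightarrow> (\<forall>q<r. a q = 0)" "hahn_val a > ereal r \<longleftrightarrow> (\<forall>q\<le>r. a q = 0)"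
proof -
  have "(hahn_val a \<ge> ereal r \<longleftrightarrow> (\<forall>q<r. a q = 0)) \<and> (hahn_val a > ereal r \<longleftrightarrow> (\<forall>q\<le>r. a q = 0))"
  proof (cases "a = (\<lambda>_. 0)")
    case False
    obtain m where m: "a m = 1" "\<And>q. q < m \<Longrightarrow> a q = 0" "(LEAST q. q \<in> supp a) = m"
      by (rule hahn_series_least[OF assms False]) (rule that)
    have "hahn_val a = ereal m" using False m(3) by (simp add: hahn_val_def)
    moreover have "r \<le> m \<longleftrightarrow> (\<forall>q<r. a q = 0)" using m by (metis not_le order_less_le_trans zero_neq_one)
    moreover have "r < m \<longleftrightarrow> (\<forall>q\<le>r. a q = 0)" using m by (metis not_le order_le_less_trans zero_neq_one)
    ultimately show ?thesis by simp
  qed (simp add: hahn_val_def)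
  then show "hahn_val a \<ge> ereal r \<longleftrightarrow> (\<forall>q<r. a q = 0)" "hahn_val a > ereal r \<longleftrightarrow> (\<forall>q\<le>r. a q = 0)" by blast+
qed

lemma hahn_ring_simps [simp]:
  "monoid.mult hahn_ring = hahn_mult" "one hahn_ring = monomial 0" "ring.zero hahn_ring = (\<lambda>_. 0)"
  "ring.add hahn_ring = (\<lambda>a b q. a q + b q)"
  by (simp_all add: hahn_ring_def flip: hahn_field_simps)

lemma carrier_hahn_ring: "carrier hahn_ring = {a \<in> hahn_series. \<forall>q<0. a q = 0}"
  using hahn_val_ge_iff(1)[of _ 0] by (auto simp: hahn_ring_def zero_ereal_def)

lemma I_pos_eq: "I_pos = {a \<in> hahn_series. \<forall>q\<le>0. a q = 0}"
  using hahn_val_ge_iff(2)[of _ 0] by (auto simp: I_pos_def zero_ereal_def)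

lemma hahn_ring_cring: "cring hahn_ring"
proof (rule cringI)
  show "abelian_group hahn_ring"
  proof (rule abelian_groupI)
    fix x assume "x \<in> carrier hahn_ring"
    then show "\<exists>y\<in>carrier hahn_ring. y \<oplus>\<^bsub>hahn_ring\<^esub> x = \<zero>\<^bsub>hahn_ring\<^esub>"
      by (intro bexI[of _ x]) auto
  qed (auto simp: carrier_hahn_ring hahn_add_closed hahn_zero_closed add_ac)
  show "comm_monoid hahn_ring"
  proof (rule comm_monoidI)
    fix x y assume xy: "x \<in> carrier hahn_ring" "y \<in> carrier hahn_ring"
    then show "x \<otimes>\<^bsub>hahn_ring\<^esub> y \<in> carrier hahn_ring"
      using hahn_mult_vanish[of 0 x 0 y] by (auto simp: carrier_hahn_ring hahn_mult_closed)
    show "x \<otimes>\<^bsub>hahn_ring\<^esub> y = y \<otimes>\<^bsub>hahn_ring\<^esub> x"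
      using xy hahn_mult_comm by (auto simp: carrier_hahn_ring)
  qed (auto simp: carrier_hahn_ring hahn_mult_assoc monomial_mult, auto simp: monomial_def)
  fix x y z assume "x \<in> carrier hahn_ring" "y \<in> carrier hahn_ring" "z \<in> carrier hahn_ring"
  then show "(x \<oplus>\<^bsub>hahn_ring\<^esub> y) \<otimes>\<^bsub>hahn_ring\<^esub> z = x \<otimes>\<^bsub>hahn_ring\<^esub> z \<oplus>\<^bsub>hahn_ring\<^esub> y \<otimes>\<^bsub>hahn_ring\<^esub> z"
    using hahn_mult_add_right[of z x y] hahn_mult_comm[of z] hahn_add_closed by (simp add: carrier_hahn_ring)
qed

text \<open>Spherical completeness of \<open>K\<close>.\<close>

lemma glue_truncations:
  fixes z :: "real \<Rightarrow> hahn"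
  assumes down: "\<And>d e. \<lbrakk>d \<in> D; e \<le> d\<rbrakk> \<Longrightarrow> e \<in> D"
    and z: "\<And>d. d \<in> D \<Longrightarrow> z d \<in> hahn_series"
    and agree: "\<And>d e q. \<lbrakk>d \<in> D; e \<in> D; d \<le> e; q \<le> d\<rbrakk> \<Longrightarrow> z d q = z e q"
  obtains y where "y \<in> hahn_series" "\<And>d q. \<lbrakk>d \<in> D; q \<le> d\<rbrakk> \<Longrightarrow> y q = z d q"
proof -
  \<comment> \<open>Diagonal choice: by agreement of the truncations, the coefficient of z q at q
    itself is already final.\<close>
  define y where "y q = (if q \<in> D then z q q else 0)" for q
  have y: "y q = z d q" if "d \<in> D" "q \<le> d" for d q
    using that down[OF that] agree[of q d q] by (simp add: y_def)
  have "y \<in> hahn_series"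
    unfolding hahn_series_iff
  proof (intro allI impI)
    fix T assume T: "T \<subseteq> supp y" "T \<noteq> {}"
    then obtain t where t: "t \<in> T" by blast
    then have "y t \<noteq> 0" using T by (auto simp: in_supp_iff)
    then have tD: "t \<in> D" by (auto simp: y_def split: if_splits)
    \<comment> \<open>Up to t the series y coincides with the single series z t, whose well-ordered
      support supplies the minimum.\<close>
    have "T \<inter> {..t} \<subseteq> supp (z t)" using T y[OF tD] by (auto simp: in_supp_iff)
    moreover have "T \<inter> {..t} \<noteq> {}" using t by auto
    ultimately have "\<exists>m\<in>T \<inter> {..t}. \<forall>s\<in>T \<inter> {..t}. m \<le> s"
      by (rule z[OF tD, unfolded hahn_series_iff, rule_format])
    then obtain m where m: "m \<in> T \<inter> {..t}" "\<forall>s\<in>T \<inter> {..t}. m \<le> s" by blast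
    then have "\<forall>s\<in>T. m \<le> s" by (metis IntI IntD2 atMost_iff linorder_le_cases order_trans)
    then show "\<exists>m\<in>T. \<forall>s\<in>T. m \<le> s" using m by blast
  qed
  then show thesis using y that by blast
qed

section \<open>Inverses by the geometric series\<close>

primrec hahn_power :: "hahn \<Rightarrow> nat \<Rightarrow> hahn" where
  "hahn_power e 0 = monomial 0"
| "hahn_power e (Suc n) = hahn_mult e (hahn_power e n)"

text \<open>Partial sums for the inverse of 1 + e; in characteristic 2 the signs do not
  alternate.\<close>

primrec geometric :: "hahn \<Rightarrow> nat \<Rightarrow> hahn" where
  "geometric e 0 = (\<lambda>_. 0)"
| "geometric e (Suc n) = (\<lambda>q. geometric e n q + hahn_power e n q)"

lemma hahn_power_closed: "e \<in> hahn_series \<Longrightarrow> hahn_power e n \<in> hahn_series"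
  by (induction n) (auto intro: hahn_mult_closed)

lemma geometric_closed: "e \<in> hahn_series \<Longrightarrow> geometric e n \<in> hahn_series"
  by (induction n) (auto intro: hahn_add_closed hahn_power_closed hahn_zero_closed)

lemma monomial_zero_mult [simp]: "hahn_mult (monomial 0) a = a"
  by (simp add: monomial_mult)

lemma one_in_hahn_ring [simp]: "monomial 0 \<in> carrier hahn_ring"
  by (auto simp: carrier_hahn_ring) (simp add: monomial_def)

lemma monomial_in_hahn_ring: "0 \<le> s \<Longrightarrow> monomial s \<in> carrier hahn_ring"
  by (auto simp: carrier_hahn_ring) (simp add: monomial_def)

lemma monomial_monomial: "hahn_mult (monomial s) (monomial t) = monomial (s + t)"
  unfolding monomial_mult by (auto simp: monomial_def)

lemma hahn_mult_zero_right [simp]: "hahn_mult a (\<lambda>_. 0) = (\<lambda>_. 0)"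
  by (simp add: hahn_mult_def supp_def)

lemma hahn_mult_zero_left [simp]: "hahn_mult (\<lambda>_. 0) a = (\<lambda>_. 0)"
  by (simp add: hahn_mult_def supp_def)

lemma hahn_mult_add_left:
  assumes "a \<in> hahn_series" "b \<in> hahn_series" "c \<in> hahn_series"
  shows "hahn_mult (\<lambda>q. a q + b q) c = (\<lambda>q. hahn_mult a c q + hahn_mult b c q)"
  using hahn_mult_add_right[of c a b] hahn_mult_comm[of c] hahn_add_closed assms by simp

text \<open>Neighbouring powers cancel in pairs, as the characteristic is 2.\<close>

lemma geometric_telescope:
  assumes e: "e \<in> hahn_series"
  shows "hahn_mult (\<lambda>q. monomial 0 q + e q) (geometric e n) = (\<lambda>q. monomial 0 q + hahn_power e n q)"
proof (induction n)
  case (Suc n)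
  have a: "(\<lambda>q. monomial 0 q + e q) \<in> hahn_series" using e by (intro hahn_add_closed) simp_all
  have "hahn_mult (\<lambda>q. monomial 0 q + e q) (hahn_power e n) = (\<lambda>q. hahn_power e n q + hahn_power e (Suc n) q)"
    using e hahn_power_closed by (simp add: hahn_mult_add_left)
  then show ?case
    using Suc hahn_mult_add_right[OF a geometric_closed[OF e] hahn_power_closed[OF e], of n n]
    by (simp add: add_ac)
qed simp

text \<open>Write a = 1 + e with e vanishing below some \<delta> > 0. The powers of e vanish on ever
  longer initial segments, so the partial geometric sums stabilise coefficientwise and can be glued
  to an inverse.\<close>

lemma hahn_ring_unit:
  assumes a: "a \<in> carrier hahn_ring" and a0: "a 0 = 1"
  shows "\<exists>b\<in>carrier hahn_ring. hahn_mult a b = monomial 0"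
proof -
  have ah: "a \<in> hahn_series" and aneg: "\<And>q. q < 0 \<Longrightarrow> a q = 0" using a by (auto simp: carrier_hahn_ring)
  define e where "e = (\<lambda>q. monomial 0 q + a q)"
  have e: "e \<in> hahn_series" unfolding e_def using ah by (intro hahn_add_closed) simp_all
  have a_eq: "a = (\<lambda>q. monomial 0 q + e q)" by (simp add: e_def)
  have e0: "e q = 0" if "q \<le> 0" for q using that a0 aneg by (cases "q = 0") (auto simp: e_def monomial_def)
  \<comment> \<open>The leading exponent of e, positive because the constant terms of 1 and a
    cancel; any positive number serves if e = 0.\<close>
  obtain \<delta> where \<delta>: "\<delta> > 0" "\<And>q. q < \<delta> \<Longrightarrow> e q = 0"
  proof (cases "e = (\<lambda>_. 0)")
    case True
    then show thesis using that[of 1] by simp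
  next
    case False
    obtain m where m: "e m = 1" "\<And>q. q < m \<Longrightarrow> e q = 0" "(LEAST q. q \<in> supp e) = m"
      by (rule hahn_series_least[OF e False]) (rule that)
    then show thesis using that[of m] e0[of m] by force
  qed
  have pow: "hahn_power e n q = 0" if "q < n * \<delta>" for n q
    using that
  proof (induction n arbitrary: q)
    case 0
    then show ?case by (simp add: monomial_def)
  next
    case (Suc n)
    then show ?case
      using hahn_mult_vanish[of \<delta> e "n * \<delta>" "hahn_power e n" q] \<delta>(2) by (simp add: algebra_simps)
  qed
  have geom: "geometric e n q = geometric e m q" if "n \<le> m" "q < n * \<delta>" for n m q
    using that(1)
  proof (induction m rule: dec_induct)
    case (step m)
    have "q < m * \<delta>" using that(2) step(1) \<delta>(1) by (meson less_le_trans mult_le_cancel_right_pos of_nat_le_iff)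
    then show ?case using step pow[of q m] by simp
  qed simp
  \<comment> \<open>Enough terms for the partial sum to be final up to d: the n-th power vanishes
    below n \<delta>, and N d \<delta> exceeds d.\<close>
  define N where "N d = nat (\<lceil>d / \<delta>\<rceil> + 1)" for d
  have N: "d < N d * \<delta>" for d
  proof -
    have "d / \<delta> < real (N d)" unfolding N_def by linarith
    then show ?thesis using \<delta>(1) by (simp add: field_simps)
  qed
  have N_mono: "N d \<le> N d'" if "d \<le> d'" for d d'
    unfolding N_def using that \<delta>(1) by (intro nat_mono add_mono ceiling_mono divide_right_mono) auto
  obtain y where y: "y \<in> hahn_series" "\<And>d q. q \<le> d \<Longrightarrow> y q = geometric e (N d) q"
  proof (rule glue_truncations[of UNIV "\<lambda>d. geometric e (N d)"])
    fix d d' q :: real assume "d \<le> d'" "q \<le> d"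
    then show "geometric e (N d) q = geometric e (N d') q" using N[of d] by (intro geom N_mono) auto
  qed (use that geometric_closed[OF e] in auto)
  have "y q = 0" if "q < 0" for q
    using y(2)[of q q] geom[of 0 "N q" q] that by simp
  then have "y \<in> carrier hahn_ring" using y(1) by (auto simp: carrier_hahn_ring)
  moreover have "hahn_mult a y = monomial 0"
  proof
    fix d
    let ?z = "geometric e (N d)"
    have z: "?z \<in> hahn_series" by (rule geometric_closed[OF e])
    \<comment> \<open>The error ?z + y vanishes up to d, and a has no negative exponents, so the
      error does not reach the coefficient at d.\<close>
    have "hahn_mult a y = hahn_mult a (\<lambda>q. ?z q + (?z q + y q))" by simp
    also have "\<dots> = (\<lambda>q. hahn_mult a ?z q + hahn_mult a (\<lambda>q. ?z q + y q) q)"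
      by (rule hahn_mult_add_right[OF ah z hahn_add_closed[OF z y(1)]])
    finally have "hahn_mult a y d = hahn_mult a ?z d + hahn_mult a (\<lambda>q. ?z q + y q) d" by simp
    also have "hahn_mult a (\<lambda>q. ?z q + y q) d = 0"
      using hahn_mult_vanish_le[of 0 a d "\<lambda>q. ?z q + y q" d] y(2)[of _ d] aneg by simp
    also have "hahn_mult a ?z d = monomial 0 d"
      using geometric_telescope[OF e, of "N d"] pow[OF N[of d]] by (simp flip: a_eq)
    finally show "hahn_mult a y d = monomial 0 d" by simp
  qed
  ultimately show ?thesis by blast
qed

section \<open>Monomial times unit, divisibility, countable cofinality\<close>

lemma hahn_factor:
  assumes a: "a \<in> hahn_series" "a \<noteq> (\<lambda>_. 0)"
  obtains m u v where "a m = 1" "\<And>q. q < m \<Longrightarrow> a q = 0" "u \<in> carrier hahn_ring" "v \<in> carrier hahn_ring"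
    "hahn_mult u v = monomial 0" "a = hahn_mult (monomial m) u"
proof -
  obtain m where m: "a m = 1" "\<And>q. q < m \<Longrightarrow> a q = 0" "(LEAST q. q \<in> supp a) = m"
    by (rule hahn_series_least[OF a]) (rule that)
  define u where "u = hahn_mult (monomial (- m)) a"
  have u: "u = (\<lambda>q. a (q + m))" by (simp add: u_def monomial_mult)
  have "u \<in> hahn_series" unfolding u_def using a by (intro hahn_mult_closed) simp_all
  then have uA: "u \<in> carrier hahn_ring" using m by (simp add: carrier_hahn_ring u)
  obtain v where "v \<in> carrier hahn_ring" "hahn_mult u v = monomial 0"
    using hahn_ring_unit[OF uA] m(1) by (auto simp: u)
  moreover have "a = hahn_mult (monomial m) u" by (simp add: monomial_mult u)
  ultimately show thesis using that m uA by blast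
qed

lemma hahn_field_inverse:
  assumes a: "a \<in> hahn_series" "a \<noteq> (\<lambda>_. 0)"
  shows "\<exists>b\<in>hahn_series. hahn_mult a b = monomial 0"
proof -
  obtain m u v where m: "a m = 1" "\<And>q. q < m \<Longrightarrow> a q = 0" "u \<in> carrier hahn_ring" "v \<in> carrier hahn_ring"
    "hahn_mult u v = monomial 0" "a = hahn_mult (monomial m) u"
    by (rule hahn_factor[OF a]) (rule that)
  have uv: "u \<in> hahn_series" "v \<in> hahn_series" using m by (auto simp: carrier_hahn_ring)
  have "hahn_mult a (hahn_mult v (monomial (- m))) = hahn_mult (monomial m) (hahn_mult (hahn_mult u v) (monomial (- m)))"
    using uv m(6) by (simp add: hahn_mult_assoc hahn_mult_closed)
  also have "\<dots> = monomial 0" by (simp add: m(5) monomial_monomial)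
  finally show ?thesis using uv by (intro bexI[of _ "hahn_mult v (monomial (- m))"]) (auto intro: hahn_mult_closed)
qed

text \<open>With a = t^m u, the quotient is the inverse of u times t^(-m) b, and the latter has no
  negative exponents.\<close>

lemma hahn_divides:
  assumes a: "a \<in> hahn_series" "a m = 1" "\<And>q. q < m \<Longrightarrow> a q = 0"
    and b: "b \<in> hahn_series" "\<And>q. q < m \<Longrightarrow> b q = 0"
  shows "\<exists>c\<in>carrier hahn_ring. b = hahn_mult a c"
proof -
  have "a \<noteq> (\<lambda>_. 0)" using a(2) by auto
  then obtain m' u v where m': "a m' = 1" "\<And>q. q < m' \<Longrightarrow> a q = 0" and
    uv: "u \<in> carrier hahn_ring" "v \<in> carrier hahn_ring"
    "hahn_mult u v = monomial 0" "a = hahn_mult (monomial m') u"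
    by (rule hahn_factor[OF a(1)]) (rule that)
  have mm: "m' = m" using m' a by (metis linorder_neqE_linordered_idom zero_neq_one)
  have uvh: "u \<in> hahn_series" "v \<in> hahn_series" using uv by (auto simp: carrier_hahn_ring)
  define b' where "b' = hahn_mult (monomial (- m)) b"
  have b'h: "b' \<in> hahn_series" unfolding b'_def using b by (intro hahn_mult_closed) simp_all
  have b': "b' \<in> carrier hahn_ring"
    using b'h b(2) by (simp add: carrier_hahn_ring b'_def monomial_mult)
  have "hahn_mult a (hahn_mult v b') = hahn_mult (monomial m) (hahn_mult (hahn_mult u v) b')"
    using uvh uv(4) b'h by (simp add: mm hahn_mult_assoc hahn_mult_closed)
  also have "\<dots> = b" by (simp add: uv(3) b'_def monomial_mult)
  moreover have "hahn_mult v b' \<in> carrier hahn_ring"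
    using cring.cring_simprules(5)[OF hahn_ring_cring] uv(2) b' by simp
  ultimately show ?thesis by metis
qed

text \<open>If V has no maximum, an element of V is picked above each rational that V exceeds;
  density of the rationals makes these countably many choices cofinal.\<close>

lemma cofinal_sequence:
  fixes V :: "real set"
  assumes "V \<noteq> {}"
  obtains v :: "nat \<Rightarrow> real" where "\<And>k. v k \<in> V" "\<And>k. v k \<le> v (Suc k)" "\<And>x. x \<in> V \<Longrightarrow> \<exists>k. x \<le> v k"
proof (cases "\<exists>x\<in>V. \<forall>y\<in>V. y \<le> x")
  case True
  then obtain x where "x \<in> V" "\<forall>y\<in>V. y \<le> x" by blast
  then show thesis using that[of "\<lambda>_. x"] by auto
next
  case False
  obtain v0 where v0: "v0 \<in> V" using assms by blast
  define w where "w k = (if \<exists>x\<in>V. of_rat (nat_to_rat_surj k) < x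
    then SOME x. x \<in> V \<and> of_rat (nat_to_rat_surj k) < x else v0)" for k
  have w: "w k \<in> V" "(\<exists>x\<in>V. of_rat (nat_to_rat_surj k) < x) \<Longrightarrow> of_rat (nat_to_rat_surj k) < w k" for k
    using v0 someI_ex[of "\<lambda>x. x \<in> V \<and> of_rat (nat_to_rat_surj k) < x"] unfolding w_def by auto
  have cof: "\<exists>k. x \<le> w k" if x: "x \<in> V" for x
  proof -
    obtain y where y: "y \<in> V" "x < y" using False x by (meson not_le)
    obtain r where r: "x < of_rat r" "of_rat r < y" using of_rat_dense[OF y(2)] by blast
    obtain k where "r = nat_to_rat_surj k" using surj_nat_to_rat_surj by (metis surjD)
    then have "x \<le> w k" using w(2)[of k] r y by force
    then show ?thesis by blast
  qed
  \<comment> \<open>Running maxima make the sequence monotone without leaving V.\<close>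
  define v where "v k = Max (w ` {..k})" for k
  show thesis
  proof (rule that[of v])
    fix k
    have "v k \<in> w ` {..k}" unfolding v_def by (intro Max_in) auto
    then show "v k \<in> V" using w(1) by auto
    show "v k \<le> v (Suc k)" unfolding v_def by (intro Max_mono) auto
  next
    fix x assume "x \<in> V"
    then obtain k where "x \<le> w k" using cof by blast
    also have "w k \<le> v k" unfolding v_def by (intro Max_ge) auto
    finally show "\<exists>k. x \<le> v k" by blast
  qed
qed

lemma hahn_ring_least:
  assumes "a \<in> carrier hahn_ring" "a \<noteq> (\<lambda>_. 0)"
  obtains m where "a m = 1" "\<And>q. q < m \<Longrightarrow> a q = 0"
  by (rule hahn_series_least[of a]) (use assms that in \<open>auto simp: carrier_hahn_ring\<close>)

lemma hahn_ring_divides_total: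
  assumes a: "a \<in> carrier hahn_ring" and b: "b \<in> carrier hahn_ring"
  shows "(\<exists>c\<in>carrier hahn_ring. a = hahn_mult b c) \<or> (\<exists>c\<in>carrier hahn_ring. b = hahn_mult a c)"
proof -
  have zero: "(\<lambda>_. 0) \<in> carrier hahn_ring" by (simp add: carrier_hahn_ring hahn_zero_closed)
  show ?thesis
  proof (cases "a = (\<lambda>_. 0) \<or> b = (\<lambda>_. 0)")
    case True
    then show ?thesis using zero hahn_mult_zero_right by metis
  next
    case False
    obtain m where m: "a m = 1" "\<And>q. q < m \<Longrightarrow> a q = 0"
      by (rule hahn_ring_least[OF a]) (use False that in auto)
    obtain n where n: "b n = 1" "\<And>q. q < n \<Longrightarrow> b q = 0"
      by (rule hahn_ring_least[OF b]) (use False that in auto)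
    have ab: "a \<in> hahn_series" "b \<in> hahn_series" using a b by (auto simp: carrier_hahn_ring)
    show ?thesis
    proof (cases "m \<le> n")
      case True
      then show ?thesis using hahn_divides[OF ab(1) m ab(2)] n(2) by auto
    next
      case False
      then show ?thesis using hahn_divides[OF ab(2) n ab(1)] m(2) by auto
    qed
  qed
qed

lemma hahn_ring_val_ring: "val_ring hahn_ring"
proof (intro val_ring.intro val_ring_axioms.intro hahn_ring_cring)
  show "\<one>\<^bsub>hahn_ring\<^esub> \<oplus>\<^bsub>hahn_ring\<^esub> \<one>\<^bsub>hahn_ring\<^esub> = \<zero>\<^bsub>hahn_ring\<^esub>" by simp
  show "(\<exists>c\<in>carrier hahn_ring. a = b \<otimes>\<^bsub>hahn_ring\<^esub> c) \<or> (\<exists>c\<in>carrier hahn_ring. b = a \<otimes>\<^bsub>hahn_ring\<^esub> c)"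
    if "a \<in> carrier hahn_ring" "b \<in> carrier hahn_ring" for a b
    using hahn_ring_divides_total[OF that] by simp
next
  fix H assume H: "H \<subseteq> carrier hahn_ring" "H \<noteq> {}"
  show "\<exists>c::nat \<Rightarrow> hahn. (\<forall>k. c k \<in> H \<and> (\<exists>d\<in>carrier hahn_ring. c (Suc k) = c k \<otimes>\<^bsub>hahn_ring\<^esub> d)) \<and>
      (\<forall>h\<in>H. \<exists>k. \<exists>d\<in>carrier hahn_ring. c k = h \<otimes>\<^bsub>hahn_ring\<^esub> d)"
  \<comment> \<open>Zero is divisible by everything, so a constant sequence suffices if it is in H.
    Otherwise divisibility is the order of the leading exponents, and a cofinal sequence of these is
    lifted to H.\<close>
  proof (cases "(\<lambda>_. 0) \<in> H")
    case True
    have "(\<lambda>_. 0) \<in> carrier hahn_ring" by (simp add: carrier_hahn_ring hahn_zero_closed)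
    then show ?thesis
      using True by (intro exI[of _ "\<lambda>_ _. 0"]) (auto intro: bexI[of _ "\<lambda>_. 0"])
  next
    case False
    define V where "V = {m. \<exists>h\<in>H. h m = 1 \<and> (\<forall>q<m. h q = 0)}"
    have inV: "\<exists>m\<in>V. h m = 1 \<and> (\<forall>q<m. h q = 0)" if "h \<in> H" for h
    proof -
      have "h \<in> carrier hahn_ring" "h \<noteq> (\<lambda>_. 0)" using H False that by auto
      then obtain m where "h m = 1" "\<And>q. q < m \<Longrightarrow> h q = 0" by (rule hahn_ring_least) (rule that)
      then show ?thesis using \<open>h \<in> H\<close> by (auto simp: V_def)
    qed
    have "V \<noteq> {}" using H inV by blast
    then obtain v where v: "\<And>k. v k \<in> V" "\<And>k. v k \<le> v (Suc k)" "\<And>x. x \<in> V \<Longrightarrow> \<exists>k. x \<le> v k"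
      by (rule cofinal_sequence) (rule that)
    have "\<forall>k. \<exists>h\<in>H. h (v k) = 1 \<and> (\<forall>q<v k. h q = 0)" using v(1) by (auto simp: V_def)
    then obtain c where c: "\<And>k. c k \<in> H" "\<And>k. c k (v k) = 1" "\<And>k q. q < v k \<Longrightarrow> c k q = 0" by metis
    have ch: "c k \<in> hahn_series" for k using c(1) H by (auto simp: carrier_hahn_ring)
    have "\<exists>d\<in>carrier hahn_ring. c (Suc k) = hahn_mult (c k) d" for k
      using c v(2)[of k] ch by (intro hahn_divides[where m = "v k"]) auto
    moreover have "\<exists>k. \<exists>d\<in>carrier hahn_ring. c k = hahn_mult h d" if h: "h \<in> H" for h
    proof -
      obtain m where m: "m \<in> V" "h m = 1" "\<forall>q<m. h q = 0" using inV h by blast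
      obtain k where "m \<le> v k" using v(3) m(1) by blast
      then have "\<exists>d\<in>carrier hahn_ring. c k = hahn_mult h d"
        using m c ch h H by (intro hahn_divides[where m = m]) (auto simp: carrier_hahn_ring)
      then show ?thesis by blast
    qed
    ultimately show ?thesis using c(1) by (intro exI[of _ c]) auto
  qed
qed

section \<open>The injective cogenerator \<open>\<Theta>\<close>\<close>

lemma hahn_field_module_simps [simp]:
  "carrier hahn_field_module = hahn_series" "ring.zero hahn_field_module = (\<lambda>_. 0)"
  "ring.add hahn_field_module = (\<lambda>a b q. a q + b q)" "smult hahn_field_module = hahn_mult"
  by (simp_all add: hahn_field_module_def)

lemma hahn_ring_subset: "a \<in> carrier hahn_ring \<Longrightarrow> a \<in> hahn_series"
  by (simp add: carrier_hahn_ring)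

lemma hahn_ring_mult_closed:
  "\<lbrakk>a \<in> carrier hahn_ring; b \<in> carrier hahn_ring\<rbrakk> \<Longrightarrow> hahn_mult a b \<in> carrier hahn_ring"
  using cring.cring_simprules(5)[OF hahn_ring_cring] by simp

lemma hahn_field_module: "module hahn_ring hahn_field_module"
proof (rule moduleI[OF hahn_ring_cring])
  show "abelian_group hahn_field_module"
  proof (rule abelian_groupI)
    fix x assume "x \<in> carrier hahn_field_module"
    then show "\<exists>y\<in>carrier hahn_field_module. y \<oplus>\<^bsub>hahn_field_module\<^esub> x = \<zero>\<^bsub>hahn_field_module\<^esub>"
      by (intro bexI[of _ x]) auto
  qed (auto simp: hahn_add_closed hahn_zero_closed add_ac)
qed (auto simp: hahn_mult_closed hahn_mult_assoc hahn_mult_add_left hahn_mult_add_right hahn_ring_subset)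

interpretation K: val_module hahn_ring hahn_field_module
  by (intro val_module.intro hahn_ring_val_ring hahn_field_module)

text \<open>The coset of x modulo \<open>I_pos\<close>: two series differ by an element of positive
  valuation exactly if they agree at all exponents up to 0.\<close>

definition theta :: "hahn \<Rightarrow> hahn set" where
  "theta x = {y \<in> hahn_series. \<forall>q\<le>0. y q = x q}"

lemma theta_eq_iff:
  "x \<in> hahn_series \<Longrightarrow> theta x = theta y \<longleftrightarrow> (\<forall>q\<le>0. x q = y q)"
  by (auto simp: theta_def)

lemma theta_self: "x \<in> hahn_series \<Longrightarrow> x \<in> theta x"
  by (simp add: theta_def)

lemma coset_eq_theta:
  assumes "x \<in> hahn_series"
  shows "I_pos +>\<^bsub>hahn_field_module\<^esub> x = theta x"
proof -
  have "\<exists>h\<in>I_pos. y = (\<lambda>q. h q + x q)" if "y \<in> theta x" for y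
    using that assms
    by (intro bexI[of _ "\<lambda>q. y q + x q"]) (auto simp: theta_def I_pos_eq hahn_add_closed add.assoc)
  moreover have "(\<lambda>q. h q + x q) \<in> theta x" if "h \<in> I_pos" for h
    using that assms by (auto simp: theta_def I_pos_eq hahn_add_closed)
  ultimately show ?thesis by (auto simp: a_r_coset_def r_coset_def)
qed

lemma Theta_carrier: "carrier Theta = theta ` hahn_series"
proof -
  have "a_rcosets\<^bsub>hahn_field_module\<^esub> I_pos = (\<lambda>x. I_pos +>\<^bsub>hahn_field_module\<^esub> x) ` hahn_series"
    by (auto simp: A_RCOSETS_def')
  also have "\<dots> = theta ` hahn_series" by (rule image_cong) (simp_all add: coset_eq_theta)
  finally show ?thesis by (simp add: Theta_def quotient_module_def)
qed

lemma Theta_zero: "\<zero>\<^bsub>Theta\<^esub> = theta (\<lambda>_. 0)"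
  by (simp add: Theta_def quotient_module_def I_pos_eq theta_def)

lemma Theta_add:
  assumes "x \<in> hahn_series" "y \<in> hahn_series"
  shows "theta x \<oplus>\<^bsub>Theta\<^esub> theta y = theta (\<lambda>q. x q + y q)"
proof -
  have "theta x <+>\<^bsub>hahn_field_module\<^esub> theta y = theta (\<lambda>q. x q + y q)"
  proof
    show "theta x <+>\<^bsub>hahn_field_module\<^esub> theta y \<subseteq> theta (\<lambda>q. x q + y q)"
      by (auto simp: set_add_def set_mult_def theta_def hahn_add_closed)
    show "theta (\<lambda>q. x q + y q) \<subseteq> theta x <+>\<^bsub>hahn_field_module\<^esub> theta y"
    proof
      fix z assume z: "z \<in> theta (\<lambda>q. x q + y q)"
      then have "(\<lambda>q. x q + z q) \<in> theta y"
        using assms by (auto simp: theta_def hahn_add_closed)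
      moreover have "z = (\<lambda>q. x q + (x q + z q))" by simp
      ultimately show "z \<in> theta x <+>\<^bsub>hahn_field_module\<^esub> theta y"
        using theta_self[OF assms(1)] by (force simp: set_add_def set_mult_def)
    qed
  qed
  then show ?thesis by (simp add: Theta_def quotient_module_def)
qed

text \<open>Multiplication by an element of A cannot carry a positive exponent down to 0 or
  below.\<close>

lemma theta_smult_cong:
  assumes a: "a \<in> carrier hahn_ring" and x: "x \<in> hahn_series" "y \<in> hahn_series" "\<forall>q\<le>0. x q = y q"
  shows "theta (hahn_mult a x) = theta (hahn_mult a y)"
proof -
  have ah: "a \<in> hahn_series" "\<And>q. q < 0 \<Longrightarrow> a q = 0" using a by (auto simp: carrier_hahn_ring)
  have "hahn_mult a x q + hahn_mult a y q = 0" if "q \<le> 0" for q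
    using hahn_mult_vanish_le[of 0 a 0 "\<lambda>q. x q + y q" q] ah x that
    by (simp add: hahn_mult_add_right)
  then have "\<forall>q\<le>0. hahn_mult a x q = hahn_mult a y q" by (metis bit_add_add_self add.right_neutral)
  then show ?thesis using ah x by (simp add: theta_eq_iff hahn_mult_closed)
qed

lemma Theta_smult:
  assumes a: "a \<in> carrier hahn_ring" and x: "x \<in> hahn_series"
  shows "a \<odot>\<^bsub>Theta\<^esub> theta x = theta (hahn_mult a x)"
proof -
  have "I_pos +>\<^bsub>hahn_field_module\<^esub> hahn_mult a y = theta (hahn_mult a x)" if "y \<in> theta x" for y
    using that a x theta_smult_cong[OF a, of y x]
    by (subst coset_eq_theta) (auto simp: theta_def carrier_hahn_ring hahn_mult_closed)
  then have "(\<Union>y\<in>theta x. I_pos +>\<^bsub>hahn_field_module\<^esub> hahn_mult a y) = theta (hahn_mult a x)"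
    using theta_self[OF x] by auto
  then show ?thesis by (simp add: Theta_def quotient_module_def)
qed

lemma Theta_module: "module hahn_ring Theta"
proof (rule moduleI[OF hahn_ring_cring])
  show "abelian_group Theta"
  proof (rule abelian_groupI)
    fix x assume "x \<in> carrier Theta"
    then show "\<exists>y\<in>carrier Theta. y \<oplus>\<^bsub>Theta\<^esub> x = \<zero>\<^bsub>Theta\<^esub>"
      by (intro bexI[of _ x]) (auto simp: Theta_carrier Theta_add Theta_zero)
  qed (auto simp: Theta_carrier Theta_add Theta_zero hahn_add_closed hahn_zero_closed add_ac)
qed (auto simp: Theta_carrier Theta_add Theta_smult hahn_mult_closed hahn_add_closed hahn_ring_subset
    hahn_mult_assoc hahn_mult_add_left hahn_mult_add_right hahn_ring_mult_closed
    hahn_ring_cring[THEN cring.cring_simprules(1), simplified])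

interpretation Theta: val_module hahn_ring Theta
  by (intro val_module.intro hahn_ring_val_ring Theta_module)

lemma theta_in_Theta [intro]: "x \<in> hahn_series \<Longrightarrow> theta x \<in> carrier Theta"
  by (simp add: Theta_carrier)

text \<open>Every non-zero x in J is a unit of A times a monomial that also lies in J, so g is
  determined by its values at monomials. The value at t^(-d) prescribes the coefficients of y up to
  d, and spherical completeness assembles them.\<close>

lemma hom_to_Theta_is_multiplication:
  assumes J: "submodule J hahn_ring hahn_field_module"
    and g: "\<And>x. x \<in> J \<Longrightarrow> g x \<in> carrier Theta"
    and g_smult: "\<And>a x. \<lbrakk>a \<in> carrier hahn_ring; x \<in> J\<rbrakk> \<Longrightarrow> g (hahn_mult a x) = a \<odot>\<^bsub>Theta\<^esub> g x"
  shows "\<exists>y\<in>hahn_series. \<forall>x\<in>J. g x = theta (hahn_mult x y)"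
proof -
  have JK: "x \<in> hahn_series" if "x \<in> J" for x using J that by (auto simp: K.submodule_iff)
  have J0: "(\<lambda>_. 0) \<in> J" and Jsm: "\<And>a x. \<lbrakk>a \<in> carrier hahn_ring; x \<in> J\<rbrakk> \<Longrightarrow> hahn_mult a x \<in> J"
    using J by (auto simp: K.submodule_iff)
  define D where "D = {d. monomial (- d) \<in> J}"
  have down: "e \<in> D" if "d \<in> D" "e \<le> d" for d e
    using Jsm[of "monomial (d - e)" "monomial (- d)"] that
    by (simp add: D_def monomial_monomial monomial_in_hahn_ring)
  have "\<exists>w\<in>hahn_series. g (monomial (- d)) = theta w" if "d \<in> D" for d
    using g[of "monomial (- d)"] that by (auto simp: D_def Theta_carrier)
  then obtain w where w: "\<And>d. d \<in> D \<Longrightarrow> w d \<in> hahn_series" "\<And>d. d \<in> D \<Longrightarrow> g (monomial (- d)) = theta (w d)"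
    by metis
  \<comment> \<open>If g is multiplication by y, then \<open>w d\<close> agrees with t^(-d) y up to
    exponent 0; so its shift by d agrees with y up to exponent d.\<close>
  define z where "z d = hahn_mult (monomial d) (w d)" for d
  have z_eq: "z d = (\<lambda>q. w d (q - d))" for d by (simp add: z_def monomial_mult)
  obtain y where y: "y \<in> hahn_series" "\<And>d q. \<lbrakk>d \<in> D; q \<le> d\<rbrakk> \<Longrightarrow> y q = z d q"
  proof (rule glue_truncations[of D z])
    fix d e q assume de: "d \<in> D" "e \<in> D" "d \<le> e" "q \<le> d"
    have A: "monomial (e - d) \<in> carrier hahn_ring" using de by (simp add: monomial_in_hahn_ring)
    have "theta (w d) = g (hahn_mult (monomial (e - d)) (monomial (- e)))"
      using w(2)[OF de(1)] by (simp add: monomial_monomial)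
    also have "\<dots> = theta (hahn_mult (monomial (e - d)) (w e))"
      using g_smult[OF A, of "monomial (- e)"] w de A by (simp add: D_def Theta_smult)
    finally have "\<forall>q\<le>0. w d q = w e (q - (e - d))"
      using w(1)[OF de(1)] by (simp add: theta_eq_iff monomial_mult)
    then have "w d (q - d) = w e (q - d - (e - d))" using de(4) by (metis diff_le_0_iff_le)
    then show "z d q = z e q" by (simp add: z_eq)
  next
    show "z d \<in> hahn_series" if "d \<in> D" for d
      unfolding z_def using w(1)[OF that] by (intro hahn_mult_closed) simp_all
  qed (use down that in blast)+
  have "g x = theta (hahn_mult x y)" if x: "x \<in> J" for x
  proof (cases "x = (\<lambda>_. 0)")
    case True
    have "g (hahn_mult (\<lambda>_. 0) x) = (\<lambda>_. 0) \<odot>\<^bsub>Theta\<^esub> g x"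
      using g_smult[OF _ x, of "\<lambda>_. 0"] K.R.zero_closed by simp
    then show ?thesis using True Theta.smult_l_null[OF g[OF x]] by (simp add: Theta_zero)
  next
    case False
    obtain m u v where m: "x m = 1" "\<And>q. q < m \<Longrightarrow> x q = 0" and u: "u \<in> carrier hahn_ring" "v \<in> carrier hahn_ring"
      "hahn_mult u v = monomial 0" "x = hahn_mult (monomial m) u"
      by (rule hahn_factor[OF JK[OF x] False]) (rule that)
    have uv: "u \<in> hahn_series" "v \<in> hahn_series" using u hahn_ring_subset by auto
    have xu: "x = hahn_mult u (monomial m)" using u(4) uv hahn_mult_comm by simp
    have "hahn_mult v x = hahn_mult (hahn_mult u v) (monomial m)"
      using uv hahn_mult_comm[OF uv] by (simp add: xu hahn_mult_assoc)
    then have "hahn_mult v x = monomial m" using u(3) by simp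
    then have mJ: "monomial m \<in> J" using Jsm[OF u(2) x] by simp
    then have d: "- m \<in> D" by (simp add: D_def)
    have "g x = u \<odot>\<^bsub>Theta\<^esub> theta (w (- m))" using xu g_smult[OF u(1) mJ] w(2)[OF d] by simp
    also have "\<dots> = theta (hahn_mult u (w (- m)))" using Theta_smult[OF u(1) w(1)[OF d]] .
    also have "\<dots> = theta (hahn_mult u (hahn_mult (monomial m) y))"
    proof (rule theta_smult_cong[OF u(1) w(1)[OF d]])
      show "hahn_mult (monomial m) y \<in> hahn_series" using y(1) by (intro hahn_mult_closed) simp_all
      show "\<forall>q\<le>0. w (- m) q = hahn_mult (monomial m) y q"
        using y(2)[OF d] by (simp add: monomial_mult z_eq)
    qed
    also have "\<dots> = theta (hahn_mult x y)" using uv y(1) by (simp add: xu hahn_mult_assoc)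
    finally show ?thesis .
  qed
  then show ?thesis using y(1) by blast
qed

section \<open>Injectivity of \<Theta> and the cogenerator property\<close>

declare hahn_ring_simps [simp del]

text \<open>Partial homomorphisms into \<Theta> as graphs: extension becomes inclusion, and unions
  of chains are again graphs. The last clause gives single-valuedness, because two values at x have
  a difference attached to zero.\<close>

definition hom_graph :: "(hahn, 'm, 'x) module_scheme \<Rightarrow> ('m \<times> hahn set) set \<Rightarrow> bool" where
  "hom_graph M G \<longleftrightarrow> G \<subseteq> carrier M \<times> carrier Theta \<and> (\<zero>\<^bsub>M\<^esub>, \<zero>\<^bsub>Theta\<^esub>) \<in> G \<and>
     (\<forall>x s y t. (x, s) \<in> G \<longrightarrow> (y, t) \<in> G \<longrightarrow> (x \<oplus>\<^bsub>M\<^esub> y, s \<oplus>\<^bsub>Theta\<^esub> t) \<in> G) \<and>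
     (\<forall>a\<in>carrier hahn_ring. \<forall>x s. (x, s) \<in> G \<longrightarrow> (a \<odot>\<^bsub>M\<^esub> x, a \<odot>\<^bsub>Theta\<^esub> s) \<in> G) \<and>
     (\<forall>s. (\<zero>\<^bsub>M\<^esub>, s) \<in> G \<longrightarrow> s = \<zero>\<^bsub>Theta\<^esub>)"

locale hahn_module = val_module hahn_ring M for M :: "(hahn, 'm, 'x) module_scheme" (structure)
begin

lemma hom_graphD:
  assumes "hom_graph M G"
  shows "(x, s) \<in> G \<Longrightarrow> x \<in> carrier M" "(x, s) \<in> G \<Longrightarrow> s \<in> carrier Theta"
    "(\<zero>, \<zero>\<^bsub>Theta\<^esub>) \<in> G"
    "\<lbrakk>(x, s) \<in> G; (y, t) \<in> G\<rbrakk> \<Longrightarrow> (x \<oplus> y, s \<oplus>\<^bsub>Theta\<^esub> t) \<in> G"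
    "\<lbrakk>a \<in> carrier hahn_ring; (x, s) \<in> G\<rbrakk> \<Longrightarrow> (a \<odot> x, a \<odot>\<^bsub>Theta\<^esub> s) \<in> G"
    "(\<zero>, s) \<in> G \<Longrightarrow> s = \<zero>\<^bsub>Theta\<^esub>"
proof -
  have G: "G \<subseteq> carrier M \<times> carrier Theta" "(\<zero>, \<zero>\<^bsub>Theta\<^esub>) \<in> G"
    "\<forall>x s y t. (x, s) \<in> G \<longrightarrow> (y, t) \<in> G \<longrightarrow> (x \<oplus> y, s \<oplus>\<^bsub>Theta\<^esub> t) \<in> G"
    "\<forall>a\<in>carrier hahn_ring. \<forall>x s. (x, s) \<in> G \<longrightarrow> (a \<odot> x, a \<odot>\<^bsub>Theta\<^esub> s) \<in> G"
    "\<forall>s. (\<zero>, s) \<in> G \<longrightarrow> s = \<zero>\<^bsub>Theta\<^esub>"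
    using assms by (simp_all add: hom_graph_def)
  show "(x, s) \<in> G \<Longrightarrow> x \<in> carrier M" "(x, s) \<in> G \<Longrightarrow> s \<in> carrier Theta" using G(1) by auto
  show "(\<zero>, \<zero>\<^bsub>Theta\<^esub>) \<in> G" by (rule G(2))
  show "\<lbrakk>(x, s) \<in> G; (y, t) \<in> G\<rbrakk> \<Longrightarrow> (x \<oplus> y, s \<oplus>\<^bsub>Theta\<^esub> t) \<in> G" using G(3) by simp
  show "\<lbrakk>a \<in> carrier hahn_ring; (x, s) \<in> G\<rbrakk> \<Longrightarrow> (a \<odot> x, a \<odot>\<^bsub>Theta\<^esub> s) \<in> G" using G(4) by simp
  show "(\<zero>, s) \<in> G \<Longrightarrow> s = \<zero>\<^bsub>Theta\<^esub>" using G(5) by simp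
qed

lemma hom_graph_unique:
  assumes G: "hom_graph M G" and "(x, s) \<in> G" "(x, t) \<in> G"
  shows "s = t"
proof -
  note D = hom_graphD[OF G]
  have "(x \<oplus> x, s \<oplus>\<^bsub>Theta\<^esub> t) \<in> G" by (rule D(4)[OF assms(2,3)])
  then have "s \<oplus>\<^bsub>Theta\<^esub> t = \<zero>\<^bsub>Theta\<^esub>" using D(1)[OF assms(2)] D(6) by simp
  then show ?thesis using Theta.add_eq_zero_iff[OF D(2)[OF assms(2)] D(2)[OF assms(3)]] by simp
qed

text \<open>As in Baer's criterion: the scalars a with a x in the domain form an ideal J of A,
  viewed inside K, and the values at a x are given by multiplication with some y. The value
  \<open>theta y\<close> at x is then consistent with G.\<close>

lemma hom_graph_extend:
  assumes G: "hom_graph M G" and x: "x \<in> carrier M"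
  shows "\<exists>G' s. hom_graph M G' \<and> G \<subseteq> G' \<and> (x, s) \<in> G'"
proof -
  note D = hom_graphD[OF G]
  define J where "J = {a \<in> carrier hahn_ring. \<exists>s. (a \<odot> x, s) \<in> G}"
  define g where "g a = (THE s. (a \<odot> x, s) \<in> G)" for a
  have g_eq: "g a = s" if s: "(a \<odot> x, s) \<in> G" for a s
    unfolding g_def
  proof (rule the_equality)
    show "(a \<odot> x, s) \<in> G" by (rule s)
    show "t = s" if "(a \<odot> x, t) \<in> G" for t by (rule hom_graph_unique[OF G that s])
  qed
  have g: "(a \<odot> x, g a) \<in> G" if "a \<in> J" for a
    using that g_eq by (auto simp: J_def)
  have J: "submodule J hahn_ring hahn_field_module"
    unfolding K.submodule_iff
  proof (intro conjI ballI)
    show "J \<subseteq> carrier hahn_field_module" using hahn_ring_subset by (auto simp: J_def)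
    have "(\<zero>\<^bsub>hahn_ring\<^esub> \<odot> x, \<zero>\<^bsub>Theta\<^esub>) \<in> G" using D(3) x by simp
    then have "\<zero>\<^bsub>hahn_ring\<^esub> \<in> J" unfolding J_def using R.zero_closed by blast
    then show "\<zero>\<^bsub>hahn_field_module\<^esub> \<in> J" by (simp add: hahn_ring_simps)
    fix a assume a: "a \<in> J"
    then have aA: "a \<in> carrier hahn_ring" by (simp add: J_def)
    { fix b assume b: "b \<in> J"
      then have bA: "b \<in> carrier hahn_ring" by (simp add: J_def)
      have "((a \<oplus>\<^bsub>hahn_ring\<^esub> b) \<odot> x, g a \<oplus>\<^bsub>Theta\<^esub> g b) \<in> G"
        using D(4)[OF g[OF a] g[OF b]] aA bA x by (simp add: smult_l_distr)
      then have "a \<oplus>\<^bsub>hahn_ring\<^esub> b \<in> J" unfolding J_def using aA bA R.a_closed by blast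
      then show "a \<oplus>\<^bsub>hahn_field_module\<^esub> b \<in> J" by (simp add: hahn_ring_simps) }
    fix c assume c: "c \<in> carrier hahn_ring"
    have "((c \<otimes>\<^bsub>hahn_ring\<^esub> a) \<odot> x, c \<odot>\<^bsub>Theta\<^esub> g a) \<in> G"
      using D(5)[OF c g[OF a]] aA c x by (simp add: smult_assoc1)
    then have "c \<otimes>\<^bsub>hahn_ring\<^esub> a \<in> J" unfolding J_def using aA c R.m_closed by blast
    then show "c \<odot>\<^bsub>hahn_field_module\<^esub> a \<in> J" by (simp add: hahn_ring_simps)
  qed
  have "\<exists>y\<in>hahn_series. \<forall>a\<in>J. g a = theta (hahn_mult a y)"
  proof (rule hom_to_Theta_is_multiplication[OF J])
    show "g a \<in> carrier Theta" if "a \<in> J" for a using D(2)[OF g[OF that]] .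
    fix c a assume c: "c \<in> carrier hahn_ring" and a: "a \<in> J"
    then have "((c \<otimes>\<^bsub>hahn_ring\<^esub> a) \<odot> x, c \<odot>\<^bsub>Theta\<^esub> g a) \<in> G"
      using D(5)[OF c g[OF a]] x by (simp add: smult_assoc1 J_def)
    then show "g (hahn_mult c a) = c \<odot>\<^bsub>Theta\<^esub> g a" using g_eq by (simp add: hahn_ring_simps)
  qed
  then obtain y where y: "y \<in> hahn_series" "\<And>a. a \<in> J \<Longrightarrow> g a = theta (hahn_mult a y)" by blast
  define s0 where "s0 = theta y"
  have s0: "s0 \<in> carrier Theta" using y by (simp add: s0_def theta_in_Theta)
  have Js0: "(a \<odot> x, a \<odot>\<^bsub>Theta\<^esub> s0) \<in> G" if "a \<in> J" for a
    using g[OF that] y that by (simp add: s0_def Theta_smult J_def)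
  define G' where "G' = {(n \<oplus> a \<odot> x, s \<oplus>\<^bsub>Theta\<^esub> a \<odot>\<^bsub>Theta\<^esub> s0) | n s a. (n, s) \<in> G \<and> a \<in> carrier hahn_ring}"
  have "hom_graph M G'"
    unfolding hom_graph_def
  proof (intro conjI allI impI ballI)
    show "G' \<subseteq> carrier M \<times> carrier Theta" using D(1,2) x s0 by (auto simp: G'_def)
    show "(\<zero>, \<zero>\<^bsub>Theta\<^esub>) \<in> G'"
      unfolding G'_def using D(3) x s0 by (auto intro!: exI[of _ "\<zero>"] exI[of _ "\<zero>\<^bsub>Theta\<^esub>"] exI[of _ "\<zero>\<^bsub>hahn_ring\<^esub>"])
    { fix p u q v assume "(p, u) \<in> G'" "(q, v) \<in> G'"
      then obtain n s a n' s' a' where 1: "(n, s) \<in> G" "a \<in> carrier hahn_ring" "p = n \<oplus> a \<odot> x"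
          "u = s \<oplus>\<^bsub>Theta\<^esub> a \<odot>\<^bsub>Theta\<^esub> s0"
        and 2: "(n', s') \<in> G" "a' \<in> carrier hahn_ring" "q = n' \<oplus> a' \<odot> x" "v = s' \<oplus>\<^bsub>Theta\<^esub> a' \<odot>\<^bsub>Theta\<^esub> s0"
        unfolding G'_def by blast
      have "p \<oplus> q = (n \<oplus> n') \<oplus> (a \<oplus>\<^bsub>hahn_ring\<^esub> a') \<odot> x"
        using 1 2 D(1) x by (simp add: smult_l_distr M.a_ac)
      moreover have "u \<oplus>\<^bsub>Theta\<^esub> v = (s \<oplus>\<^bsub>Theta\<^esub> s') \<oplus>\<^bsub>Theta\<^esub> (a \<oplus>\<^bsub>hahn_ring\<^esub> a') \<odot>\<^bsub>Theta\<^esub> s0"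
        using 1 2 D(2) s0 by (simp add: Theta.smult_l_distr Theta.M.a_ac)
      ultimately show "(p \<oplus> q, u \<oplus>\<^bsub>Theta\<^esub> v) \<in> G'"
        unfolding G'_def using D(4)[OF 1(1) 2(1)] R.a_closed[OF 1(2) 2(2)] by blast }
    { fix c p u assume c: "c \<in> carrier hahn_ring" and "(p, u) \<in> G'"
      then obtain n s a where 1: "(n, s) \<in> G" "a \<in> carrier hahn_ring" "p = n \<oplus> a \<odot> x"
          "u = s \<oplus>\<^bsub>Theta\<^esub> a \<odot>\<^bsub>Theta\<^esub> s0"
        unfolding G'_def by blast
      have "c \<odot> p = c \<odot> n \<oplus> (c \<otimes>\<^bsub>hahn_ring\<^esub> a) \<odot> x"
        using 1 c D(1) x by (simp add: smult_r_distr smult_assoc1)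
      moreover have "c \<odot>\<^bsub>Theta\<^esub> u = c \<odot>\<^bsub>Theta\<^esub> s \<oplus>\<^bsub>Theta\<^esub> (c \<otimes>\<^bsub>hahn_ring\<^esub> a) \<odot>\<^bsub>Theta\<^esub> s0"
        using 1 c D(2) s0 by (simp add: Theta.smult_r_distr Theta.smult_assoc1)
      ultimately show "(c \<odot> p, c \<odot>\<^bsub>Theta\<^esub> u) \<in> G'"
        unfolding G'_def using D(5)[OF c 1(1)] R.m_closed[OF c 1(2)] by blast }
    { fix u assume "(\<zero>, u) \<in> G'"
      then obtain n s a where 1: "(n, s) \<in> G" "a \<in> carrier hahn_ring" "n \<oplus> a \<odot> x = \<zero>"
          "u = s \<oplus>\<^bsub>Theta\<^esub> a \<odot>\<^bsub>Theta\<^esub> s0"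
        unfolding G'_def by (auto dest: sym)
      have "n = a \<odot> x" using 1 D(1) x by (simp add: add_eq_zero_iff)
      then have "a \<in> J" using 1 by (auto simp: J_def)
      then have "s = a \<odot>\<^bsub>Theta\<^esub> s0" using hom_graph_unique[OF G 1(1)] Js0 \<open>n = _\<close> by simp
      then show "u = \<zero>\<^bsub>Theta\<^esub>" using 1 D(2) by simp }
  qed
  moreover have "G \<subseteq> G'"
  proof clarify
    fix n s assume ns: "(n, s) \<in> G"
    then have "(n, s) = (n \<oplus> \<zero>\<^bsub>hahn_ring\<^esub> \<odot> x, s \<oplus>\<^bsub>Theta\<^esub> \<zero>\<^bsub>hahn_ring\<^esub> \<odot>\<^bsub>Theta\<^esub> s0)"
      using D(1)[OF ns] D(2)[OF ns] x s0 by simp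
    then show "(n, s) \<in> G'" unfolding G'_def using ns R.zero_closed by blast
  qed
  moreover have "(x, s0) \<in> G'"
  proof -
    have "(x, s0) = (\<zero> \<oplus> \<one>\<^bsub>hahn_ring\<^esub> \<odot> x, \<zero>\<^bsub>Theta\<^esub> \<oplus>\<^bsub>Theta\<^esub> \<one>\<^bsub>hahn_ring\<^esub> \<odot>\<^bsub>Theta\<^esub> s0)"
      using x s0 by simp
    then show ?thesis unfolding G'_def using D(3) R.one_closed by blast
  qed
  ultimately show ?thesis by blast
qed

text \<open>Zorn's lemma on the graphs containing G; by one-element extension a maximal graph is
  defined everywhere.\<close>

theorem Theta_injective:
  assumes G: "hom_graph M G"
  shows "\<exists>f\<in>mod_hom hahn_ring M Theta. \<forall>(x, s)\<in>G. f x = s"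
proof -
  define A where "A = {H. hom_graph M H \<and> G \<subseteq> H}"
  have "\<exists>H\<in>A. \<forall>H'\<in>A. H \<subseteq> H' \<longrightarrow> H' = H"
  proof (rule subset_Zorn_nonempty)
    show "A \<noteq> {}" using G by (auto simp: A_def)
    fix C assume ne: "C \<noteq> {}" and ch: "subset.chain A C"
    have C: "hom_graph M H" "G \<subseteq> H" if "H \<in> C" for H using ch that by (auto simp: subset.chain_def A_def)
    have two: "\<exists>H\<in>C. p \<in> H \<and> q \<in> H" if pq: "p \<in> \<Union>C" "q \<in> \<Union>C" for p q
    proof -
      obtain H H' where H: "H \<in> C" "H' \<in> C" "p \<in> H" "q \<in> H'" using pq by blast
      then have "H \<subseteq> H' \<or> H' \<subseteq> H" using ch by (auto simp: subset.chain_def)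
      then show ?thesis using H by blast
    qed
    have "hom_graph M (\<Union>C)"
      unfolding hom_graph_def
    proof (intro conjI allI impI ballI)
      show "\<Union>C \<subseteq> carrier M \<times> carrier Theta" using hom_graphD(1,2)[OF C(1)] by auto
      obtain H where "H \<in> C" using ne by blast
      then show "(\<zero>, \<zero>\<^bsub>Theta\<^esub>) \<in> \<Union>C" using hom_graphD(3)[OF C(1)] by blast
      fix x s y t assume xs: "(x, s) \<in> \<Union>C" "(y, t) \<in> \<Union>C"
      then obtain H where H: "H \<in> C" "(x, s) \<in> H" "(y, t) \<in> H" using two by blast
      then show "(x \<oplus> y, s \<oplus>\<^bsub>Theta\<^esub> t) \<in> \<Union>C" using hom_graphD(4)[OF C(1)[OF H(1)] H(2,3)] by blast
    next
      fix a x s assume a: "a \<in> carrier hahn_ring" and "(x, s) \<in> \<Union>C"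
      then obtain H where H: "H \<in> C" "(x, s) \<in> H" by blast
      then show "(a \<odot> x, a \<odot>\<^bsub>Theta\<^esub> s) \<in> \<Union>C" using hom_graphD(5)[OF C(1)[OF H(1)] a H(2)] by blast
    next
      fix s assume "(\<zero>, s) \<in> \<Union>C"
      then obtain H where H: "H \<in> C" "(\<zero>, s) \<in> H" by blast
      then show "s = \<zero>\<^bsub>Theta\<^esub>" using hom_graphD(6)[OF C(1)[OF H(1)] H(2)] by simp
    qed
    then show "\<Union>C \<in> A" using C(2) ne by (auto simp: A_def)
  qed
  then obtain H where H: "hom_graph M H" "G \<subseteq> H" and max: "\<And>H'. \<lbrakk>hom_graph M H'; H \<subseteq> H'\<rbrakk> \<Longrightarrow> H' = H"
    unfolding A_def by (auto dest: subset_trans)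
  have "\<exists>s. (x, s) \<in> H" if x: "x \<in> carrier M" for x
  proof -
    obtain H' s where H': "hom_graph M H'" "H \<subseteq> H'" "(x, s) \<in> H'" using hom_graph_extend[OF H(1) x] by (elim exE conjE)
    then show ?thesis using max[OF H'(1,2)] by blast
  qed
  then obtain f where f: "\<And>x. x \<in> carrier M \<Longrightarrow> (x, f x) \<in> H" by metis
  note D = hom_graphD[OF H(1)]
  have f_eq: "f x = s" if xs: "(x, s) \<in> H" for x s
    by (rule hom_graph_unique[OF H(1) f[OF D(1)[OF xs]] xs])
  have "f \<in> mod_hom hahn_ring M Theta"
    unfolding mod_hom_def
  proof (intro CollectI conjI ballI funcsetI)
    show "f x \<in> carrier Theta" if "x \<in> carrier M" for x using D(2)[OF f[OF that]] .
    show "f (x \<oplus> y) = f x \<oplus>\<^bsub>Theta\<^esub> f y" if "x \<in> carrier M" "y \<in> carrier M" for x y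
      by (rule f_eq[OF D(4)[OF f[OF that(1)] f[OF that(2)]]])
    show "f (a \<odot> x) = a \<odot>\<^bsub>Theta\<^esub> f x" if "a \<in> carrier hahn_ring" "x \<in> carrier M" for a x
      by (rule f_eq[OF D(5)[OF that(1) f[OF that(2)]]])
  qed
  moreover have "\<forall>(x, s)\<in>G. f x = s" using f_eq H(2) by auto
  ultimately show ?thesis by blast
qed

text \<open>Every non-unit of A kills the non-zero class e of 1. If x is not in N, then a x in N
  forces a to be a non-unit, so sending n + a x to a e is well defined; injectivity extends this map
  to M.\<close>

theorem Theta_cogenerator:
  assumes N: "submodule N hahn_ring M" and x: "x \<in> carrier M" "x \<notin> N"
  shows "\<exists>f\<in>mod_hom hahn_ring M Theta. (\<forall>n\<in>N. f n = \<zero>\<^bsub>Theta\<^esub>) \<and> f x \<noteq> \<zero>\<^bsub>Theta\<^esub>"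
proof -
  define e where "e = theta (monomial 0)"
  have e: "e \<in> carrier Theta" by (simp add: e_def theta_in_Theta)
  have NM: "n \<in> carrier M" if "n \<in> N" for n using N that by (auto simp: submodule_iff)
  have N0: "\<zero> \<in> N" and Nadd: "\<And>m n. m \<in> N \<Longrightarrow> n \<in> N \<Longrightarrow> m \<oplus> n \<in> N"
    and Nsm: "\<And>a n. a \<in> carrier hahn_ring \<Longrightarrow> n \<in> N \<Longrightarrow> a \<odot> n \<in> N"
    using N by (auto simp: submodule_iff)
  define G where "G = {(n \<oplus> a \<odot> x, a \<odot>\<^bsub>Theta\<^esub> e) | n a. n \<in> N \<and> a \<in> carrier hahn_ring}"
  have "hom_graph M G"
    unfolding hom_graph_def
  proof (intro conjI allI impI ballI)
    show "G \<subseteq> carrier M \<times> carrier Theta" using NM x e by (auto simp: G_def)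
    show "(\<zero>, \<zero>\<^bsub>Theta\<^esub>) \<in> G"
      unfolding G_def using N0 x e by (auto intro!: exI[of _ "\<zero>"] exI[of _ "\<zero>\<^bsub>hahn_ring\<^esub>"])
    { fix p u q v assume "(p, u) \<in> G" "(q, v) \<in> G"
      then obtain n a n' a' where 1: "n \<in> N" "a \<in> carrier hahn_ring" "p = n \<oplus> a \<odot> x" "u = a \<odot>\<^bsub>Theta\<^esub> e"
        and 2: "n' \<in> N" "a' \<in> carrier hahn_ring" "q = n' \<oplus> a' \<odot> x" "v = a' \<odot>\<^bsub>Theta\<^esub> e"
        unfolding G_def by blast
      have "p \<oplus> q = (n \<oplus> n') \<oplus> (a \<oplus>\<^bsub>hahn_ring\<^esub> a') \<odot> x"
        using 1 2 NM x by (simp add: smult_l_distr M.a_ac)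
      moreover have "u \<oplus>\<^bsub>Theta\<^esub> v = (a \<oplus>\<^bsub>hahn_ring\<^esub> a') \<odot>\<^bsub>Theta\<^esub> e"
        using 1 2 e by (simp add: Theta.smult_l_distr)
      ultimately show "(p \<oplus> q, u \<oplus>\<^bsub>Theta\<^esub> v) \<in> G"
        unfolding G_def using Nadd[OF 1(1) 2(1)] R.a_closed[OF 1(2) 2(2)] by blast }
    { fix c p u assume c: "c \<in> carrier hahn_ring" and "(p, u) \<in> G"
      then obtain n a where 1: "n \<in> N" "a \<in> carrier hahn_ring" "p = n \<oplus> a \<odot> x" "u = a \<odot>\<^bsub>Theta\<^esub> e"
        unfolding G_def by blast
      have "c \<odot> p = c \<odot> n \<oplus> (c \<otimes>\<^bsub>hahn_ring\<^esub> a) \<odot> x"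
        using 1 c NM x by (simp add: smult_r_distr smult_assoc1)
      moreover have "c \<odot>\<^bsub>Theta\<^esub> u = (c \<otimes>\<^bsub>hahn_ring\<^esub> a) \<odot>\<^bsub>Theta\<^esub> e"
        using 1 c e by (simp add: Theta.smult_assoc1)
      ultimately show "(c \<odot> p, c \<odot>\<^bsub>Theta\<^esub> u) \<in> G"
        unfolding G_def using Nsm[OF c 1(1)] R.m_closed[OF c 1(2)] by blast }
    { fix u assume "(\<zero>, u) \<in> G"
      then obtain n a where 1: "n \<in> N" "a \<in> carrier hahn_ring" "n \<oplus> a \<odot> x = \<zero>" "u = a \<odot>\<^bsub>Theta\<^esub> e"
        unfolding G_def by (auto dest: sym)
      have ax: "a \<odot> x \<in> N" using 1 NM x by (simp add: add_eq_zero_iff)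
      have "a 0 \<noteq> 1"
      proof
        assume "a 0 = 1"
        then obtain b where b: "b \<in> carrier hahn_ring" "hahn_mult a b = monomial 0"
          using hahn_ring_unit[OF 1(2)] by blast
        have "b \<otimes>\<^bsub>hahn_ring\<^esub> a = \<one>\<^bsub>hahn_ring\<^esub>"
          using b R.m_comm[OF b(1) 1(2)] by (simp add: hahn_ring_simps)
        then have "b \<odot> (a \<odot> x) = x" using b(1) 1(2) x(1) by (simp flip: smult_assoc1)
        then show False using Nsm[OF b(1) ax] x(2) by simp
      qed
      then have "\<forall>q\<le>0. a q = 0" using 1(2) by (auto simp: carrier_hahn_ring order_le_less bit_not_one_iff)
      then have "theta a = theta (\<lambda>_. 0)" using 1(2) hahn_ring_subset by (simp add: theta_eq_iff)
      moreover have "hahn_mult a (monomial 0) = a"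
        using hahn_mult_comm[of a "monomial 0"] hahn_ring_subset[OF 1(2)] by simp
      ultimately show "u = \<zero>\<^bsub>Theta\<^esub>" using 1 by (simp add: e_def Theta_smult Theta_zero) }
  qed
  from Theta_injective[OF this] obtain f where f: "f \<in> mod_hom hahn_ring M Theta"
    and "\<forall>(p, s)\<in>G. f p = s" by (elim bexE)
  then have f_eq: "f p = s" if "(p, s) \<in> G" for p s using that by auto
  have "f n = \<zero>\<^bsub>Theta\<^esub>" if "n \<in> N" for n
  proof (rule f_eq)
    have "(n, \<zero>\<^bsub>Theta\<^esub>) = (n \<oplus> \<zero>\<^bsub>hahn_ring\<^esub> \<odot> x, \<zero>\<^bsub>hahn_ring\<^esub> \<odot>\<^bsub>Theta\<^esub> e)"
      using NM[OF that] x e by simp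
    then show "(n, \<zero>\<^bsub>Theta\<^esub>) \<in> G" unfolding G_def using that R.zero_closed by blast
  qed
  moreover have "f x = e"
  proof (rule f_eq)
    have "(x, e) = (\<zero> \<oplus> \<one>\<^bsub>hahn_ring\<^esub> \<odot> x, \<one>\<^bsub>hahn_ring\<^esub> \<odot>\<^bsub>Theta\<^esub> e)" using x e by simp
    then show "(x, e) \<in> G" unfolding G_def using N0 R.one_closed by blast
  qed
  moreover have "e \<noteq> \<zero>\<^bsub>Theta\<^esub>"
  proof -
    have "monomial 0 0 \<noteq> 0" by (simp add: monomial_def)
    then show ?thesis unfolding e_def Theta_zero using theta_eq_iff[of "monomial 0" "\<lambda>_. 0"] by fastforce
  qed
  ultimately show ?thesis using f by (intro bexI[of _ f]) auto
qed

end

section \<open>Duality\<close>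

lemma dual_simps [simp]:
  "carrier (dual M) = mod_hom hahn_ring M Theta \<inter> extensional (carrier M)"
  "\<zero>\<^bsub>dual M\<^esub> = (\<lambda>x\<in>carrier M. \<zero>\<^bsub>Theta\<^esub>)"
  "f \<oplus>\<^bsub>dual M\<^esub> g = (\<lambda>x\<in>carrier M. f x \<oplus>\<^bsub>Theta\<^esub> g x)"
  "a \<odot>\<^bsub>dual M\<^esub> f = (\<lambda>x\<in>carrier M. a \<odot>\<^bsub>Theta\<^esub> f x)"
  by (simp_all add: dual_def Hom_module_def)

section \<open>The dual module and the evaluation map\<close>

context hahn_module
begin

lemma mod_hom_restrict:
  assumes f: "f \<in> mod_hom hahn_ring M N"
  shows "restrict f (carrier M) \<in> mod_hom hahn_ring M N"
  using f unfolding mod_hom_def by (auto simp: Pi_def)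

lemma dual_closed:
  "f \<in> mod_hom hahn_ring M Theta \<Longrightarrow> restrict f (carrier M) \<in> carrier (dual M)"
  by (simp add: mod_hom_restrict)

lemma dual_ext:
  assumes "f \<in> carrier (dual M)" "g \<in> carrier (dual M)" "\<And>x. x \<in> carrier M \<Longrightarrow> f x = g x"
  shows "f = g"
  by (rule extensionalityI[of _ "carrier M"]) (use assms in auto)

lemma hom_add_hom:
  assumes f: "f \<in> mod_hom hahn_ring M Theta" and g: "g \<in> mod_hom hahn_ring M Theta"
  shows "(\<lambda>x. f x \<oplus>\<^bsub>Theta\<^esub> g x) \<in> mod_hom hahn_ring M Theta"
  by (rule mod_hom_add[OF Theta.module_axioms f g])

lemma hom_smult_hom:
  assumes a: "a \<in> carrier hahn_ring" and f: "f \<in> mod_hom hahn_ring M Theta"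
  shows "(\<lambda>x. a \<odot>\<^bsub>Theta\<^esub> f x) \<in> mod_hom hahn_ring M Theta"
  using a mod_homD[OF f] unfolding mod_hom_def
  by (auto simp: Theta.smult_r_distr Theta.smult_commute)

lemma zero_hom: "(\<lambda>x. \<zero>\<^bsub>Theta\<^esub>) \<in> mod_hom hahn_ring M Theta"
  by (auto simp: mod_hom_def)

lemma dual_module: "module hahn_ring (dual M)"
proof (rule moduleI[OF hahn_ring_cring])
  have add: "f \<oplus>\<^bsub>dual M\<^esub> g \<in> carrier (dual M)" if "f \<in> carrier (dual M)" "g \<in> carrier (dual M)" for f g
    using that hom_add_hom[of f g] mod_hom_restrict[of "\<lambda>x. f x \<oplus>\<^bsub>Theta\<^esub> g x" Theta] by simp
  have smult: "a \<odot>\<^bsub>dual M\<^esub> f \<in> carrier (dual M)" if "a \<in> carrier hahn_ring" "f \<in> carrier (dual M)" for a f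
    using that hom_smult_hom[of a f] mod_hom_restrict[of "\<lambda>x. a \<odot>\<^bsub>Theta\<^esub> f x" Theta] by simp
  have zero: "\<zero>\<^bsub>dual M\<^esub> \<in> carrier (dual M)" using mod_hom_restrict[OF zero_hom] by simp
  have val: "f x \<in> carrier Theta" if "f \<in> carrier (dual M)" "x \<in> carrier M" for f x
    using that mod_homD(1)[of f] by auto
  show "abelian_group (dual M)"
  proof (rule abelian_groupI)
    fix f assume f: "f \<in> carrier (dual M)"
    show "\<exists>g\<in>carrier (dual M). g \<oplus>\<^bsub>dual M\<^esub> f = \<zero>\<^bsub>dual M\<^esub>"
      using f val[OF f] by (intro bexI[of _ f]) (auto intro!: restrict_ext)
    show "\<zero>\<^bsub>dual M\<^esub> \<oplus>\<^bsub>dual M\<^esub> f = f"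
      by (rule dual_ext[OF add[OF zero f] f]) (use val[OF f] in simp)
    fix g assume g: "g \<in> carrier (dual M)"
    show "f \<oplus>\<^bsub>dual M\<^esub> g = g \<oplus>\<^bsub>dual M\<^esub> f"
      by (rule dual_ext[OF add[OF f g] add[OF g f]]) (use val[OF f] val[OF g] in \<open>simp add: Theta.M.a_comm\<close>)
    fix h assume h: "h \<in> carrier (dual M)"
    show "(f \<oplus>\<^bsub>dual M\<^esub> g) \<oplus>\<^bsub>dual M\<^esub> h = f \<oplus>\<^bsub>dual M\<^esub> (g \<oplus>\<^bsub>dual M\<^esub> h)"
      by (rule dual_ext[OF add[OF add[OF f g] h] add[OF f add[OF g h]]])
        (use val[OF f] val[OF g] val[OF h] in \<open>simp add: Theta.M.a_assoc\<close>)
  qed (use add zero in blast)+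
  show "\<one>\<^bsub>hahn_ring\<^esub> \<odot>\<^bsub>dual M\<^esub> f = f" if f: "f \<in> carrier (dual M)" for f
    by (rule dual_ext[OF smult[OF R.one_closed f] f]) (use val[OF f] in simp)
  fix a f assume a: "a \<in> carrier hahn_ring" and f: "f \<in> carrier (dual M)"
  show "a \<odot>\<^bsub>dual M\<^esub> f \<in> carrier (dual M)" by (rule smult[OF a f])
  { fix g assume g: "g \<in> carrier (dual M)"
    show "a \<odot>\<^bsub>dual M\<^esub> (f \<oplus>\<^bsub>dual M\<^esub> g) = a \<odot>\<^bsub>dual M\<^esub> f \<oplus>\<^bsub>dual M\<^esub> a \<odot>\<^bsub>dual M\<^esub> g"
    by (rule dual_ext[OF smult[OF a add[OF f g]] add[OF smult[OF a f] smult[OF a g]]])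
      (use val[OF f] val[OF g] a in \<open>simp add: Theta.smult_r_distr\<close>) }
  fix b assume b: "b \<in> carrier hahn_ring"
  show "(a \<oplus>\<^bsub>hahn_ring\<^esub> b) \<odot>\<^bsub>dual M\<^esub> f = a \<odot>\<^bsub>dual M\<^esub> f \<oplus>\<^bsub>dual M\<^esub> b \<odot>\<^bsub>dual M\<^esub> f"
    by (rule dual_ext[OF smult[OF R.a_closed[OF a b] f] add[OF smult[OF a f] smult[OF b f]]])
      (use val[OF f] a b in \<open>simp add: Theta.smult_l_distr\<close>)
  show "(a \<otimes>\<^bsub>hahn_ring\<^esub> b) \<odot>\<^bsub>dual M\<^esub> f = a \<odot>\<^bsub>dual M\<^esub> (b \<odot>\<^bsub>dual M\<^esub> f)"
    by (rule dual_ext[OF smult[OF R.m_closed[OF a b] f] smult[OF a smult[OF b f]]])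
      (use val[OF f] a b in \<open>simp add: Theta.smult_assoc1\<close>)
qed

lemma dual_hahn_module: "hahn_module (dual M)"
  by (intro hahn_module.intro val_module.intro val_ring_axioms dual_module)

lemma dual_apply_closed: "\<lbrakk>\<alpha> \<in> carrier (dual M); x \<in> carrier M\<rbrakk> \<Longrightarrow> \<alpha> x \<in> carrier Theta"
  using mod_homD(1)[of \<alpha> hahn_ring M Theta] by simp

lemma eval_hom: "m \<in> carrier M \<Longrightarrow> (\<lambda>\<alpha>. \<alpha> m) \<in> mod_hom hahn_ring (dual M) Theta"
  using dual_apply_closed unfolding mod_hom_def[of _ "dual M"] by auto

lemma chi_closed: "m \<in> carrier M \<Longrightarrow> chi M m \<in> carrier (dual (dual M))"
  using hahn_module.dual_closed[OF dual_hahn_module eval_hom] by (simp add: chi_def)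

lemma chi_hom: "chi M \<in> mod_hom hahn_ring M (dual (dual M))"
proof -
  have D: "\<alpha> (x \<oplus> y) = \<alpha> x \<oplus>\<^bsub>Theta\<^esub> \<alpha> y" "\<alpha> (a \<odot> x) = a \<odot>\<^bsub>Theta\<^esub> \<alpha> x"
    if "\<alpha> \<in> carrier (dual M)" "x \<in> carrier M" "y \<in> carrier M" "a \<in> carrier hahn_ring" for \<alpha> x y a
    using mod_homD[of \<alpha> hahn_ring M Theta] that by auto
  show ?thesis
    unfolding mod_hom_def[of _ M]
  proof (intro CollectI conjI ballI funcsetI)
    fix x y assume xy: "x \<in> carrier M" "y \<in> carrier M"
    show "chi M (x \<oplus> y) = chi M x \<oplus>\<^bsub>dual (dual M)\<^esub> chi M y"
      unfolding chi_def dual_simps(3)[where M = "dual M"] by (rule restrict_ext) (use D(1) xy R.zero_closed in force)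
  next
    fix a x assume ax: "a \<in> carrier hahn_ring" "x \<in> carrier M"
    show "chi M (a \<odot> x) = a \<odot>\<^bsub>dual (dual M)\<^esub> chi M x"
      unfolding chi_def dual_simps(4)[where M = "dual M"] by (rule restrict_ext) (use D(2) ax in force)
  qed (rule chi_closed)
qed

lemma dual_separates:
  assumes N: "submodule N hahn_ring M" and x: "x \<in> carrier M" "x \<notin> N"
  shows "\<exists>\<alpha>\<in>carrier (dual M). (\<forall>n\<in>N. \<alpha> n = \<zero>\<^bsub>Theta\<^esub>) \<and> \<alpha> x \<noteq> \<zero>\<^bsub>Theta\<^esub>"
proof -
  obtain f where f: "f \<in> mod_hom hahn_ring M Theta" "\<forall>n\<in>N. f n = \<zero>\<^bsub>Theta\<^esub>" "f x \<noteq> \<zero>\<^bsub>Theta\<^esub>"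
    using Theta_cogenerator[OF N x] by (elim bexE conjE)
  have "N \<subseteq> carrier M" using N by (simp add: submodule_iff)
  then show ?thesis using f x by (intro bexI[OF _ dual_closed[OF f(1)]]) auto
qed

text \<open>The cogenerator property for the zero submodule.\<close>

lemma chi_inj: "inj_on (chi M) (carrier M)"
proof (rule mod_hom_inj[OF _ chi_hom])
  show "val_module hahn_ring (dual (dual M))"
    using hahn_module.dual_hahn_module[OF dual_hahn_module] by (simp add: hahn_module_def)
  fix x assume x: "x \<in> carrier M" and 0: "chi M x = \<zero>\<^bsub>dual (dual M)\<^esub>"
  show "x = \<zero>"
  proof (rule ccontr)
    assume "x \<noteq> \<zero>"
    moreover have "submodule {\<zero>} hahn_ring M" by (simp add: submodule_iff)
    ultimately obtain \<alpha> where \<alpha>: "\<alpha> \<in> carrier (dual M)" "\<alpha> x \<noteq> \<zero>\<^bsub>Theta\<^esub>"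
      using dual_separates x by blast
    have "chi M x \<alpha> = \<zero>\<^bsub>Theta\<^esub>" unfolding 0 using \<alpha>(1) by simp
    then show False using \<alpha> by (simp add: chi_def)
  qed
qed

text \<open>Since \<open>chi\<close> is always an injective homomorphism, only surjectivity is at
  stake. Here \<phi> is not restricted to extensional functions.\<close>

lemma Theta_reflexive_iff:
  "Theta_reflexive M \<longleftrightarrow>
     (\<forall>\<phi>\<in>mod_hom hahn_ring (dual M) Theta. \<exists>m\<in>carrier M. \<forall>\<alpha>\<in>carrier (dual M). \<phi> \<alpha> = \<alpha> m)"
  (is "_ \<longleftrightarrow> ?rhs")
proof
  assume refl: "Theta_reflexive M"
  show ?rhs
  proof
    fix \<phi> assume "\<phi> \<in> mod_hom hahn_ring (dual M) Theta"
    then have "restrict \<phi> (carrier (dual M)) \<in> carrier (dual (dual M))"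
      by (rule hahn_module.dual_closed[OF dual_hahn_module])
    then obtain m where m: "m \<in> carrier M" "restrict \<phi> (carrier (dual M)) = chi M m"
      using refl unfolding Theta_reflexive_def mod_iso_def bij_betw_def by blast
    have "\<phi> \<alpha> = \<alpha> m" if "\<alpha> \<in> carrier (dual M)" for \<alpha>
      using fun_cong[OF m(2), of \<alpha>] that unfolding chi_def by (simp del: dual_simps)
    then show "\<exists>m\<in>carrier M. \<forall>\<alpha>\<in>carrier (dual M). \<phi> \<alpha> = \<alpha> m" using m(1) by blast
  qed
next
  assume rhs: ?rhs
  have "chi M ` carrier M = carrier (dual (dual M))"
  proof
    show "chi M ` carrier M \<subseteq> carrier (dual (dual M))" using chi_closed by blast
    show "carrier (dual (dual M)) \<subseteq> chi M ` carrier M"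
    proof
      fix \<phi> assume \<phi>: "\<phi> \<in> carrier (dual (dual M))"
      then have "\<phi> \<in> mod_hom hahn_ring (dual M) Theta" unfolding dual_simps(1)[of "dual M"] by blast
      then obtain m where m: "m \<in> carrier M" "\<forall>\<alpha>\<in>carrier (dual M). \<phi> \<alpha> = \<alpha> m" using rhs by blast
      have "\<phi> = chi M m"
        by (rule hahn_module.dual_ext[OF dual_hahn_module \<phi> chi_closed[OF m(1)]])
          (use m(2) in \<open>simp add: chi_def del: dual_simps\<close>)
      then show "\<phi> \<in> chi M ` carrier M" using m(1) by blast
    qed
  qed
  then show "Theta_reflexive M"
    using chi_hom chi_inj by (simp add: Theta_reflexive_def mod_iso_def bij_betw_def)
qed

section \<open>From reflexivity to linear compactness\<close>

definition constant_on :: "('m \<Rightarrow> hahn set) \<Rightarrow> 'm set \<Rightarrow> bool" where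
  "constant_on \<alpha> S \<longleftrightarrow> (\<forall>x\<in>S. \<forall>y\<in>S. \<alpha> x = \<alpha> y)"

text \<open>
  For a chain of cosets, a functional \<open>\<alpha>\<close> constant on some member is sent to that constant value. This
  extends to the whole dual, and the point representing the extension lies in every coset.
\<close>

theorem reflexive_imp_lin_compact:
  assumes refl: "Theta_reflexive M"
  shows "lin_compact hahn_ring M"
  unfolding lin_compact_def
proof (intro allI impI, elim conjE)
  fix C assume ne: "C \<noteq> {}" and aff: "\<forall>S\<in>C. affine hahn_ring M S"
    and chain: "\<forall>S\<in>C. \<forall>T\<in>C. S \<subseteq> T \<or> T \<subseteq> S"
  interpret D: hahn_module "dual M" by (rule dual_hahn_module)
  define G where "G = {(\<alpha>, \<alpha> x) | \<alpha> x. \<alpha> \<in> carrier (dual M) \<and> (\<exists>S\<in>C. x \<in> S \<and> constant_on \<alpha> S)}"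
  have SM: "S \<subseteq> carrier M" "S \<noteq> {}" if "S \<in> C" for S using aff that by (auto simp: affine_def)
  have "hom_graph (dual M) G"
    unfolding hom_graph_def
  proof (intro conjI allI impI ballI)
    show "G \<subseteq> carrier (dual M) \<times> carrier Theta"
      using SM dual_apply_closed unfolding G_def by blast
    obtain S x where S: "S \<in> C" "x \<in> S" using ne SM(2) by blast
    have "constant_on \<zero>\<^bsub>dual M\<^esub> S" using SM(1)[OF S(1)] by (auto simp: constant_on_def)
    moreover have "(\<zero>\<^bsub>dual M\<^esub>, \<zero>\<^bsub>Theta\<^esub>) = (\<zero>\<^bsub>dual M\<^esub>, \<zero>\<^bsub>dual M\<^esub> x)" using S SM by auto
    ultimately show "(\<zero>\<^bsub>dual M\<^esub>, \<zero>\<^bsub>Theta\<^esub>) \<in> G" unfolding G_def using S D.M.zero_closed by blast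
  next
    fix \<alpha> s \<beta> t assume "(\<alpha>, s) \<in> G" "(\<beta>, t) \<in> G"
    then obtain x S y T where S: "\<alpha> \<in> carrier (dual M)" "S \<in> C" "x \<in> S" "constant_on \<alpha> S" "s = \<alpha> x"
      and T: "\<beta> \<in> carrier (dual M)" "T \<in> C" "y \<in> T" "constant_on \<beta> T" "t = \<beta> y"
      unfolding G_def by blast
    \<comment> \<open>The smaller of the two cosets serves both functionals; this is where the chain
      condition enters.\<close>
    have "\<exists>z Q. Q \<in> C \<and> z \<in> Q \<and> Q \<subseteq> S \<and> Q \<subseteq> T"
    proof (cases "S \<subseteq> T")
      case True
      then show ?thesis using S by blast
    next
      case False
      then have "T \<subseteq> S" using chain S(2) T(2) by blast
      then show ?thesis using T by blast
    qed
    then obtain z Q where Q: "Q \<in> C" "z \<in> Q" "Q \<subseteq> S" "Q \<subseteq> T" by blast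
    have zM: "z \<in> carrier M" using Q SM by blast
    have "s = \<alpha> z" "t = \<beta> z" using S T Q unfolding constant_on_def by blast+
    then have "(\<alpha> \<oplus>\<^bsub>dual M\<^esub> \<beta>, s \<oplus>\<^bsub>Theta\<^esub> t) = (\<alpha> \<oplus>\<^bsub>dual M\<^esub> \<beta>, (\<alpha> \<oplus>\<^bsub>dual M\<^esub> \<beta>) z)" using zM by simp
    moreover have "constant_on (\<alpha> \<oplus>\<^bsub>dual M\<^esub> \<beta>) Q"
      unfolding constant_on_def
    proof (intro ballI)
      fix u v assume uv: "u \<in> Q" "v \<in> Q"
      have "\<alpha> u = \<alpha> v" "\<beta> u = \<beta> v" using S T Q uv unfolding constant_on_def by blast+
      then show "(\<alpha> \<oplus>\<^bsub>dual M\<^esub> \<beta>) u = (\<alpha> \<oplus>\<^bsub>dual M\<^esub> \<beta>) v" using uv SM(1)[OF Q(1)] by auto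
    qed
    ultimately show "(\<alpha> \<oplus>\<^bsub>dual M\<^esub> \<beta>, s \<oplus>\<^bsub>Theta\<^esub> t) \<in> G"
      unfolding G_def using Q(1,2) D.M.a_closed[OF S(1) T(1)] by blast
  next
    fix a \<alpha> s assume a: "a \<in> carrier hahn_ring" and "(\<alpha>, s) \<in> G"
    then obtain x S where S: "\<alpha> \<in> carrier (dual M)" "S \<in> C" "x \<in> S" "constant_on \<alpha> S" "s = \<alpha> x"
      unfolding G_def by blast
    have xM: "x \<in> carrier M" using S SM by blast
    have "(a \<odot>\<^bsub>dual M\<^esub> \<alpha>, a \<odot>\<^bsub>Theta\<^esub> s) = (a \<odot>\<^bsub>dual M\<^esub> \<alpha>, (a \<odot>\<^bsub>dual M\<^esub> \<alpha>) x)" using xM S(5) by simp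
    moreover have "constant_on (a \<odot>\<^bsub>dual M\<^esub> \<alpha>) S"
      unfolding constant_on_def
    proof (intro ballI)
      fix u v assume uv: "u \<in> S" "v \<in> S"
      have "\<alpha> u = \<alpha> v" using S(4) uv unfolding constant_on_def by blast
      then show "(a \<odot>\<^bsub>dual M\<^esub> \<alpha>) u = (a \<odot>\<^bsub>dual M\<^esub> \<alpha>) v" using uv SM(1)[OF S(2)] by auto
    qed
    ultimately show "(a \<odot>\<^bsub>dual M\<^esub> \<alpha>, a \<odot>\<^bsub>Theta\<^esub> s) \<in> G"
      unfolding G_def using S(2,3) D.smult_closed[OF a S(1)] by blast
  next
    fix s assume "(\<zero>\<^bsub>dual M\<^esub>, s) \<in> G"
    then obtain x S where "S \<in> C" "x \<in> S" "s = \<zero>\<^bsub>dual M\<^esub> x" unfolding G_def by blast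
    then show "s = \<zero>\<^bsub>Theta\<^esub>" using SM by auto
  qed
  from D.Theta_injective[OF this] obtain \<phi> where
    \<phi>: "\<phi> \<in> mod_hom hahn_ring (dual M) Theta" "\<forall>(\<alpha>, s)\<in>G. \<phi> \<alpha> = s" by (elim bexE)
  obtain m where m: "m \<in> carrier M" "\<forall>\<alpha>\<in>carrier (dual M). \<phi> \<alpha> = \<alpha> m"
    using bspec[OF iffD1[OF Theta_reflexive_iff refl] \<phi>(1)] by (elim bexE)
  have key: "\<alpha> m = \<alpha> x" if "\<alpha> \<in> carrier (dual M)" "S \<in> C" "x \<in> S" "constant_on \<alpha> S" for \<alpha> S x
  proof -
    have "(\<alpha>, \<alpha> x) \<in> G" unfolding G_def using that by blast
    then have "\<phi> \<alpha> = \<alpha> x" using \<phi>(2) by auto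
    then show ?thesis using m(2) that(1) by simp
  qed
  have "m \<in> S" if S: "S \<in> C" for S
  proof (rule ccontr)
    assume mS: "m \<notin> S"
    obtain x where x: "x \<in> S" using SM S by blast
    have xM: "x \<in> carrier M" using x SM S by blast
    \<comment> \<open>The submodule of which S is a coset. If m missed S, some \<alpha> would vanish
      on N but not at x + m; being constant on S, it would nevertheless satisfy \<alpha> m =
      \<alpha> x.\<close>
    define N where "N = {y \<in> carrier M. x \<oplus> y \<in> S}"
    have affS: "p \<oplus> a \<odot> (q \<oplus> r) \<in> S" if "p \<in> S" "q \<in> S" "r \<in> S" "a \<in> carrier hahn_ring" for p q r a
      using aff S that by (simp add: affine_def)
    have "submodule N hahn_ring M"
      unfolding submodule_iff
    proof (intro conjI ballI)
      show "N \<subseteq> carrier M" by (auto simp: N_def)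
      show "\<zero> \<in> N" using x xM by (simp add: N_def)
      fix p assume p: "p \<in> N"
      { fix q assume q: "q \<in> N"
        have "(x \<oplus> p) \<oplus> \<one>\<^bsub>hahn_ring\<^esub> \<odot> (x \<oplus> (x \<oplus> q)) \<in> S"
          using affS p q x by (simp add: N_def)
        then show "p \<oplus> q \<in> N" using p q xM by (simp add: N_def M.a_assoc) }
      fix a assume a: "a \<in> carrier hahn_ring"
      have "x \<oplus> a \<odot> (x \<oplus> (x \<oplus> p)) \<in> S" using affS[OF x x _ a] p by (simp add: N_def)
      then show "a \<odot> p \<in> N" using p a xM by (simp add: N_def)
    qed
    moreover have "x \<oplus> m \<in> carrier M" "x \<oplus> m \<notin> N" using xM m mS by (simp_all add: N_def)
    ultimately obtain \<alpha> where \<alpha>: "\<alpha> \<in> carrier (dual M)" "\<forall>n\<in>N. \<alpha> n = \<zero>\<^bsub>Theta\<^esub>" "\<alpha> (x \<oplus> m) \<noteq> \<zero>\<^bsub>Theta\<^esub>"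
      using dual_separates by blast
    have \<alpha>_add: "\<alpha> (p \<oplus> q) = \<alpha> p \<oplus>\<^bsub>Theta\<^esub> \<alpha> q" if "p \<in> carrier M" "q \<in> carrier M" for p q
      using \<alpha>(1) that mod_homD(2)[of \<alpha> hahn_ring M Theta] by simp
    have \<alpha>x: "\<alpha> y = \<alpha> x" if y: "y \<in> S" for y
    proof -
      have yM: "y \<in> carrier M" using y SM S by blast
      have "x \<oplus> y \<in> N" using xM yM y by (simp add: N_def)
      then have "\<alpha> x \<oplus>\<^bsub>Theta\<^esub> \<alpha> y = \<zero>\<^bsub>Theta\<^esub>" using \<alpha>(2) \<alpha>_add[OF xM yM] by simp
      then show ?thesis
        using Theta.add_eq_zero_iff[OF dual_apply_closed[OF \<alpha>(1) xM] dual_apply_closed[OF \<alpha>(1) yM]] by simp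
    qed
    then have "constant_on \<alpha> S" unfolding constant_on_def by (metis)
    then have "\<alpha> m = \<alpha> x" using key \<alpha>(1) S x by blast
    then show False using \<alpha>(3) \<alpha>_add[OF xM m(1)] dual_apply_closed[OF \<alpha>(1) xM] by simp
  qed
  then show "\<Inter>C \<noteq> {}" using ne by blast
qed

end

section \<open>Multibasic modules are reflexive\<close>

text \<open>A fixed non-zero w is divided by scalars cofinal among its divisors. Comparability
  arranges the quotients in a chain, and any further element is a multiple of w or has w as a
  multiple.\<close>

lemma (in basic_val_module) ex_generating_chain:
  "\<exists>x::nat \<Rightarrow> 'c. (\<forall>k. x k \<in> carrier M \<and> (\<exists>d\<in>carrier R. x k = d \<odot> x (Suc k))) \<and> x 0 \<noteq> \<zero> \<and>
     (\<forall>y\<in>carrier M. \<exists>k. \<exists>a\<in>carrier R. y = a \<odot> x k)"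
proof -
  obtain w where w: "w \<in> carrier M" "w \<noteq> \<zero>" using nontrivial by blast
  define H where "H = {a \<in> carrier R. \<exists>x\<in>carrier M. a \<odot> x = w}"
  have "H \<subseteq> carrier R" "H \<noteq> {}" using w R.one_closed smult_one unfolding H_def by blast+
  then obtain c where c: "\<And>k::nat. c k \<in> H" "\<And>k. \<exists>d\<in>carrier R. c (Suc k) = c k \<otimes>\<^bsub>R\<^esub> d"
    and cof: "\<And>h. h \<in> H \<Longrightarrow> \<exists>k. \<exists>d\<in>carrier R. c k = h \<otimes>\<^bsub>R\<^esub> d"
    using cofinal_seq[of H] by blast
  have cR: "c k \<in> carrier R" for k using c(1)[of k] by (simp add: H_def)
  have "\<forall>k. \<exists>x\<in>carrier M. c k \<odot> x = w" using c(1) by (auto simp: H_def)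
  then obtain x where x: "\<And>k. x k \<in> carrier M" "\<And>k. c k \<odot> x k = w" by metis
  \<comment> \<open>Both p and q are quotients of w, and q is the quotient by the larger scalar a e.
    If q is nevertheless a multiple f p, then e f fixes w, so f is a unit and p is a multiple of
    q.\<close>
  have cancel: "\<exists>g\<in>carrier R. p = g \<odot> q"
    if p: "p \<in> carrier M" "q = f \<odot> p" "f \<in> carrier R"
      and e: "a \<odot> p = w" "(a \<otimes>\<^bsub>R\<^esub> e) \<odot> q = w" "a \<in> carrier R" "e \<in> carrier R" for p q f a e
  proof -
    have "(e \<otimes>\<^bsub>R\<^esub> f) \<odot> w = w"
    proof -
      have "(e \<otimes>\<^bsub>R\<^esub> f) \<odot> w = (e \<otimes>\<^bsub>R\<^esub> f) \<odot> (a \<odot> p)" using e by simp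
      also have "\<dots> = (a \<otimes>\<^bsub>R\<^esub> e) \<odot> (f \<odot> p)"
        using p(1,3) e(3,4) by (simp add: R.m_ac flip: smult_assoc1)
      finally show ?thesis using e p by simp
    qed
    then obtain b where b: "b \<in> carrier R" "(e \<otimes>\<^bsub>R\<^esub> f) \<otimes>\<^bsub>R\<^esub> b = \<one>\<^bsub>R\<^esub>"
      using unit_if_fixes[of "e \<otimes>\<^bsub>R\<^esub> f" w] w p(3) e(4) by auto
    have "(e \<otimes>\<^bsub>R\<^esub> b) \<odot> q = ((e \<otimes>\<^bsub>R\<^esub> f) \<otimes>\<^bsub>R\<^esub> b) \<odot> p"
      using p b(1) e(4) by (simp add: R.m_ac flip: smult_assoc1)
    then have "p = (e \<otimes>\<^bsub>R\<^esub> b) \<odot> q" using b p by simp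
    then show ?thesis using b(1) e(4) by blast
  qed
  have step: "\<exists>d\<in>carrier R. x k = d \<odot> x (Suc k)" for k
  proof -
    obtain e where e: "e \<in> carrier R" "c (Suc k) = c k \<otimes>\<^bsub>R\<^esub> e" using c(2) by blast
    consider f where "f \<in> carrier R" "x k = f \<odot> x (Suc k)" | f where "f \<in> carrier R" "x (Suc k) = f \<odot> x k"
      using comparable[OF x(1)[of k] x(1)[of "Suc k"]] by blast
    then show ?thesis
    proof cases
      case (2 f)
      then show ?thesis using cancel[OF x(1)[of k] 2(2,1) x(2)[of k] _ cR e(1)] x(2)[of "Suc k"] e(2) by simp
    qed blast
  qed
  have gen: "\<exists>k. \<exists>a\<in>carrier R. y = a \<odot> x k" if y: "y \<in> carrier M" for y
  proof -
    consider b where "b \<in> carrier R" "y = b \<odot> w" | a where "a \<in> carrier R" "w = a \<odot> y"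
      using comparable[OF y w(1)] by blast
    then show ?thesis
    proof cases
      case (1 b)
      then have "y = (b \<otimes>\<^bsub>R\<^esub> c 0) \<odot> x 0" using x[of 0] cR by (simp add: smult_assoc1)
      then show ?thesis using 1 cR by blast
    next
      case (2 a)
      then have "a \<in> H" using y by (auto simp: H_def)
      then obtain k d where kd: "d \<in> carrier R" "c k = a \<otimes>\<^bsub>R\<^esub> d" using cof by blast
      consider f where "f \<in> carrier R" "y = f \<odot> x k" | f where "f \<in> carrier R" "x k = f \<odot> y"
        using comparable[OF y x(1)[of k]] by blast
      then show ?thesis
      proof cases
        case f: (2 f)
        have "\<exists>g\<in>carrier R. y = g \<odot> x k"
          using cancel[OF y f(2,1) 2(2)[symmetric] _ 2(1) kd(1)] x(2)[of k] kd(2) by simp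
        then show ?thesis by blast
      qed blast
    qed
  qed
  have "x 0 \<noteq> \<zero>" using x(2)[of 0] w cR by auto
  then show ?thesis using x(1) step gen by blast
qed

interpretation K: hahn_module hahn_field_module
  by (intro hahn_module.intro K.val_module_axioms)

context hahn_module
begin

text \<open>Writing \<open>x k = d k \<cdot> x (k + 1)\<close> along a generating chain, \<open>x k\<close> corresponds in \<open>K\<close> to \<open>(d 0 \<cdots> d (k - 1))\<^sup>-\<^sup>1\<close>.\<close>

lemma basic_cover:
  assumes basic: "basic_module hahn_ring M"
  obtains J and p :: "hahn \<Rightarrow> 'm" where "submodule J hahn_ring hahn_field_module" "p ` J = carrier M"
    "\<And>a y. \<lbrakk>a \<in> carrier hahn_ring; y \<in> J\<rbrakk> \<Longrightarrow> p (hahn_mult a y) = a \<odot> p y"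
proof -
  interpret B: basic_val_module hahn_ring M
    using basic by (simp add: basic_val_module_def basic_val_module_axioms_def val_module_axioms)
  obtain x where x: "\<forall>k::nat. x k \<in> carrier M \<and> (\<exists>d\<in>carrier hahn_ring. x k = d \<odot> x (Suc k))"
    and x0: "x 0 \<noteq> \<zero>" and gen: "\<forall>y\<in>carrier M. \<exists>k. \<exists>a\<in>carrier hahn_ring. y = a \<odot> x k"
    using B.ex_generating_chain by (elim exE conjE)
  have xM: "x k \<in> carrier M" for k using x by simp
  have "\<forall>k. \<exists>d\<in>carrier hahn_ring. x k = d \<odot> x (Suc k)" using x by simp
  then obtain d where d: "\<And>k. d k \<in> carrier hahn_ring" "\<And>k. x k = d k \<odot> x (Suc k)" by metis
  define D where "D = rec_nat (monomial 0) (\<lambda>k e. hahn_mult (d k) e)"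
  have D0: "D 0 = monomial 0" and DSuc: "\<And>k. D (Suc k) = hahn_mult (d k) (D k)" by (simp_all add: D_def)
  have DA: "D k \<in> carrier hahn_ring" for k
    by (induction k) (simp_all add: D0 DSuc hahn_ring_mult_closed d(1))
  have smult_mult: "hahn_mult a b \<odot> z = a \<odot> (b \<odot> z)"
    if "a \<in> carrier hahn_ring" "b \<in> carrier hahn_ring" "z \<in> carrier M" for a b z
    using smult_assoc1[OF that] by (simp add: hahn_ring_simps)
  have one_smult: "monomial 0 \<odot> z = z" if "z \<in> carrier M" for z
    using smult_one[OF that] by (simp add: hahn_ring_simps)
  have Dx: "D k \<odot> x k = x 0" for k
  proof (induction k)
    case (Suc k)
    have "D (Suc k) \<odot> x (Suc k) = d k \<odot> (D k \<odot> x (Suc k))"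
      using smult_mult[OF d(1) DA xM] by (simp add: DSuc)
    also have "\<dots> = D k \<odot> (d k \<odot> x (Suc k))" by (rule smult_commute[OF d(1) DA xM])
    finally show ?case using d(2)[of k] Suc by simp
  qed (simp add: D0 one_smult xM)
  have Dnz: "D k \<noteq> (\<lambda>_. 0)" for k
  proof
    assume "D k = (\<lambda>_. 0)"
    then have "D k \<odot> x k = \<zero>" using smult_l_null[OF xM] by (simp add: hahn_ring_simps)
    then show False using Dx x0 by simp
  qed
  \<comment> \<open>The fractional ideal generated by the inverses of all D k, written without
    inverses.\<close>
  define J where "J = {y \<in> hahn_series. \<exists>k. hahn_mult (D k) y \<in> carrier hahn_ring}"
  \<comment> \<open>Intended to send the inverse of D k to x k. Every admissible k gives the same
    value; the least one is taken only to have a definite choice.\<close>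
  define p where "p y = (let k = (LEAST k. hahn_mult (D k) y \<in> carrier hahn_ring) in hahn_mult (D k) y \<odot> x k)" for y
  have up: "hahn_mult (D l) y \<in> carrier hahn_ring \<and> hahn_mult (D l) y \<odot> x l = hahn_mult (D k) y \<odot> x k"
    if y: "y \<in> hahn_series" "hahn_mult (D k) y \<in> carrier hahn_ring" and "k \<le> l" for y k l
    using \<open>k \<le> l\<close>
  proof (induction l rule: dec_induct)
    case (step l)
    have eq: "hahn_mult (D (Suc l)) y = hahn_mult (d l) (hahn_mult (D l) y)"
      using hahn_mult_assoc[OF hahn_ring_subset[OF d(1)] hahn_ring_subset[OF DA] y(1)] by (simp add: DSuc)
    have A: "hahn_mult (D l) y \<in> carrier hahn_ring" using step by blast
    have "hahn_mult (D (Suc l)) y \<odot> x (Suc l) = hahn_mult (D l) y \<odot> (d l \<odot> x (Suc l))"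
      unfolding eq using smult_mult[OF d(1) A xM] smult_commute[OF d(1) A xM] by simp
    then show ?case using step d(2)[of l] hahn_ring_mult_closed[OF d(1) A] by (simp add: eq)
  qed (use y in blast)
  have p_eq: "p y = hahn_mult (D k) y \<odot> x k" if "y \<in> hahn_series" "hahn_mult (D k) y \<in> carrier hahn_ring" for y k
  proof -
    let ?l = "LEAST k. hahn_mult (D k) y \<in> carrier hahn_ring"
    have "hahn_mult (D ?l) y \<in> carrier hahn_ring" "?l \<le> k" using that(2) by (auto intro: LeastI Least_le)
    then show ?thesis using up[OF that(1), of ?l k] by (simp add: p_def Let_def)
  qed
  have D_comm: "hahn_mult (D k) (hahn_mult a y) = hahn_mult a (hahn_mult (D k) y)"
    if "a \<in> carrier hahn_ring" "y \<in> hahn_series" for a k y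
    using that hahn_ring_subset[OF DA] hahn_ring_subset hahn_mult_comm
    by (metis hahn_mult_assoc)
  show thesis
  proof (rule that[of J p])
    show "submodule J hahn_ring hahn_field_module"
      unfolding K.submodule_iff
    proof (intro conjI ballI)
      show "J \<subseteq> carrier hahn_field_module" by (auto simp: J_def)
      show "\<zero>\<^bsub>hahn_field_module\<^esub> \<in> J"
        using hahn_zero_closed by (simp add: J_def carrier_hahn_ring)
      fix y assume "y \<in> J"
      then obtain k where k: "y \<in> hahn_series" "hahn_mult (D k) y \<in> carrier hahn_ring" by (auto simp: J_def)
      { fix z assume "z \<in> J"
        then obtain l where l: "z \<in> hahn_series" "hahn_mult (D l) z \<in> carrier hahn_ring" by (auto simp: J_def)
        let ?m = "max k l"
        have "hahn_mult (D ?m) y \<oplus>\<^bsub>hahn_ring\<^esub> hahn_mult (D ?m) z \<in> carrier hahn_ring"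
          using up[OF k, of ?m] up[OF l, of ?m] by (intro R.a_closed) simp_all
        then have "hahn_mult (D ?m) (\<lambda>q. y q + z q) \<in> carrier hahn_ring"
          using hahn_mult_add_right[OF hahn_ring_subset[OF DA] k(1) l(1), of ?m] by (simp add: hahn_ring_simps)
        then show "y \<oplus>\<^bsub>hahn_field_module\<^esub> z \<in> J" using k l hahn_add_closed unfolding J_def by auto }
      fix a assume a: "a \<in> carrier hahn_ring"
      then show "a \<odot>\<^bsub>hahn_field_module\<^esub> y \<in> J"
        using D_comm[OF a k(1), of k] hahn_ring_mult_closed[OF a k(2)] hahn_mult_closed[OF hahn_ring_subset[OF a] k(1)]
        unfolding J_def by (auto intro!: exI[of _ k])
    qed
    show "p (hahn_mult a y) = a \<odot> p y" if a: "a \<in> carrier hahn_ring" and "y \<in> J" for a y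
    proof -
      obtain k where k: "y \<in> hahn_series" "hahn_mult (D k) y \<in> carrier hahn_ring" using \<open>y \<in> J\<close> by (auto simp: J_def)
      have "hahn_mult (D k) (hahn_mult a y) \<in> carrier hahn_ring"
        unfolding D_comm[OF a k(1)] by (rule hahn_ring_mult_closed[OF a k(2)])
      then have "p (hahn_mult a y) = hahn_mult (D k) (hahn_mult a y) \<odot> x k"
        by (rule p_eq[OF hahn_mult_closed[OF hahn_ring_subset[OF a] k(1)]])
      also have "\<dots> = a \<odot> p y"
        unfolding D_comm[OF a k(1)] p_eq[OF k] by (rule smult_mult[OF a k(2) xM])
      finally show ?thesis .
    qed
    show "p ` J = carrier M"
    proof
      show "p ` J \<subseteq> carrier M" using p_eq xM by (auto simp: J_def)
      show "carrier M \<subseteq> p ` J"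
      proof
        fix z assume "z \<in> carrier M"
        then obtain k a where a: "a \<in> carrier hahn_ring" "z = a \<odot> x k" using gen by blast
        \<comment> \<open>The inverse of D k in K is the preimage of x k.\<close>
        obtain e where e: "e \<in> hahn_series" "hahn_mult (D k) e = monomial 0"
          using hahn_field_inverse[OF hahn_ring_subset[OF DA] Dnz] by blast
        have ae: "hahn_mult a e \<in> hahn_series" using hahn_mult_closed[OF hahn_ring_subset[OF a(1)] e(1)] .
        have "hahn_mult (D k) (hahn_mult a e) = hahn_mult a (monomial 0)"
          using D_comm[OF a(1) e(1)] e(2) by simp
        also have "\<dots> = a" using hahn_mult_comm[OF hahn_ring_subset[OF a(1)], of "monomial 0"] by simp
        finally have *: "hahn_mult (D k) (hahn_mult a e) = a" .
        then have "p (hahn_mult a e) = z" using p_eq[OF ae, of k] a by simp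
        moreover have "hahn_mult a e \<in> J" using ae * a(1) unfolding J_def by (auto intro: exI[of _ k])
        ultimately show "z \<in> p ` J" by blast
      qed
    qed
  qed
qed

text \<open>M is covered by a submodule J of K through p, and functionals on M come from those x in
  K for which multiplication by x factors through p. So \<phi> turns into a homomorphism from a
  submodule of K to \<Theta>, that is, into multiplication by some z; once z is known to lie in J,
  the representing element is p z.\<close>

theorem basic_imp_reflexive:
  assumes basic: "basic_module hahn_ring M"
  shows "Theta_reflexive M"
  unfolding Theta_reflexive_iff
proof
  fix \<phi> assume \<phi>: "\<phi> \<in> mod_hom hahn_ring (dual M) Theta"
  interpret D: hahn_module "dual M" by (rule dual_hahn_module)
  note \<phi>D = mod_homD[OF \<phi>]
  obtain J and p :: "hahn \<Rightarrow> 'm" where J: "submodule J hahn_ring hahn_field_module" and p: "p ` J = carrier M"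
    and p_smult: "\<And>a y. \<lbrakk>a \<in> carrier hahn_ring; y \<in> J\<rbrakk> \<Longrightarrow> p (hahn_mult a y) = a \<odot> p y"
    by (rule basic_cover[OF basic]) (rule that)
  have JK: "y \<in> hahn_series" if "y \<in> J" for y using J that by (auto simp: K.submodule_iff)
  have pM: "p y \<in> carrier M" if "y \<in> J" for y using p that by blast
  \<comment> \<open>\<open>x \<in> K\<close> represents \<open>\<alpha>\<close> if multiplication by \<open>x\<close> induces \<open>\<alpha>\<close> along \<open>p\<close>\<close>
  define rep where "rep x \<alpha> \<longleftrightarrow> x \<in> hahn_series \<and> \<alpha> \<in> carrier (dual M) \<and> (\<forall>y\<in>J. theta (hahn_mult x y) = \<alpha> (p y))" for x \<alpha>
  have rep_unique: "\<alpha> = \<beta>" if "rep x \<alpha>" "rep x \<beta>" for x \<alpha> \<beta>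
  proof (rule dual_ext)
    show "\<alpha> \<in> carrier (dual M)" "\<beta> \<in> carrier (dual M)" using that by (simp_all add: rep_def del: dual_simps)
    fix m assume "m \<in> carrier M"
    then obtain y where "y \<in> J" "m = p y" using p by blast
    then show "\<alpha> m = \<beta> m" using that unfolding rep_def by metis
  qed
  have rep_ex: "\<exists>x. rep x \<alpha>" if \<alpha>: "\<alpha> \<in> carrier (dual M)" for \<alpha>
  proof -
    have hom: "\<alpha> \<in> mod_hom hahn_ring M Theta" using \<alpha> by simp
    have "\<exists>x\<in>hahn_series. \<forall>y\<in>J. \<alpha> (p y) = theta (hahn_mult y x)"
      using mod_homD(1)[OF hom] mod_homD(3)[OF hom] pM p_smult
      by (intro hom_to_Theta_is_multiplication[OF J]) auto
    then obtain x where x: "x \<in> hahn_series" "\<forall>y\<in>J. \<alpha> (p y) = theta (hahn_mult y x)" by blast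
    then have "rep x \<alpha>" using \<alpha> JK hahn_mult_comm[OF x(1)] by (auto simp: rep_def)
    then show ?thesis by blast
  qed
  have rep_zero: "rep x \<zero>\<^bsub>dual M\<^esub>" if "x \<in> hahn_series" "\<And>y. y \<in> J \<Longrightarrow> theta (hahn_mult x y) = \<zero>\<^bsub>Theta\<^esub>" for x
    using that D.M.zero_closed pM by (simp add: rep_def)
  have rep_add: "rep (\<lambda>q. x q + x' q) (\<alpha> \<oplus>\<^bsub>dual M\<^esub> \<alpha>')" if r: "rep x \<alpha>" "rep x' \<alpha>'" for x \<alpha> x' \<alpha>'
  proof -
    have "\<alpha> \<oplus>\<^bsub>dual M\<^esub> \<alpha>' \<in> carrier (dual M)" using r unfolding rep_def by (intro D.M.a_closed) blast+
    moreover have "theta (hahn_mult (\<lambda>q. x q + x' q) y) = (\<alpha> \<oplus>\<^bsub>dual M\<^esub> \<alpha>') (p y)" if y: "y \<in> J" for y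
    proof -
      have "theta (hahn_mult (\<lambda>q. x q + x' q) y) = theta (hahn_mult x y) \<oplus>\<^bsub>Theta\<^esub> theta (hahn_mult x' y)"
        using r JK[OF y] by (simp add: rep_def hahn_mult_add_left Theta_add hahn_mult_closed)
      then show ?thesis using r y pM[OF y] by (simp add: rep_def)
    qed
    ultimately show ?thesis using r hahn_add_closed unfolding rep_def by blast
  qed
  have rep_smult: "rep (hahn_mult a x) (a \<odot>\<^bsub>dual M\<^esub> \<alpha>)" if a: "a \<in> carrier hahn_ring" and r: "rep x \<alpha>" for a x \<alpha>
  proof -
    have "a \<odot>\<^bsub>dual M\<^esub> \<alpha> \<in> carrier (dual M)" using a r unfolding rep_def by (intro D.smult_closed) blast+
    moreover have "theta (hahn_mult (hahn_mult a x) y) = (a \<odot>\<^bsub>dual M\<^esub> \<alpha>) (p y)" if y: "y \<in> J" for y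
    proof -
      have "theta (hahn_mult (hahn_mult a x) y) = a \<odot>\<^bsub>Theta\<^esub> theta (hahn_mult x y)"
        using r JK[OF y] a hahn_ring_subset[OF a] by (simp add: rep_def hahn_mult_assoc Theta_smult hahn_mult_closed)
      then show ?thesis using r y pM[OF y] by (simp add: rep_def)
    qed
    ultimately show ?thesis using r hahn_mult_closed[OF hahn_ring_subset[OF a]] unfolding rep_def by blast
  qed
  \<comment> \<open>The x in K that induce some functional. Several x may induce the same one, but
    each x induces only one, so \<Psi> is well defined on W.\<close>
  define W where "W = {x. \<exists>\<alpha>. rep x \<alpha>}"
  define \<Psi> where "\<Psi> x = \<phi> (SOME \<alpha>. rep x \<alpha>)" for x
  have \<Psi>: "\<Psi> x = \<phi> \<alpha>" if "rep x \<alpha>" for x \<alpha>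
    using rep_unique[OF someI[of "rep x", OF that] that] by (simp add: \<Psi>_def)
  have rep_dual: "\<alpha> \<in> carrier (dual M)" if "rep x \<alpha>" for x \<alpha> using that unfolding rep_def by blast
  have "submodule W hahn_ring hahn_field_module"
    unfolding K.submodule_iff
  proof (intro conjI ballI)
    show "W \<subseteq> carrier hahn_field_module" by (auto simp: W_def rep_def)
    have "rep (\<lambda>_. 0) \<zero>\<^bsub>dual M\<^esub>" by (rule rep_zero) (simp_all add: hahn_zero_closed Theta_zero)
    then show "\<zero>\<^bsub>hahn_field_module\<^esub> \<in> W" by (auto simp: W_def)
    fix x assume x: "x \<in> W"
    show "x \<oplus>\<^bsub>hahn_field_module\<^esub> x' \<in> W" if "x' \<in> W" for x'
      using x that rep_add unfolding W_def hahn_field_module_simps by blast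
    show "a \<odot>\<^bsub>hahn_field_module\<^esub> x \<in> W" if "a \<in> carrier hahn_ring" for a
      using x rep_smult[OF that] unfolding W_def hahn_field_module_simps by blast
  qed
  then have "\<exists>z\<in>hahn_series. \<forall>x\<in>W. \<Psi> x = theta (hahn_mult x z)"
  proof (rule hom_to_Theta_is_multiplication)
    fix x assume "x \<in> W"
    then obtain \<alpha> where \<alpha>: "rep x \<alpha>" by (auto simp: W_def)
    show "\<Psi> x \<in> carrier Theta" using \<Psi>[OF \<alpha>] \<phi>D(1)[OF rep_dual[OF \<alpha>]] by simp
    fix a assume a: "a \<in> carrier hahn_ring"
    show "\<Psi> (hahn_mult a x) = a \<odot>\<^bsub>Theta\<^esub> \<Psi> x"
      using \<Psi>[OF rep_smult[OF a \<alpha>]] \<Psi>[OF \<alpha>] \<phi>D(3)[OF a rep_dual[OF \<alpha>]] by simp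
  qed
  then obtain z where z: "z \<in> hahn_series" "\<And>x. x \<in> W \<Longrightarrow> \<Psi> x = theta (hahn_mult x z)" by blast
  \<comment> \<open>Otherwise multiplication by some x in K sends J to zero in \<Theta> but not z.
    Such an x represents the zero functional, so x z would have to vanish in \<Theta> as
    well.\<close>
  have zJ: "z \<in> J"
  proof (rule ccontr)
    assume "z \<notin> J"
    then obtain f where f: "f \<in> mod_hom hahn_ring hahn_field_module Theta" "\<forall>y\<in>J. f y = \<zero>\<^bsub>Theta\<^esub>" "f z \<noteq> \<zero>\<^bsub>Theta\<^esub>"
      using K.Theta_cogenerator[OF J, of z] z(1) by auto
    have "\<exists>x\<in>hahn_series. \<forall>y\<in>carrier hahn_field_module. f y = theta (hahn_mult y x)"
      using mod_homD[OF f(1)] by (intro hom_to_Theta_is_multiplication K.carrier_is_submodule) auto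
    then obtain x where x: "x \<in> hahn_series" "\<And>y. y \<in> hahn_series \<Longrightarrow> f y = theta (hahn_mult x y)"
      using hahn_mult_comm by fastforce
    have r: "rep x \<zero>\<^bsub>dual M\<^esub>" using rep_zero[OF x(1)] x(2) f(2) JK by simp
    then have "x \<in> W" by (auto simp: W_def)
    then have "f z = \<Psi> x" using x(2) z by simp
    also have "\<dots> = \<phi> \<zero>\<^bsub>dual M\<^esub>" by (rule \<Psi>[OF r])
    also have "\<dots> = \<zero>\<^bsub>Theta\<^esub>" by (rule D.mod_hom_zero[OF Theta.module_axioms \<phi>])
    finally show False using f(3) by simp
  qed
  have "\<phi> \<alpha> = \<alpha> (p z)" if \<alpha>: "\<alpha> \<in> carrier (dual M)" for \<alpha>
  proof -
    obtain x where r: "rep x \<alpha>" using rep_ex[OF \<alpha>] by blast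
    then have "x \<in> W" by (auto simp: W_def)
    then have "\<phi> \<alpha> = theta (hahn_mult x z)" using z(2) \<Psi>[OF r] by simp
    also have "\<dots> = \<alpha> (p z)" using r zJ by (simp add: rep_def)
    finally show ?thesis .
  qed
  then show "\<exists>m\<in>carrier M. \<forall>\<alpha>\<in>carrier (dual M). \<phi> \<alpha> = \<alpha> m" using pM[OF zJ] by blast
qed

text \<open>Composition with the component maps carries functionals on each summand to functionals
  on M. On these \<phi> is evaluation at some \<open>m i\<close>. Every \<alpha> is the sum of its
  lifted restrictions, so \<phi> is evaluation at the sum of the \<open>m i\<close>.\<close>

theorem direct_sum_reflexive:
  assumes ds: "is_direct_sum hahn_ring M n N"
    and refl: "\<And>i. i < n \<Longrightarrow> Theta_reflexive (M\<lparr>carrier := N i\<rparr>)"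
  shows "Theta_reflexive M"
  unfolding Theta_reflexive_iff
proof
  fix \<phi> assume \<phi>: "\<phi> \<in> mod_hom hahn_ring (dual M) Theta"
  interpret D: hahn_module "dual M" by (rule dual_hahn_module)
  note \<phi>D = mod_homD[OF \<phi>]
  let ?c = "component N n"
  define lift where "lift i \<beta> = (\<lambda>x\<in>carrier M. \<beta> (?c i x))" for i and \<beta> :: "'m \<Rightarrow> hahn set"
  have NM: "x \<in> carrier M" if "x \<in> N i" "i < n" for x i using summand_closed[OF ds that] .
  have cN: "?c i x \<in> N i" if "i < n" "x \<in> carrier M" for i x using component_sum(1)[OF ds] that by blast
  have lift: "lift i \<beta> \<in> carrier (dual M)"
    if "i < n" "\<beta> \<in> mod_hom hahn_ring (M\<lparr>carrier := N i\<rparr>) Theta" for i \<beta>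
    unfolding lift_def by (intro dual_closed mod_hom_compose[OF component_hom[OF ds that(1)] that(2)])
  have "\<exists>m\<in>N i. \<forall>\<beta>\<in>carrier (dual (M\<lparr>carrier := N i\<rparr>)). \<phi> (lift i \<beta>) = \<beta> m" if i: "i < n" for i
  proof -
    interpret Ni: hahn_module "M\<lparr>carrier := N i\<rparr>"
      by (intro hahn_module.intro submodule_val_module summand_submodule[OF ds i])
    have "(\<lambda>\<beta>. \<phi> (lift i \<beta>)) \<in> mod_hom hahn_ring (dual (M\<lparr>carrier := N i\<rparr>)) Theta"
      unfolding mod_hom_def[of _ "dual _"]
    proof (intro CollectI conjI ballI funcsetI)
      fix \<beta> assume \<beta>: "\<beta> \<in> carrier (dual (M\<lparr>carrier := N i\<rparr>))"
      then have l: "lift i \<beta> \<in> carrier (dual M)" by (intro lift[OF i]) simp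
      show "\<phi> (lift i \<beta>) \<in> carrier Theta" by (rule \<phi>D(1)[OF l])
      { fix \<gamma> assume \<gamma>: "\<gamma> \<in> carrier (dual (M\<lparr>carrier := N i\<rparr>))"
        then have l': "lift i \<gamma> \<in> carrier (dual M)" by (intro lift[OF i]) simp
        have "lift i (\<beta> \<oplus>\<^bsub>dual (M\<lparr>carrier := N i\<rparr>)\<^esub> \<gamma>) = lift i \<beta> \<oplus>\<^bsub>dual M\<^esub> lift i \<gamma>"
          using cN[OF i] by (auto simp: lift_def intro!: restrict_ext)
        then show "\<phi> (lift i (\<beta> \<oplus>\<^bsub>dual (M\<lparr>carrier := N i\<rparr>)\<^esub> \<gamma>)) = \<phi> (lift i \<beta>) \<oplus>\<^bsub>Theta\<^esub> \<phi> (lift i \<gamma>)"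
          using \<phi>D(2)[OF l l'] by simp }
      { fix a assume a: "a \<in> carrier hahn_ring"
        have "lift i (a \<odot>\<^bsub>dual (M\<lparr>carrier := N i\<rparr>)\<^esub> \<beta>) = a \<odot>\<^bsub>dual M\<^esub> lift i \<beta>"
          using cN[OF i] by (auto simp: lift_def intro!: restrict_ext)
        then show "\<phi> (lift i (a \<odot>\<^bsub>dual (M\<lparr>carrier := N i\<rparr>)\<^esub> \<beta>)) = a \<odot>\<^bsub>Theta\<^esub> \<phi> (lift i \<beta>)"
          using \<phi>D(3)[OF a l] by simp }
    qed
    from bspec[OF iffD1[OF Ni.Theta_reflexive_iff refl[OF i]] this] show ?thesis by simp
  qed
  then obtain m where m: "\<And>i. i < n \<Longrightarrow> m i \<in> N i"
    "\<And>i \<beta>. \<lbrakk>i < n; \<beta> \<in> carrier (dual (M\<lparr>carrier := N i\<rparr>))\<rbrakk> \<Longrightarrow> \<phi> (lift i \<beta>) = \<beta> (m i)" by metis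
  have mM: "m i \<in> carrier M" if "i < n" for i using m(1) NM that by blast
  define s where "s = (\<Oplus>i\<in>{..<n}. m i)"
  have sM: "s \<in> carrier M" unfolding s_def using mM by (intro M.finsum_closed) auto
  have "\<phi> \<alpha> = \<alpha> s" if \<alpha>: "\<alpha> \<in> carrier (dual M)" for \<alpha>
  proof -
    have hom: "\<alpha> \<in> mod_hom hahn_ring M Theta" using \<alpha> by simp
    define \<beta> where "\<beta> i = restrict \<alpha> (N i)" for i
    have \<beta>: "\<beta> i \<in> carrier (dual (M\<lparr>carrier := N i\<rparr>))" if "i < n" for i
      using mod_homD[OF hom] NM[OF _ that] summand_submodule[OF ds that]
      by (auto simp: \<beta>_def mod_hom_def submodule_iff)
    have l: "lift i (\<beta> i) \<in> carrier (dual M)" if "i < n" for i using lift[OF that] \<beta>[OF that] by simp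
    have "\<alpha> = (\<Oplus>\<^bsub>dual M\<^esub>i\<in>{..<n}. lift i (\<beta> i))"
    proof (rule dual_ext[OF \<alpha>])
      show "(\<Oplus>\<^bsub>dual M\<^esub>i\<in>{..<n}. lift i (\<beta> i)) \<in> carrier (dual M)"
        using l by (intro D.M.finsum_closed) auto
      fix x assume x: "x \<in> carrier M"
      have "\<alpha> x = \<alpha> (\<Oplus>i\<in>{..<n}. ?c i x)" using component_sum(2)[OF ds x] by simp
      also have "\<dots> = (\<Oplus>\<^bsub>Theta\<^esub>i\<in>{..<n}. \<alpha> (?c i x))"
        using cN[OF _ x] NM by (intro hom_finsum[OF Theta.val_module_axioms hom]) blast
      also have "\<dots> = (\<Oplus>\<^bsub>Theta\<^esub>i\<in>{..<n}. lift i (\<beta> i) x)"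
        using x cN[OF _ x] mod_homD(1)[OF hom NM[OF cN[OF _ x]]]
        by (intro Theta.M.finsum_cong') (auto simp: lift_def \<beta>_def)
      also have "\<dots> = (\<Oplus>\<^bsub>dual M\<^esub>i\<in>{..<n}. lift i (\<beta> i)) x"
        using l by (intro D.hom_finsum[OF Theta.val_module_axioms eval_hom[OF x], symmetric]) blast
      finally show "\<alpha> x = (\<Oplus>\<^bsub>dual M\<^esub>i\<in>{..<n}. lift i (\<beta> i)) x" .
    qed
    then have "\<phi> \<alpha> = (\<Oplus>\<^bsub>Theta\<^esub>i\<in>{..<n}. \<phi> (lift i (\<beta> i)))"
      using D.hom_finsum[OF Theta.val_module_axioms \<phi>, of n "\<lambda>i. lift i (\<beta> i)"] l by simp
    also have "\<dots> = (\<Oplus>\<^bsub>Theta\<^esub>i\<in>{..<n}. \<alpha> (m i))"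
      using m \<beta> mM mod_homD(1)[OF hom] by (intro Theta.M.finsum_cong') (auto simp: \<beta>_def)
    also have "\<dots> = \<alpha> s"
      unfolding s_def using mM by (intro hom_finsum[OF Theta.val_module_axioms hom, symmetric])
    finally show ?thesis .
  qed
  then show "\<exists>m\<in>carrier M. \<forall>\<alpha>\<in>carrier (dual M). \<phi> \<alpha> = \<alpha> m" using sM by blast
qed

lemma multibasic_imp_reflexive:
  assumes "multibasic hahn_ring M"
  shows "Theta_reflexive M"
proof -
  obtain n N where N: "is_direct_sum hahn_ring M n N"
    "\<And>i. i < n \<Longrightarrow> basic_module hahn_ring (M\<lparr>carrier := N i\<rparr>)"
    using assms unfolding multibasic_def basic_decomposition_def by blast
  have "Theta_reflexive (M\<lparr>carrier := N i\<rparr>)" if i: "i < n" for i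
  proof -
    interpret Ni: hahn_module "M\<lparr>carrier := N i\<rparr>"
      by (intro hahn_module.intro submodule_val_module summand_submodule[OF N(1) i])
    show ?thesis by (rule Ni.basic_imp_reflexive[OF N(2)[OF i]])
  qed
  then show ?thesis by (rule direct_sum_reflexive[OF N(1)])
qed

end

theorem theorem2p1p14:
  fixes M :: "(hahn, 'm, 'x) module_scheme"
  assumes "Module.module hahn_ring M"
  shows "(Theta_reflexive M \<longleftrightarrow> multibasic hahn_ring M) \<and>
    (\<forall>m n P N. basic_decomposition hahn_ring M m P \<and> basic_decomposition hahn_ring M n N \<longrightarrow>
       m = n \<and>
       (\<exists>\<sigma>. \<sigma> permutes {..<n} \<and>
          (\<forall>i<n. mod_isomorphic hahn_ring
                  (M\<lparr>carrier := P i\<rparr>) (M\<lparr>carrier := N (\<sigma> i)\<rparr>))))"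
proof -
  interpret hahn_module M
    by (intro hahn_module.intro val_module.intro hahn_ring_val_ring assms)
  show ?thesis
    using lin_compact_imp_multibasic[OF reflexive_imp_lin_compact] multibasic_imp_reflexive
      basic_decomposition_unique by blast
qed

end
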